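(* Let $(\mathcal{C},\mathcal{W})$ and $(\mathcal{D},\mathrm{E})$ be relative categories closed by finite coproducts which are homotopically equivalent. If $(\mathcal{D},\mathrm{E})$ is a simplicial descent category, then so is $(\mathcal{C},\mathcal{W})$, i.e. $(\mathcal{C},\mathcal{W})$ admits a simplicial descent structure.
   Context: **Homotopical equivalences.** A homotopical equivalence between relative categories $(\mathcal{C},\mathcal{W})$ and $(\mathcal{D},\mathrm{E})$ consists of functors $F:\mathcal{C}\to\mathcal{D}$, $G:\mathcal{D}\to\mathcal{C}$ with $F(\mathcal{W})\subset\mathrm{E}$, $G(\mathrm{E})\subset\mathcal{W}$, and zigzags of natural weak equivalences $FG\dashrightarrow1_{\mathcal{D}}$ and $GF\dashrightarrow1_{\mathcal{C}}$. The two relative categories are homotopically equivalent if such a homotopical equivalence exists. **Simplicial descent categories.** $\Delta$ is the category of ordered sets $[n]=\{0,\dots,n\}$ and order preserving maps. $\Delta^{op}\mathcal{D}$ is the category of simplicial objects in $\mathcal{D}$; $c(A)$ is the constant simplicial object on $A$; $\mathrm{D}(Z)_n=Z_{n,n}$ is the diagonal of a bisimplicial object. If $\mathcal D$ has finite coproducts and $K$ is a simplicial finite set, $(X\boxtimes K)_n=\coprod_{K_n}X_n$; the map $d^0:[0]\to[1]$ induces $d_0^X:X\to X\boxtimes\Delta[1]$, and we write $A$ for $c(A)$. A class $\mathrm{E}$ of morphisms of $\mathcal{D}$ is saturated if it consists of exactly the morphisms that become invertible in $\mathcal{D}[\mathrm{E}^{-1}]$. A relative category $(\mathcal{D},\mathrm{E})$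 is a category with a saturated class of morphisms (weak equivalences); it is closed by finite coproducts if $\mathcal{D}$ has an initial object and finite coproducts, and $f\sqcup g\in\mathrm{E}$ whenever $f,g\in\mathrm{E}$. A zigzag of natural weak equivalences $F\dashrightarrow G$ is a finite chain of natural transformations, in either direction, connecting $F$ to $G$, each objectwise in $\mathrm{E}$; $Fun(\mathcal{C},\mathcal{D})[\mathrm{E}^{-1}]$ is the localization at the objectwise weak equivalences. A simplicial descent structure on a relative category $(\mathcal{D},\mathrm{E})$ closed by finite coproducts is a triple $(\mathbf{s},\mu,\lambda)$ with: (S1) $\mathbf{s}:\Delta^{op}\mathcal{D}\to\mathcal{D}$ is a functor (the simple functor) such that $\mathbf{s}(X)\sqcup\mathbf{s}(Y)\to\mathbf{s}(X\sqcup Y)$ is in $\mathrm{E}$ for all $X,Y$. (S2) $\mu:\mathbf{s}\circ\mathrm{D}\dashrightarrow\mathbf{s}\circ\mathbf{s}$ is a zigzag of natural weak equivalences, where $\mathbf{s}\mathbf{s}(Z)=\mathbf{s}(n\mapsto\mathbf{s}(m\mapsto Z_{n,m}))$. (S3) $\lambda:\mathbf{s}\circ c\dashrightarrow 1_{\mathcal{D}}$ is a zigzag of natural weak equivalences compatible with $\mu$: with $(X\times\Delta)_{n,m}=X_n$, $(\Delta\times X)_{n,m}=X_m$, the composites $\mathbf{s}(X)\xrightarrow{\mu_{\Delta\times X}}\mathbf{s}c\mathbf{s}(X)\xrightarrow{\lambda_{\mathbf{s}(X)}}\mathbf{s}(X)$ and $\mathbf{s}(X)\xrightarrow{\mu_{X\times\Delta}}\mathbf{s}(n\mapsto\mathbf{s}c(X_n))\xrightarrow{\mathbf{s}(\lambda_X)}\mathbf{s}(X)$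 are the identity in $Fun(\Delta^{op}\mathcal{D},\mathcal{D})[\mathrm{E}^{-1}]$. (S4) If $f:X\to Y$ in $\Delta^{op}\mathcal{D}$ has $f_n\in\mathrm{E}$ for all $n$, then $\mathbf{s}(f)\in\mathrm{E}$. (S5) $\mathbf{s}(d_0^A:A\to A\boxtimes\Delta[1])\in\mathrm{E}$ for each object $A$ of $\mathcal{D}$. A simplicial descent category is a relative category closed by finite coproducts endowed with a simplicial descent structure. *)

theory Defs
  imports Main "HOL-Library.FuncSet"
begin

section \<open>Categories, functors, natural transformations\<close>

record ('o, 'm) category =
  Obj :: "'o set"
  Arr :: "'m set"
  Dom :: "'m \<Rightarrow> 'o"
  Cod :: "'m \<Rightarrow> 'o"
  Ide :: "'o \<Rightarrow> 'm"
  Comp :: "'m \<Rightarrow> 'm \<Rightarrow> 'm" (infixr "\<cdot>\<index>" 70)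

definition hom :: "('o, 'm) category \<Rightarrow> 'o \<Rightarrow> 'o \<Rightarrow> 'm set" where
  "hom C a b = {f \<in> Arr C. Dom C f = a \<and> Cod C f = b}"

locale category =
  fixes C :: "('o, 'm) category" (structure)
  assumes dom_in_Obj: "f \<in> Arr C \<Longrightarrow> Dom C f \<in> Obj C"
    and cod_in_Obj: "f \<in> Arr C \<Longrightarrow> Cod C f \<in> Obj C"
    and ide_in_hom: "a \<in> Obj C \<Longrightarrow> Ide C a \<in> hom C a a"
    and comp_in_hom: "f \<in> hom C a b \<Longrightarrow> g \<in> hom C b c \<Longrightarrow> g \<cdot> f \<in> hom C a c"
    and comp_ide_right: "f \<in> hom C a b \<Longrightarrow> f \<cdot> Ide C a = f"
    and comp_ide_left: "f \<in> hom C a b \<Longrightarrow> Ide C b \<cdot> f = f"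
    and comp_assoc: "f \<in> hom C a b \<Longrightarrow> g \<in> hom C b c \<Longrightarrow> h \<in> hom C c d
      \<Longrightarrow> (h \<cdot> g) \<cdot> f = h \<cdot> (g \<cdot> f)"

definition is_iso :: "('o, 'm) category \<Rightarrow> 'm \<Rightarrow> bool" where
  "is_iso C f \<longleftrightarrow> f \<in> Arr C \<and>
     (\<exists>g \<in> hom C (Cod C f) (Dom C f).
        g \<cdot>\<^bsub>C\<^esub> f = Ide C (Dom C f) \<and> f \<cdot>\<^bsub>C\<^esub> g = Ide C (Cod C f))"

definition opp :: "('o, 'm) category \<Rightarrow> ('o, 'm) category" where
  "opp C = \<lparr>Obj = Obj C, Arr = Arr C, Dom = Cod C, Cod = Dom C, Ide = Ide C,
            Comp = (\<lambda>g f. f \<cdot>\<^bsub>C\<^esub> g)\<rparr>"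

text \<open>Functors record their source and target, and their two maps are extensional
  (\<open>undefined\<close> outside the objects resp. arrows of the source), so that equality of
  functors is HOL equality. The same applies to natural transformations.\<close>

record ('o1, 'm1, 'o2, 'm2) func =
  Src :: "('o1, 'm1) category"
  Tgt :: "('o2, 'm2) category"
  OMap :: "'o1 \<Rightarrow> 'o2"
  AMap :: "'m1 \<Rightarrow> 'm2"

definition is_functor ::
  "('o1, 'm1) category \<Rightarrow> ('o2, 'm2) category \<Rightarrow> ('o1, 'm1, 'o2, 'm2) func \<Rightarrow> bool" where
  "is_functor C D F \<longleftrightarrow> category C \<and> category D \<and> Src F = C \<and> Tgt F = D \<and>
     OMap F \<in> Obj C \<rightarrow>\<^sub>E Obj D \<and> AMap F \<in> Arr C \<rightarrow>\<^sub>E Arr D \<and>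
     (\<forall>f \<in> Arr C. Dom D (AMap F f) = OMap F (Dom C f) \<and> Cod D (AMap F f) = OMap F (Cod C f)) \<and>
     (\<forall>a \<in> Obj C. AMap F (Ide C a) = Ide D (OMap F a)) \<and>
     (\<forall>f \<in> Arr C. \<forall>g \<in> Arr C. Cod C f = Dom C g \<longrightarrow>
        AMap F (g \<cdot>\<^bsub>C\<^esub> f) = AMap F g \<cdot>\<^bsub>D\<^esub> AMap F f)"

definition id_func :: "('o, 'm) category \<Rightarrow> ('o, 'm, 'o, 'm) func" where
  "id_func C = \<lparr>Src = C, Tgt = C, OMap = (\<lambda>a\<in>Obj C. a), AMap = (\<lambda>f\<in>Arr C. f)\<rparr>"

definition comp_func ::
  "('o2, 'm2, 'o3, 'm3) func \<Rightarrow> ('o1, 'm1, 'o2, 'm2) func \<Rightarrow> ('o1, 'm1, 'o3, 'm3) func"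
  (infixr "\<circ>\<^sub>F" 75) where
  "G \<circ>\<^sub>F F = \<lparr>Src = Src F, Tgt = Tgt G,
     OMap = compose (Obj (Src F)) (OMap G) (OMap F),
     AMap = compose (Arr (Src F)) (AMap G) (AMap F)\<rparr>"

record ('o1, 'm1, 'o2, 'm2) nattrans =
  NDom :: "('o1, 'm1, 'o2, 'm2) func"
  NCod :: "('o1, 'm1, 'o2, 'm2) func"
  Cmp :: "'o1 \<Rightarrow> 'm2"

definition is_nattrans ::
  "('o1, 'm1) category \<Rightarrow> ('o2, 'm2) category \<Rightarrow> ('o1, 'm1, 'o2, 'm2) nattrans \<Rightarrow> bool" where
  "is_nattrans C D t \<longleftrightarrow> is_functor C D (NDom t) \<and> is_functor C D (NCod t) \<and>
     Cmp t \<in> extensional (Obj C) \<and>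
     (\<forall>a \<in> Obj C. Cmp t a \<in> hom D (OMap (NDom t) a) (OMap (NCod t) a)) \<and>
     (\<forall>f \<in> Arr C. Cmp t (Cod C f) \<cdot>\<^bsub>D\<^esub> AMap (NDom t) f
                 = AMap (NCod t) f \<cdot>\<^bsub>D\<^esub> Cmp t (Dom C f))"

definition FunCat :: "('o1, 'm1) category \<Rightarrow> ('o2, 'm2) category \<Rightarrow>
    (('o1, 'm1, 'o2, 'm2) func, ('o1, 'm1, 'o2, 'm2) nattrans) category" where
  "FunCat C D = \<lparr>Obj = {F. is_functor C D F}, Arr = {t. is_nattrans C D t},
     Dom = NDom, Cod = NCod,
     Ide = (\<lambda>F. \<lparr>NDom = F, NCod = F, Cmp = (\<lambda>a\<in>Obj C. Ide D (OMap F a))\<rparr>),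
     Comp = (\<lambda>u t. \<lparr>NDom = NDom t, NCod = NCod u,
                    Cmp = (\<lambda>a\<in>Obj C. Cmp u a \<cdot>\<^bsub>D\<^esub> Cmp t a)\<rparr>)\<rparr>"

text \<open>Whiskering: \<open>whisker_left K t\<close> has components \<open>K(t\<^sub>a)\<close>,
  \<open>whisker_right t H\<close> has components \<open>t\<^sub>H\<^sub>a\<close>.\<close>

definition whisker_left :: "('o2, 'm2, 'o3, 'm3) func \<Rightarrow> ('o1, 'm1, 'o2, 'm2) nattrans
    \<Rightarrow> ('o1, 'm1, 'o3, 'm3) nattrans" where
  "whisker_left K t = \<lparr>NDom = K \<circ>\<^sub>F NDom t, NCod = K \<circ>\<^sub>F NCod t,
     Cmp = compose (Obj (Src (NDom t))) (AMap K) (Cmp t)\<rparr>"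

definition whisker_right :: "('o2, 'm2, 'o3, 'm3) nattrans \<Rightarrow> ('o1, 'm1, 'o2, 'm2) func
    \<Rightarrow> ('o1, 'm1, 'o3, 'm3) nattrans" where
  "whisker_right t H = \<lparr>NDom = NDom t \<circ>\<^sub>F H, NCod = NCod t \<circ>\<^sub>F H,
     Cmp = compose (Obj (Src H)) (Cmp t) (OMap H)\<rparr>"

text \<open>The functor \<open>Fun(J,F) : Fun(J,C) \<rightarrow> Fun(J,D)\<close> of postcomposition with
  \<open>F : C \<rightarrow> D\<close>, and its effect on natural transformations.\<close>

definition post :: "('oj, 'mj) category \<Rightarrow> ('o1, 'm1, 'o2, 'm2) func \<Rightarrow>
    (('oj, 'mj, 'o1, 'm1) func, ('oj, 'mj, 'o1, 'm1) nattrans,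
     ('oj, 'mj, 'o2, 'm2) func, ('oj, 'mj, 'o2, 'm2) nattrans) func" where
  "post J F = \<lparr>Src = FunCat J (Src F), Tgt = FunCat J (Tgt F),
     OMap = (\<lambda>X \<in> Obj (FunCat J (Src F)). F \<circ>\<^sub>F X),
     AMap = (\<lambda>t \<in> Arr (FunCat J (Src F)). whisker_left F t)\<rparr>"

definition post_nt :: "('oj, 'mj) category \<Rightarrow> ('o1, 'm1, 'o2, 'm2) nattrans \<Rightarrow>
    (('oj, 'mj, 'o1, 'm1) func, ('oj, 'mj, 'o1, 'm1) nattrans,
     ('oj, 'mj, 'o2, 'm2) func, ('oj, 'mj, 'o2, 'm2) nattrans) nattrans" where
  "post_nt J t = \<lparr>NDom = post J (NDom t), NCod = post J (NCod t),
     Cmp = (\<lambda>X \<in> Obj (FunCat J (Src (NDom t))). whisker_right t X)\<rparr>"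


section \<open>Localization\<close>

text \<open>The Gabriel--Zisman construction of \<open>C[W\<^sup>-\<^sup>1]\<close>: an arrow from \<open>a\<close> to \<open>b\<close> is a class of
  words in the arrows of \<open>C\<close> and formal inverses \<open>Bwd w\<close> of the arrows \<open>w \<in> W\<close>.
  Words are read in diagrammatic order, the first letter starting at \<open>a\<close>.\<close>

datatype 'm letter = Fwd (arrow: 'm) | Bwd (arrow: 'm)

fun path :: "('o, 'm) category \<Rightarrow> 'm set \<Rightarrow> 'o \<Rightarrow> 'm letter list \<Rightarrow> 'o \<Rightarrow> bool" where
  "path C W a [] b \<longleftrightarrow> a \<in> Obj C \<and> a = b"
| "path C W a (Fwd f # u) b \<longleftrightarrow> f \<in> Arr C \<and> Dom C f = a \<and> path C W (Cod C f) u b"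
| "path C W a (Bwd f # u) b \<longleftrightarrow> f \<in> Arr C \<and> f \<in> W \<and> Cod C f = a \<and> path C W (Dom C f) u b"

inductive gz_eq :: "('o, 'm) category \<Rightarrow> 'm set \<Rightarrow> 'o \<Rightarrow> 'o \<Rightarrow> 'm letter list \<Rightarrow> 'm letter list \<Rightarrow> bool"
  for C :: "('o, 'm) category" and W :: "'m set" where
  refl: "path C W a u b \<Longrightarrow> gz_eq C W a b u u"
| sym: "gz_eq C W a b u v \<Longrightarrow> gz_eq C W a b v u"
| trans: "gz_eq C W a b u v \<Longrightarrow> gz_eq C W a b v w \<Longrightarrow> gz_eq C W a b u w"
| append: "gz_eq C W a b u u' \<Longrightarrow> gz_eq C W b c v v' \<Longrightarrow> gz_eq C W a c (u @ v) (u' @ v')"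
| ide: "a \<in> Obj C \<Longrightarrow> gz_eq C W a a [Fwd (Ide C a)] []"
| comp: "f \<in> hom C a b \<Longrightarrow> g \<in> hom C b c \<Longrightarrow> gz_eq C W a c [Fwd f, Fwd g] [Fwd (g \<cdot>\<^bsub>C\<^esub> f)]"
| inv_right: "w \<in> W \<Longrightarrow> w \<in> hom C a b \<Longrightarrow> gz_eq C W a a [Fwd w, Bwd w] []"
| inv_left: "w \<in> W \<Longrightarrow> w \<in> hom C a b \<Longrightarrow> gz_eq C W b b [Bwd w, Fwd w] []"

definition gz_class ::
  "('o, 'm) category \<Rightarrow> 'm set \<Rightarrow> 'o \<Rightarrow> 'o \<Rightarrow> 'm letter list \<Rightarrow> 'o \<times> 'o \<times> 'm letter list set" where
  "gz_class C W a b u = (a, b, {v. gz_eq C W a b u v})"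

definition localization ::
  "('o, 'm) category \<Rightarrow> 'm set \<Rightarrow> ('o, 'o \<times> 'o \<times> 'm letter list set) category" where
  "localization C W = \<lparr>Obj = Obj C,
     Arr = {gz_class C W a b u | a b u. path C W a u b},
     Dom = (\<lambda>(a, b, U). a), Cod = (\<lambda>(a, b, U). b),
     Ide = (\<lambda>a. gz_class C W a a []),
     Comp = (\<lambda>(b', c, V) (a, b, U). (a, c, {w. \<exists>u \<in> U. \<exists>v \<in> V. gz_eq C W a c (u @ v) w}))\<rparr>"

definition loc_arr :: "('o, 'm) category \<Rightarrow> 'm set \<Rightarrow> 'm \<Rightarrow> 'o \<times> 'o \<times> 'm letter list set" where
  "loc_arr C W f = gz_class C W (Dom C f) (Cod C f) [Fwd f]"


section \<open>Relative categories and homotopical equivalences\<close>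

definition saturated :: "('o, 'm) category \<Rightarrow> 'm set \<Rightarrow> bool" where
  "saturated D E \<longleftrightarrow> E = {f \<in> Arr D. is_iso (localization D E) (loc_arr D E f)}"

definition relative_category :: "('o, 'm) category \<Rightarrow> 'm set \<Rightarrow> bool" where
  "relative_category D E \<longleftrightarrow> category D \<and> saturated D E"

definition objectwise ::
  "('o1, 'm1) category \<Rightarrow> ('o2, 'm2) category \<Rightarrow> 'm2 set \<Rightarrow> ('o1, 'm1, 'o2, 'm2) nattrans set" where
  "objectwise C D E = {t \<in> Arr (FunCat C D). \<forall>a \<in> Obj C. Cmp t a \<in> E}"

definition we_zigzag :: "('o1, 'm1) category \<Rightarrow> ('o2, 'm2) category \<Rightarrow> 'm2 set \<Rightarrow>
    ('o1, 'm1, 'o2, 'm2) func \<Rightarrow> ('o1, 'm1, 'o2, 'm2) func \<Rightarrow>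
    ('o1, 'm1, 'o2, 'm2) nattrans letter list \<Rightarrow> bool" where
  "we_zigzag C D E F G z \<longleftrightarrow>
     path (FunCat C D) (objectwise C D E) F z G \<and> arrow ` set z \<subseteq> objectwise C D E"

definition homotopical_equivalence ::
  "('o1, 'm1) category \<Rightarrow> 'm1 set \<Rightarrow> ('o2, 'm2) category \<Rightarrow> 'm2 set \<Rightarrow>
    ('o1, 'm1, 'o2, 'm2) func \<Rightarrow> ('o2, 'm2, 'o1, 'm1) func \<Rightarrow>
    ('o2, 'm2, 'o2, 'm2) nattrans letter list \<Rightarrow> ('o1, 'm1, 'o1, 'm1) nattrans letter list \<Rightarrow> bool" where
  "homotopical_equivalence C W D E F G \<beta> \<alpha> \<longleftrightarrow>
     is_functor C D F \<and> is_functor D C G \<and> AMap F ` W \<subseteq> E \<and> AMap G ` E \<subseteq> W \<and>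
     we_zigzag D D E (F \<circ>\<^sub>F G) (id_func D) \<beta> \<and> we_zigzag C C W (G \<circ>\<^sub>F F) (id_func C) \<alpha>"

definition homotopically_equivalent ::
  "('o1, 'm1) category \<Rightarrow> 'm1 set \<Rightarrow> ('o2, 'm2) category \<Rightarrow> 'm2 set \<Rightarrow> bool" where
  "homotopically_equivalent C W D E \<longleftrightarrow> (\<exists>F G \<beta> \<alpha>. homotopical_equivalence C W D E F G \<beta> \<alpha>)"


section \<open>Coproducts\<close>

text \<open>Coproducts are not chosen. A condition on a morphism between coproducts is stated for every
  choice of the coproduct cocones involved.\<close>

definition is_coproduct ::
  "('o, 'm) category \<Rightarrow> 'i set \<Rightarrow> ('i \<Rightarrow> 'o) \<Rightarrow> 'o \<Rightarrow> ('i \<Rightarrow> 'm) \<Rightarrow> bool" where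
  "is_coproduct D I X t \<iota> \<longleftrightarrow> t \<in> Obj D \<and> (\<forall>i \<in> I. \<iota> i \<in> hom D (X i) t) \<and>
     (\<forall>y \<in> Obj D. \<forall>\<phi>. (\<forall>i \<in> I. \<phi> i \<in> hom D (X i) y) \<longrightarrow>
        (\<exists>!h. h \<in> hom D t y \<and> (\<forall>i \<in> I. h \<cdot>\<^bsub>D\<^esub> \<iota> i = \<phi> i)))"

definition is_binary_coproduct ::
  "('o, 'm) category \<Rightarrow> 'o \<Rightarrow> 'o \<Rightarrow> 'o \<Rightarrow> 'm \<Rightarrow> 'm \<Rightarrow> bool" where
  "is_binary_coproduct D a b t i j \<longleftrightarrow>
     is_coproduct D (UNIV :: bool set) (case_bool a b) t (case_bool i j)"

definition has_initial :: "('o, 'm) category \<Rightarrow> bool" where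
  "has_initial D \<longleftrightarrow> (\<exists>z \<in> Obj D. \<forall>y \<in> Obj D. \<exists>!h. h \<in> hom D z y)"

definition has_finite_coproducts :: "('o, 'm) category \<Rightarrow> bool" where
  "has_finite_coproducts D \<longleftrightarrow>
     (\<forall>(I :: nat set) X. finite I \<and> X ` I \<subseteq> Obj D \<longrightarrow> (\<exists>t \<iota>. is_coproduct D I X t \<iota>))"

text \<open>In the last clause \<open>h\<close> is \<open>f \<squnion> g : x \<rightarrow> y\<close>.\<close>

definition closed_by_finite_coproducts :: "('o, 'm) category \<Rightarrow> 'm set \<Rightarrow> bool" where
  "closed_by_finite_coproducts D E \<longleftrightarrow> has_initial D \<and> has_finite_coproducts D \<and>
     (\<forall>f \<in> E. \<forall>g \<in> E. \<forall>x i j y i' j' h.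
        is_binary_coproduct D (Dom D f) (Dom D g) x i j \<and>
        is_binary_coproduct D (Cod D f) (Cod D g) y i' j' \<and>
        h \<in> hom D x y \<and> h \<cdot>\<^bsub>D\<^esub> i = i' \<cdot>\<^bsub>D\<^esub> f \<and> h \<cdot>\<^bsub>D\<^esub> j = j' \<cdot>\<^bsub>D\<^esub> g
        \<longrightarrow> h \<in> E)"


section \<open>Simplicial objects\<close>

text \<open>The natural number \<open>n\<close> stands for the ordered set \<open>[n] = {0,\<dots>,n}\<close>.\<close>

type_synonym delta_arr = "nat \<times> nat \<times> (nat \<Rightarrow> nat)"

definition Delta :: "(nat, delta_arr) category" where
  "Delta = \<lparr>Obj = UNIV,
     Arr = {(m, n, f). f \<in> {..m} \<rightarrow>\<^sub>E {..n} \<and> mono_on {..m} f},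
     Dom = (\<lambda>(m, n, f). m), Cod = (\<lambda>(m, n, f). n),
     Ide = (\<lambda>n. (n, n, \<lambda>i\<in>{..n}. i)),
     Comp = (\<lambda>(n', p, g) (m, n, f). (m, p, compose {..m} g f))\<rparr>"

text \<open>The coface \<open>d\<^sup>i : [n] \<rightarrow> [n+1]\<close> is the injection omitting \<open>i\<close>.\<close>

definition coface :: "nat \<Rightarrow> nat \<Rightarrow> delta_arr" where
  "coface n i = (n, Suc n, \<lambda>j\<in>{..n}. if j < i then j else Suc j)"

type_synonym ('o, 'm) sobj = "(nat, delta_arr, 'o, 'm) func"
type_synonym ('o, 'm) smap = "(nat, delta_arr, 'o, 'm) nattrans"
type_synonym ('o, 'm) ssobj = "(('o, 'm) sobj, ('o, 'm) smap) sobj"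
type_synonym ('o, 'm) ssmap = "(('o, 'm) sobj, ('o, 'm) smap) smap"

abbreviation Simp :: "('o, 'm) category \<Rightarrow> (('o, 'm) sobj, ('o, 'm) smap) category" where
  "Simp D \<equiv> FunCat (opp Delta) D"

definition const_obj :: "('o, 'm) category \<Rightarrow> 'o \<Rightarrow> ('o, 'm) sobj" where
  "const_obj D A = \<lparr>Src = opp Delta, Tgt = D, OMap = (\<lambda>n\<in>Obj Delta. A),
     AMap = (\<lambda>\<alpha>\<in>Arr Delta. Ide D A)\<rparr>"

definition const_func :: "('o, 'm) category \<Rightarrow> ('o, 'm, ('o, 'm) sobj, ('o, 'm) smap) func" where
  "const_func D = \<lparr>Src = D, Tgt = Simp D, OMap = (\<lambda>A\<in>Obj D. const_obj D A),
     AMap = (\<lambda>f\<in>Arr D. \<lparr>NDom = const_obj D (Dom D f), NCod = const_obj D (Cod D f),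
                         Cmp = (\<lambda>n\<in>Obj Delta. f)\<rparr>)\<rparr>"

text \<open>A bisimplicial object is an object \<open>Z\<close> of \<open>Simp (Simp D)\<close>, with
  \<open>Z\<^sub>n\<^sub>,\<^sub>m = OMap (OMap Z n) m\<close>. For \<open>\<alpha> : [m] \<rightarrow> [n]\<close> the diagonal acts as
  \<open>Z\<^sub>n\<^sub>,\<^sub>n \<rightarrow> Z\<^sub>m\<^sub>,\<^sub>n \<rightarrow> Z\<^sub>m\<^sub>,\<^sub>m\<close>.\<close>

definition diag_obj :: "('o, 'm) category \<Rightarrow> ('o, 'm) ssobj \<Rightarrow> ('o, 'm) sobj" where
  "diag_obj D Z = \<lparr>Src = opp Delta, Tgt = D,
     OMap = (\<lambda>n\<in>Obj Delta. OMap (OMap Z n) n),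
     AMap = (\<lambda>\<alpha>\<in>Arr Delta. AMap (OMap Z (Dom Delta \<alpha>)) \<alpha> \<cdot>\<^bsub>D\<^esub> Cmp (AMap Z \<alpha>) (Cod Delta \<alpha>))\<rparr>"

definition diag_func ::
  "('o, 'm) category \<Rightarrow> (('o, 'm) ssobj, ('o, 'm) ssmap, ('o, 'm) sobj, ('o, 'm) smap) func" where
  "diag_func D = \<lparr>Src = Simp (Simp D), Tgt = Simp D,
     OMap = (\<lambda>Z \<in> Obj (Simp (Simp D)). diag_obj D Z),
     AMap = (\<lambda>t \<in> Arr (Simp (Simp D)).
       \<lparr>NDom = diag_obj D (NDom t), NCod = diag_obj D (NCod t),
        Cmp = (\<lambda>n\<in>Obj Delta. Cmp (Cmp t n) n)\<rparr>)\<rparr>"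


section \<open>The action of simplicial finite sets\<close>

type_synonym 'x set_arr = "'x set \<times> 'x set \<times> ('x \<Rightarrow> 'x)"

definition FinSet :: "('x set, 'x set_arr) category" where
  "FinSet = \<lparr>Obj = {A. finite A},
     Arr = {(A, B, f). finite A \<and> finite B \<and> f \<in> A \<rightarrow>\<^sub>E B},
     Dom = (\<lambda>(A, B, f). A), Cod = (\<lambda>(A, B, f). B),
     Ide = (\<lambda>A. (A, A, \<lambda>x\<in>A. x)),
     Comp = (\<lambda>(B', C, g) (A, B, f). (A, C, compose A g f))\<rparr>"

definition map_of_arr :: "'x set_arr \<Rightarrow> 'x \<Rightarrow> 'x" where
  "map_of_arr = (\<lambda>(A, B, f). f)"

definition std_simplex :: "nat \<Rightarrow> (delta_arr set, delta_arr set_arr) sobj" where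
  "std_simplex k = \<lparr>Src = opp Delta, Tgt = FinSet,
     OMap = (\<lambda>n\<in>Obj Delta. hom Delta n k),
     AMap = (\<lambda>\<alpha>\<in>Arr Delta. (hom Delta (Cod Delta \<alpha>) k, hom Delta (Dom Delta \<alpha>) k,
               \<lambda>\<beta> \<in> hom Delta (Cod Delta \<alpha>) k. \<beta> \<cdot>\<^bsub>Delta\<^esub> \<alpha>))\<rparr>"

definition std_simplex_map :: "delta_arr \<Rightarrow> (delta_arr set, delta_arr set_arr) smap" where
  "std_simplex_map \<theta> =
     \<lparr>NDom = std_simplex (Dom Delta \<theta>), NCod = std_simplex (Cod Delta \<theta>),
      Cmp = (\<lambda>n\<in>Obj Delta. (hom Delta n (Dom Delta \<theta>), hom Delta n (Cod Delta \<theta>),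
               \<lambda>\<beta> \<in> hom Delta n (Dom Delta \<theta>). \<theta> \<cdot>\<^bsub>Delta\<^esub> \<beta>))\<rparr>"

text \<open>\<open>is_tensor D X K T \<iota>\<close>: the simplicial object \<open>T\<close> with coproduct inclusions
  \<open>\<iota> n k : X\<^sub>n \<rightarrow> T\<^sub>n\<close> (\<open>k \<in> K\<^sub>n\<close>) is a tensor \<open>X \<boxtimes> K\<close>. The structure map of \<open>\<alpha> : [m] \<rightarrow> [n]\<close>
  takes the summand \<open>k\<close> to the summand \<open>\<alpha>\<^sup>*k\<close> by \<open>\<alpha>\<^sup>* : X\<^sub>n \<rightarrow> X\<^sub>m\<close>.\<close>

definition is_tensor :: "('o, 'm) category \<Rightarrow> ('o, 'm) sobj \<Rightarrow> ('x set, 'x set_arr) sobj \<Rightarrow>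
    ('o, 'm) sobj \<Rightarrow> (nat \<Rightarrow> 'x \<Rightarrow> 'm) \<Rightarrow> bool" where
  "is_tensor D X K T \<iota> \<longleftrightarrow>
     X \<in> Obj (Simp D) \<and> K \<in> Obj (Simp FinSet) \<and> T \<in> Obj (Simp D) \<and>
     (\<forall>n. is_coproduct D (OMap K n) (\<lambda>_. OMap X n) (OMap T n) (\<iota> n)) \<and>
     (\<forall>\<alpha> \<in> Arr Delta. \<forall>k \<in> OMap K (Cod Delta \<alpha>).
        AMap T \<alpha> \<cdot>\<^bsub>D\<^esub> \<iota> (Cod Delta \<alpha>) k
          = \<iota> (Dom Delta \<alpha>) (map_of_arr (AMap K \<alpha>) k) \<cdot>\<^bsub>D\<^esub> AMap X \<alpha>)"

text \<open>\<open>h\<close> is the map \<open>X \<boxtimes> K \<rightarrow> X \<boxtimes> L\<close> induced by a simplicial map \<open>\<phi> : K \<rightarrow> L\<close>.\<close>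

definition is_tensor_map :: "('o, 'm) category \<Rightarrow> ('o, 'm) sobj \<Rightarrow> ('x set, 'x set_arr) smap \<Rightarrow>
    ('o, 'm) sobj \<Rightarrow> (nat \<Rightarrow> 'x \<Rightarrow> 'm) \<Rightarrow> ('o, 'm) sobj \<Rightarrow> (nat \<Rightarrow> 'x \<Rightarrow> 'm) \<Rightarrow> ('o, 'm) smap \<Rightarrow> bool" where
  "is_tensor_map D X \<phi> T \<iota> T' \<iota>' h \<longleftrightarrow>
     is_tensor D X (NDom \<phi>) T \<iota> \<and> is_tensor D X (NCod \<phi>) T' \<iota>' \<and>
     h \<in> hom (Simp D) T T' \<and>
     (\<forall>n. \<forall>k \<in> OMap (NDom \<phi>) n. Cmp h n \<cdot>\<^bsub>D\<^esub> \<iota> n k = \<iota>' n (map_of_arr (Cmp \<phi> n) k))"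

text \<open>\<open>d\<close> is \<open>d\<^sub>0\<^sup>X : X \<rightarrow> X \<boxtimes> \<Delta>[1]\<close>, where \<open>X\<close> with identities as inclusions serves as
  \<open>X \<boxtimes> \<Delta>[0]\<close> (each \<open>\<Delta>[0]\<^sub>n\<close> is a singleton).\<close>

definition is_d0 :: "('o, 'm) category \<Rightarrow> ('o, 'm) sobj \<Rightarrow> ('o, 'm) sobj \<Rightarrow>
    (nat \<Rightarrow> delta_arr \<Rightarrow> 'm) \<Rightarrow> ('o, 'm) smap \<Rightarrow> bool" where
  "is_d0 D X T \<iota> d \<longleftrightarrow>
     is_tensor_map D X (std_simplex_map (coface 0 0)) X (\<lambda>n k. Ide D (OMap X n)) T \<iota> d"


section \<open>Simplicial descent categories\<close>

text \<open>The bisimplicial objects \<open>\<Delta> \<times> X\<close> and \<open>X \<times> \<Delta>\<close> are \<open>n \<mapsto> X\<close> and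
  \<open>n \<mapsto> c(X\<^sub>n)\<close>, i.e. the values at \<open>X\<close> of \<open>const_func (Simp D)\<close> and
  \<open>post (opp Delta) (const_func D)\<close>. The functor \<open>Z \<mapsto> s(n \<mapsto> s(m \<mapsto> Z\<^sub>n\<^sub>,\<^sub>m))\<close> is
  \<open>s \<circ>\<^sub>F post (opp Delta) s\<close>.\<close>

type_synonym ('o, 'm) simple_func = "(('o, 'm) sobj, ('o, 'm) smap, 'o, 'm) func"

type_synonym ('o, 'm) mu_zigzag = "(('o, 'm) ssobj, ('o, 'm) ssmap, 'o, 'm) nattrans letter list"

type_synonym ('o, 'm) lambda_zigzag = "('o, 'm, 'o, 'm) nattrans letter list"

text \<open>In \<open>S1\<close>, \<open>Z = X \<squnion> Y\<close>, \<open>p = s(X) \<squnion> s(Y)\<close> and \<open>h\<close> is the comparison map \<open>p \<rightarrow> s(Z)\<close>.\<close>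

definition S1 :: "('o, 'm) category \<Rightarrow> 'm set \<Rightarrow> ('o, 'm) simple_func \<Rightarrow> bool" where
  "S1 D E s \<longleftrightarrow> is_functor (Simp D) D s \<and>
     (\<forall>X \<in> Obj (Simp D). \<forall>Y \<in> Obj (Simp D). \<forall>Z i j p i' j' h.
        is_binary_coproduct (Simp D) X Y Z i j \<and>
        is_binary_coproduct D (OMap s X) (OMap s Y) p i' j' \<and>
        h \<in> hom D p (OMap s Z) \<and> h \<cdot>\<^bsub>D\<^esub> i' = AMap s i \<and> h \<cdot>\<^bsub>D\<^esub> j' = AMap s j
        \<longrightarrow> h \<in> E)"

definition S2 :: "('o, 'm) category \<Rightarrow> 'm set \<Rightarrow> ('o, 'm) simple_func \<Rightarrow> ('o, 'm) mu_zigzag \<Rightarrow> bool" where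
  "S2 D E s \<mu> \<longleftrightarrow>
     we_zigzag (Simp (Simp D)) D E (s \<circ>\<^sub>F diag_func D) (s \<circ>\<^sub>F post (opp Delta) s) \<mu>"

text \<open>The word \<open>u\<close> is an endomorphism of \<open>s\<close> in \<open>Fun(\<Delta>\<^sup>o\<^sup>pD, D)[E\<^sup>-\<^sup>1]\<close>, equal to the identity.\<close>

definition is_identity_of ::
  "('o, 'm) category \<Rightarrow> 'm set \<Rightarrow> ('o, 'm) simple_func \<Rightarrow>
    (('o, 'm) sobj, ('o, 'm) smap, 'o, 'm) nattrans letter list \<Rightarrow> bool" where
  "is_identity_of D E s u \<longleftrightarrow>
     path (FunCat (Simp D) D) (objectwise (Simp D) D E) s u s \<and>
     gz_class (FunCat (Simp D) D) (objectwise (Simp D) D E) s s u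
       = Ide (localization (FunCat (Simp D) D) (objectwise (Simp D) D E)) s"

definition S3 :: "('o, 'm) category \<Rightarrow> 'm set \<Rightarrow> ('o, 'm) simple_func \<Rightarrow>
    ('o, 'm) mu_zigzag \<Rightarrow> ('o, 'm) lambda_zigzag \<Rightarrow> bool" where
  "S3 D E s \<mu> lam \<longleftrightarrow>
     we_zigzag D D E (s \<circ>\<^sub>F const_func D) (id_func D) lam \<and>
     is_identity_of D E s
       (map (map_letter (\<lambda>t. whisker_right t (const_func (Simp D)))) \<mu> @
        map (map_letter (\<lambda>t. whisker_right t s)) lam) \<and>
     is_identity_of D E s
       (map (map_letter (\<lambda>t. whisker_right t (post (opp Delta) (const_func D)))) \<mu> @
        map (map_letter (\<lambda>t. whisker_left s (post_nt (opp Delta) t))) lam)"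

definition S4 :: "('o, 'm) category \<Rightarrow> 'm set \<Rightarrow> ('o, 'm) simple_func \<Rightarrow> bool" where
  "S4 D E s \<longleftrightarrow> (\<forall>f \<in> Arr (Simp D). (\<forall>n. Cmp f n \<in> E) \<longrightarrow> AMap s f \<in> E)"

definition S5 :: "('o, 'm) category \<Rightarrow> 'm set \<Rightarrow> ('o, 'm) simple_func \<Rightarrow> bool" where
  "S5 D E s \<longleftrightarrow>
     (\<forall>A \<in> Obj D. \<forall>T \<iota> d. is_d0 D (const_obj D A) T \<iota> d \<longrightarrow> AMap s d \<in> E)"

definition simplicial_descent_structure :: "('o, 'm) category \<Rightarrow> 'm set \<Rightarrow>
    ('o, 'm) simple_func \<Rightarrow> ('o, 'm) mu_zigzag \<Rightarrow> ('o, 'm) lambda_zigzag \<Rightarrow> bool" where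
  "simplicial_descent_structure D E s \<mu> lam \<longleftrightarrow>
     S1 D E s \<and> S2 D E s \<mu> \<and> S3 D E s \<mu> lam \<and> S4 D E s \<and> S5 D E s"

definition simplicial_descent_category :: "('o, 'm) category \<Rightarrow> 'm set \<Rightarrow> bool" where
  "simplicial_descent_category D E \<longleftrightarrow>
     relative_category D E \<and> closed_by_finite_coproducts D E \<and>
     (\<exists>s \<mu> lam. simplicial_descent_structure D E s \<mu> lam)"

end

theory Submission
  imports Defs
begin

text \<open>Let \<open>F : C \<rightarrow> D\<close> and \<open>G : D \<rightarrow> C\<close> be mutually inverse homotopical equivalences, and let \<open>s\<close> be the
  simple functor of \<open>D\<close>, with comparison zigzags \<open>\<mu>\<close> and \<open>\<lambda>\<close>. Write \<open>F\<^sub>*\<close> for levelwise application of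
  \<open>F\<close> to simplicial objects. The simple functor of \<open>C\<close> is \<open>s' = G s F\<^sub>*\<close>, with
  \<open>\<lambda>' : G s F\<^sub>* c = G s c F \<rightarrow> G F \<rightarrow> 1\<close> given by \<open>G \<lambda> F\<close> and \<open>\<alpha> : GF \<rightarrow> 1\<close>, and with \<open>\<mu>'\<close> given by
  \<open>G \<mu> F\<^sub>*\<^sub>*\<close> followed by the inverse of \<open>G s \<beta>\<^sub>* s\<^sub>* F\<^sub>*\<^sub>*\<close>, where \<open>\<beta> : FG \<rightarrow> 1\<close>.

  The compatibility of \<open>\<lambda>'\<close> with \<open>\<mu>'\<close> is a computation with zigzags in a localized functor category.
  The interchange law (\<open>interchange\<close>) moves \<open>\<beta>\<close> past \<open>\<lambda>\<close>. The two composites in \<open>S3\<close> then become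
  those of \<open>D\<close>, which are trivial, followed by a zigzag that is trivial if \<open>G\<beta> = \<alpha>G\<close>, respectively
  \<open>\<beta>F = F\<alpha>\<close>, holds in the localization. These triangle identities can be arranged by changing \<open>\<beta>\<close>, as for
  ordinary equivalences of categories (\<open>adjoint_zigzags\<close>, \<open>transport_S2_S3\<close>).

  \<open>S1\<close> and \<open>S5\<close> mention coproducts, which \<open>F\<close> and \<open>G\<close> preserve only up to weak equivalence
  (\<open>equivalence_preserves_coproducts\<close>). This follows from the two-out-of-six property of the
  saturated classes and from the fact that functors connected to the identity by a zigzag of natural weak
  equivalences preserve coproducts up to weak equivalence. A coproduct \<open>X \<squnion> Y\<close> or a tensor \<open>A \<boxtimes> \<Delta>[1]\<close> in
  \<open>C\<close> is therefore sent by \<open>F\<^sub>*\<close> to a simplicial object that receives a levelwise weak equivalence from the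
  corresponding construction in \<open>D\<close>, and \<open>S4\<close> in \<open>D\<close> turns it into a weak equivalence under \<open>s\<close>.\<close>

section \<open>Functor categories\<close>

lemma homD: "f \<in> hom C a b \<Longrightarrow> f \<in> Arr C \<and> Dom C f = a \<and> Cod C f = b"
  by (simp add: hom_def)

lemma Arr_hom: "f \<in> Arr C \<Longrightarrow> f \<in> hom C (Dom C f) (Cod C f)"
  by (simp add: hom_def)

lemma hom_Obj: "category C \<Longrightarrow> f \<in> hom C a b \<Longrightarrow> a \<in> Obj C \<and> b \<in> Obj C"
  using category.dom_in_Obj category.cod_in_Obj by (fastforce simp: hom_def)

lemma opp_sel [simp]:
  "Obj (opp C) = Obj C" "Arr (opp C) = Arr C" "Dom (opp C) = Cod C" "Cod (opp C) = Dom C"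
  "Ide (opp C) = Ide C" "Comp (opp C) = (\<lambda>g f. f \<cdot>\<^bsub>C\<^esub> g)"
  by (simp_all add: opp_def)

lemma hom_opp: "hom (opp C) a b = hom C b a"
  by (auto simp: hom_def)

lemma category_opp:
  assumes C: "category C"
  shows "category (opp C)"
  by unfold_locales
    (auto simp: hom_opp category.dom_in_Obj[OF C] category.cod_in_Obj[OF C] category.ide_in_hom[OF C]
      category.comp_in_hom[OF C] category.comp_ide_left[OF C] category.comp_ide_right[OF C]
      category.comp_assoc[OF C])

lemma FunCat_sel [simp]:
  "Obj (FunCat C D) = {F. is_functor C D F}" "Arr (FunCat C D) = {t. is_nattrans C D t}"
  "Dom (FunCat C D) = NDom" "Cod (FunCat C D) = NCod"
  "Ide (FunCat C D) = (\<lambda>F. \<lparr>NDom = F, NCod = F, Cmp = (\<lambda>a\<in>Obj C. Ide D (OMap F a))\<rparr>)"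
  "Comp (FunCat C D) = (\<lambda>u t. \<lparr>NDom = NDom t, NCod = NCod u,
                    Cmp = (\<lambda>a\<in>Obj C. Cmp u a \<cdot>\<^bsub>D\<^esub> Cmp t a)\<rparr>)"
  by (simp_all add: FunCat_def)

lemma hom_FunCat: "t \<in> hom (FunCat C D) F G \<longleftrightarrow> is_nattrans C D t \<and> NDom t = F \<and> NCod t = G"
  by (auto simp: hom_def)

lemma functor_sel:
  "is_functor C D F \<Longrightarrow> Src F = C" "is_functor C D F \<Longrightarrow> Tgt F = D"
  by (simp_all add: is_functor_def)

lemma functor_cat: "is_functor C D F \<Longrightarrow> category C" "is_functor C D F \<Longrightarrow> category D"
  by (simp_all add: is_functor_def)

lemma functor_ob: "is_functor C D F \<Longrightarrow> a \<in> Obj C \<Longrightarrow> OMap F a \<in> Obj D"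
  by (auto simp: is_functor_def)

lemma functor_ar: "is_functor C D F \<Longrightarrow> f \<in> Arr C \<Longrightarrow> AMap F f \<in> Arr D"
  by (auto simp: is_functor_def)

lemma functor_dom: "is_functor C D F \<Longrightarrow> f \<in> Arr C \<Longrightarrow> Dom D (AMap F f) = OMap F (Dom C f)"
  by (auto simp: is_functor_def)

lemma functor_cod: "is_functor C D F \<Longrightarrow> f \<in> Arr C \<Longrightarrow> Cod D (AMap F f) = OMap F (Cod C f)"
  by (auto simp: is_functor_def)

lemma functor_hom: "is_functor C D F \<Longrightarrow> f \<in> hom C a b \<Longrightarrow> AMap F f \<in> hom D (OMap F a) (OMap F b)"
  by (auto simp: hom_def functor_ar functor_dom functor_cod)

lemma functor_ide: "is_functor C D F \<Longrightarrow> a \<in> Obj C \<Longrightarrow> AMap F (Ide C a) = Ide D (OMap F a)"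
  by (auto simp: is_functor_def)

lemma functor_comp: "is_functor C D F \<Longrightarrow> f \<in> hom C a b \<Longrightarrow> g \<in> hom C b c \<Longrightarrow>
    AMap F (g \<cdot>\<^bsub>C\<^esub> f) = AMap F g \<cdot>\<^bsub>D\<^esub> AMap F f"
  by (auto simp: is_functor_def hom_def)

lemma functorI:
  assumes "category C" "category D" "Src F = C" "Tgt F = D"
    "OMap F \<in> extensional (Obj C)" "AMap F \<in> extensional (Arr C)"
    "\<And>a. a \<in> Obj C \<Longrightarrow> OMap F a \<in> Obj D"
    "\<And>a b f. f \<in> hom C a b \<Longrightarrow> AMap F f \<in> hom D (OMap F a) (OMap F b)"
    "\<And>a. a \<in> Obj C \<Longrightarrow> AMap F (Ide C a) = Ide D (OMap F a)"
    "\<And>a b c f g. f \<in> hom C a b \<Longrightarrow> g \<in> hom C b c \<Longrightarrow> AMap F (g \<cdot>\<^bsub>C\<^esub> f) = AMap F g \<cdot>\<^bsub>D\<^esub> AMap F f"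
  shows "is_functor C D F"
  using assms unfolding is_functor_def by (auto simp: PiE_def hom_def)

lemma functor_eqI:
  assumes "is_functor C D F" "is_functor C D G"
    "\<And>a. a \<in> Obj C \<Longrightarrow> OMap F a = OMap G a" "\<And>f. f \<in> Arr C \<Longrightarrow> AMap F f = AMap G f"
  shows "F = G"
proof -
  have "OMap F = OMap G"
    by (rule extensionalityI[of _ "Obj C"]) (use assms in \<open>auto simp: is_functor_def PiE_def\<close>)
  moreover have "AMap F = AMap G"
    by (rule extensionalityI[of _ "Arr C"]) (use assms in \<open>auto simp: is_functor_def PiE_def\<close>)
  ultimately show ?thesis
    using assms by (intro func.equality) (auto simp: is_functor_def)
qed

(* Not declared earlier: while is_functor_def is unfolded, the condition of this rule contains an
   instance of its own left-hand side. *)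
declare functor_sel [simp]

lemma nattransD:
  assumes "is_nattrans C D t"
  shows "is_functor C D (NDom t)" "is_functor C D (NCod t)" "Cmp t \<in> extensional (Obj C)"
    "\<And>a. a \<in> Obj C \<Longrightarrow> Cmp t a \<in> hom D (OMap (NDom t) a) (OMap (NCod t) a)"
    "\<And>a b f. f \<in> hom C a b \<Longrightarrow> Cmp t b \<cdot>\<^bsub>D\<^esub> AMap (NDom t) f = AMap (NCod t) f \<cdot>\<^bsub>D\<^esub> Cmp t a"
    "category C" "category D"
  using assms by (auto simp: is_nattrans_def hom_def functor_cat)

lemma nattransI:
  assumes "is_functor C D (NDom t)" "is_functor C D (NCod t)" "Cmp t \<in> extensional (Obj C)"
    "\<And>a. a \<in> Obj C \<Longrightarrow> Cmp t a \<in> hom D (OMap (NDom t) a) (OMap (NCod t) a)"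
    "\<And>a b f. f \<in> hom C a b \<Longrightarrow> Cmp t b \<cdot>\<^bsub>D\<^esub> AMap (NDom t) f = AMap (NCod t) f \<cdot>\<^bsub>D\<^esub> Cmp t a"
  shows "is_nattrans C D t"
  using assms by (auto simp: is_nattrans_def hom_def)

lemma nattrans_eqI:
  assumes "is_nattrans C D t" "is_nattrans C D u" "NDom t = NDom u" "NCod t = NCod u"
    "\<And>a. a \<in> Obj C \<Longrightarrow> Cmp t a = Cmp u a"
  shows "t = u"
proof -
  have "Cmp t = Cmp u"
    by (rule extensionalityI[of _ "Obj C"]) (use assms in \<open>auto simp: is_nattrans_def\<close>)
  then show ?thesis using assms by (intro nattrans.equality) auto
qed

lemma nattrans_ide:
  assumes "is_functor C D F"
  shows "is_nattrans C D (Ide (FunCat C D) F)"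
proof (rule nattransI)
  have D: "category D" and C: "category C" using assms functor_cat by auto
  show "Cmp (Ide (FunCat C D) F) a \<in> hom D (OMap (NDom (Ide (FunCat C D) F)) a) (OMap (NCod (Ide (FunCat C D) F)) a)"
    if "a \<in> Obj C" for a
    using that assms category.ide_in_hom[OF D] functor_ob by fastforce
  show "Cmp (Ide (FunCat C D) F) b \<cdot>\<^bsub>D\<^esub> AMap (NDom (Ide (FunCat C D) F)) f
      = AMap (NCod (Ide (FunCat C D) F)) f \<cdot>\<^bsub>D\<^esub> Cmp (Ide (FunCat C D) F) a"
    if "f \<in> hom C a b" for a b f
    using hom_Obj[OF C that] category.comp_ide_left[OF D] category.comp_ide_right[OF D]
      functor_hom[OF assms that] by simp
qed (use assms in auto)

lemma nattrans_comp:
  assumes t: "is_nattrans C D t" and u: "is_nattrans C D u" and tu: "NCod t = NDom u"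
  shows "is_nattrans C D (u \<cdot>\<^bsub>FunCat C D\<^esub> t)"
proof (rule nattransI)
  have D: "category D" and C: "category C" using nattransD(6,7)[OF t] by auto
  note tD = nattransD[OF t] and uD = nattransD[OF u]
  show "is_functor C D (NDom (u \<cdot>\<^bsub>FunCat C D\<^esub> t))" "is_functor C D (NCod (u \<cdot>\<^bsub>FunCat C D\<^esub> t))"
    "Cmp (u \<cdot>\<^bsub>FunCat C D\<^esub> t) \<in> extensional (Obj C)"
    using tD uD by auto
  show "Cmp (u \<cdot>\<^bsub>FunCat C D\<^esub> t) a \<in> hom D (OMap (NDom (u \<cdot>\<^bsub>FunCat C D\<^esub> t)) a)
      (OMap (NCod (u \<cdot>\<^bsub>FunCat C D\<^esub> t)) a)" if "a \<in> Obj C" for a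
    using category.comp_in_hom[OF D tD(4)[OF that]] uD(4)[OF that] that tu by simp
  show "Cmp (u \<cdot>\<^bsub>FunCat C D\<^esub> t) b \<cdot>\<^bsub>D\<^esub> AMap (NDom (u \<cdot>\<^bsub>FunCat C D\<^esub> t)) f
      = AMap (NCod (u \<cdot>\<^bsub>FunCat C D\<^esub> t)) f \<cdot>\<^bsub>D\<^esub> Cmp (u \<cdot>\<^bsub>FunCat C D\<^esub> t) a"
    if f: "f \<in> hom C a b" for a b f
  proof -
    have ab: "a \<in> Obj C" "b \<in> Obj C" using hom_Obj[OF C f] by auto
    note as = category.comp_assoc[OF D]
    have "(Cmp u b \<cdot>\<^bsub>D\<^esub> Cmp t b) \<cdot>\<^bsub>D\<^esub> AMap (NDom t) f = Cmp u b \<cdot>\<^bsub>D\<^esub> (Cmp t b \<cdot>\<^bsub>D\<^esub> AMap (NDom t) f)"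
      using as functor_hom[OF tD(1) f] tD(4)[OF ab(2)] uD(4)[OF ab(2)] tu by simp
    also have "\<dots> = Cmp u b \<cdot>\<^bsub>D\<^esub> (AMap (NDom u) f \<cdot>\<^bsub>D\<^esub> Cmp t a)"
      using tD(5)[OF f] tu by simp
    also have "\<dots> = (Cmp u b \<cdot>\<^bsub>D\<^esub> AMap (NDom u) f) \<cdot>\<^bsub>D\<^esub> Cmp t a"
      using as tD(4)[OF ab(1)] functor_hom[OF uD(1) f] uD(4)[OF ab(2)] tu by simp
    also have "\<dots> = (AMap (NCod u) f \<cdot>\<^bsub>D\<^esub> Cmp u a) \<cdot>\<^bsub>D\<^esub> Cmp t a"
      using uD(5)[OF f] by simp
    also have "\<dots> = AMap (NCod u) f \<cdot>\<^bsub>D\<^esub> (Cmp u a \<cdot>\<^bsub>D\<^esub> Cmp t a)"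
      using as tD(4)[OF ab(1)] uD(4)[OF ab(1)] functor_hom[OF uD(2) f] tu by simp
    finally show ?thesis using ab by simp
  qed
qed

lemma category_FunCat:
  assumes C: "category C" and D: "category D"
  shows "category (FunCat C D)"
proof (unfold_locales)
  fix t assume t: "t \<in> Arr (FunCat C D)"
  show "Dom (FunCat C D) t \<in> Obj (FunCat C D)" using t nattransD by auto
  show "Cod (FunCat C D) t \<in> Obj (FunCat C D)" using t nattransD by auto
next
  fix F assume "F \<in> Obj (FunCat C D)"
  then show "Ide (FunCat C D) F \<in> hom (FunCat C D) F F"
    using nattrans_ide[of C D F] by (simp add: hom_FunCat)
next
  fix t u F G H assume "t \<in> hom (FunCat C D) F G" "u \<in> hom (FunCat C D) G H"
  then show "u \<cdot>\<^bsub>FunCat C D\<^esub> t \<in> hom (FunCat C D) F H"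
    using nattrans_comp[of C D t u] by (simp add: hom_FunCat)
next
  fix t F G assume t: "t \<in> hom (FunCat C D) F G"
  then have t': "is_nattrans C D t" "NDom t = F" "NCod t = G" by (auto simp: hom_FunCat)
  note tD = nattransD[OF t'(1)]
  have i: "is_nattrans C D (Ide (FunCat C D) F)" "is_nattrans C D (Ide (FunCat C D) G)"
    using nattrans_ide tD t' by blast+
  show "t \<cdot>\<^bsub>FunCat C D\<^esub> Ide (FunCat C D) F = t"
    by (rule nattrans_eqI[of C D]) (use nattrans_comp[OF i(1) t'(1)] t' category.comp_ide_right[OF D tD(4)] in auto)
  show "Ide (FunCat C D) G \<cdot>\<^bsub>FunCat C D\<^esub> t = t"
    by (rule nattrans_eqI[of C D]) (use nattrans_comp[OF t'(1) i(2)] t' category.comp_ide_left[OF D tD(4)] in auto)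
next
  fix t u v F G H K
  assume "t \<in> hom (FunCat C D) F G" "u \<in> hom (FunCat C D) G H" "v \<in> hom (FunCat C D) H K"
  then have t: "is_nattrans C D t" "NDom t = F" "NCod t = G"
    and u: "is_nattrans C D u" "NDom u = G" "NCod u = H"
    and v: "is_nattrans C D v" "NDom v = H" "NCod v = K" by (auto simp: hom_FunCat)
  have vu: "is_nattrans C D (v \<cdot>\<^bsub>FunCat C D\<^esub> u)" and ut: "is_nattrans C D (u \<cdot>\<^bsub>FunCat C D\<^esub> t)"
    using nattrans_comp t u v by metis+
  show "(v \<cdot>\<^bsub>FunCat C D\<^esub> u) \<cdot>\<^bsub>FunCat C D\<^esub> t = v \<cdot>\<^bsub>FunCat C D\<^esub> (u \<cdot>\<^bsub>FunCat C D\<^esub> t)"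
  proof (rule nattrans_eqI[of C D])
    show "is_nattrans C D ((v \<cdot>\<^bsub>FunCat C D\<^esub> u) \<cdot>\<^bsub>FunCat C D\<^esub> t)"
      using nattrans_comp[OF t(1) vu] t u by simp
    show "is_nattrans C D (v \<cdot>\<^bsub>FunCat C D\<^esub> (u \<cdot>\<^bsub>FunCat C D\<^esub> t))"
      using nattrans_comp[OF ut v(1)] v u by simp
    fix a assume "a \<in> Obj C"
    then show "Cmp ((v \<cdot>\<^bsub>FunCat C D\<^esub> u) \<cdot>\<^bsub>FunCat C D\<^esub> t) a = Cmp (v \<cdot>\<^bsub>FunCat C D\<^esub> (u \<cdot>\<^bsub>FunCat C D\<^esub> t)) a"
      using category.comp_assoc[OF D nattransD(4)[OF t(1), of a, unfolded t]
            nattransD(4)[OF u(1), of a, unfolded u] nattransD(4)[OF v(1), of a, unfolded v]]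
        t
      by simp
  qed auto
qed

section \<open>Words, localization and saturation\<close>

text \<open>Arrows of the localization are handled through words and the relation \<open>gz_eq\<close>; words compose in
  diagrammatic order.\<close>

lemma path_append: "path C W a u b \<Longrightarrow> path C W b v c \<Longrightarrow> path C W a (u @ v) c"
  by (induction C W a u b rule: path.induct) auto

lemma path_Obj: "category C \<Longrightarrow> path C W a u b \<Longrightarrow> a \<in> Obj C \<and> b \<in> Obj C"
  by (induction C W a u b rule: path.induct) (auto simp: category.dom_in_Obj category.cod_in_Obj)

lemma gz_path:
  assumes C: "category C" and "gz_eq C W a b u v"
  shows "path C W a u b \<and> path C W a v b"
  using assms(2)
proof induction
  case (ide a)
  then show ?case using category.ide_in_hom[OF C ide] by (auto simp: hom_def)
next
  case (comp f a b g c)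
  then show ?case using category.comp_in_hom[OF C comp] category.cod_in_Obj[OF C] by (auto simp: hom_def)
next
  case (inv_right w a b)
  then show ?case using category.dom_in_Obj[OF C] by (auto simp: hom_def)
next
  case (inv_left w a b)
  then show ?case using category.cod_in_Obj[OF C] by (auto simp: hom_def)
qed (auto simp: path_append)

lemma gz_append_left: "path C W a u b \<Longrightarrow> gz_eq C W b c v v' \<Longrightarrow> gz_eq C W a c (u @ v) (u @ v')"
  by (rule gz_eq.append[OF gz_eq.refl])

lemma gz_append_right: "gz_eq C W a b u u' \<Longrightarrow> path C W b v c \<Longrightarrow> gz_eq C W a c (u @ v) (u' @ v)"
  by (rule gz_eq.append[OF _ gz_eq.refl])

text \<open>\<open>gz_inverse C W a b u v\<close>: the words \<open>u : a \<rightarrow> b\<close> and \<open>v : b \<rightarrow> a\<close> are mutually inverse in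
  the localization.\<close>

definition gz_inverse where
  "gz_inverse C W a b u v \<longleftrightarrow> gz_eq C W a a (u @ v) [] \<and> gz_eq C W b b (v @ u) []
     \<and> path C W a u b \<and> path C W b v a"

lemma gz_inverse_left_right:
  assumes C: "category C" and u: "path C W a u b"
    and x: "path C W b x a" "gz_eq C W b b (x @ u) []"
    and y: "path C W b y a" "gz_eq C W a a (u @ y) []"
  shows "gz_inverse C W a b u y"
proof -
  have "gz_eq C W b a (x @ (u @ y)) (x @ [])" by (rule gz_append_left[OF x(1) y(2)])
  moreover have "gz_eq C W b a ((x @ u) @ y) ([] @ y)" by (rule gz_append_right[OF x(2) y(1)])
  ultimately have "gz_eq C W b a y x" by (metis append.assoc append_Nil append_Nil2 gz_eq.sym gz_eq.trans)
  then have "gz_eq C W b b (y @ u) (x @ u)" using gz_append_right u by metis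
  then have "gz_eq C W b b (y @ u) []" using x(2) by (rule gz_eq.trans)
  then show ?thesis using y u unfolding gz_inverse_def by blast
qed

lemma gz_inverse_cong:
  assumes C: "category C" and "gz_inverse C W a b u v" "gz_eq C W a b u u'"
  shows "gz_inverse C W a b u' v"
  using assms unfolding gz_inverse_def
  by (meson gz_append_left gz_append_right gz_eq.sym gz_eq.trans gz_path)

lemma gz_inverse_append:
  assumes C: "category C" and u: "gz_inverse C W a b u u'" and v: "gz_inverse C W b c v v'"
  shows "gz_inverse C W a c (u @ v) (v' @ u')"
proof -
  have "gz_eq C W a a (u @ ((v @ v') @ u')) (u @ ([] @ u'))"
    using u v gz_append_left gz_append_right unfolding gz_inverse_def by metis
  then have 1: "gz_eq C W a a ((u @ v) @ (v' @ u')) []"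
    using u gz_eq.trans unfolding gz_inverse_def by fastforce
  have "gz_eq C W c c (v' @ ((u' @ u) @ v)) (v' @ ([] @ v))"
    using u v gz_append_left gz_append_right unfolding gz_inverse_def by metis
  then have 2: "gz_eq C W c c ((v' @ u') @ (u @ v)) []"
    using v gz_eq.trans unfolding gz_inverse_def by fastforce
  show ?thesis using 1 2 u v path_append unfolding gz_inverse_def by metis
qed

lemma gz_inverse_weq:
  assumes C: "category C" and "f \<in> W" "f \<in> hom C a b"
  shows "gz_inverse C W a b [Fwd f] [Bwd f]"
  using assms gz_eq.inv_right[OF assms(2,3)] gz_eq.inv_left[OF assms(2,3)] hom_Obj[OF C assms(3)]
  unfolding gz_inverse_def by (auto simp: hom_def)

text \<open>Saturation is used through this lemma: an arrow that some word inverts is a weak equivalence.\<close>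

lemma saturatedD:
  assumes C: "category C" and sat: "saturated C W" and f: "f \<in> hom C a b"
    and v: "gz_inverse C W a b [Fwd f] v"
  shows "f \<in> W"
proof -
  have f': "f \<in> Arr C" "Dom C f = a" "Cod C f = b" using f by (auto simp: hom_def)
  have ab: "a \<in> Obj C" "b \<in> Obj C" using hom_Obj[OF C f] by auto
  let ?L = "localization C W"
  have cmp: "Comp ?L (gz_class C W b' c' q) (gz_class C W a' b' p) = gz_class C W a' c' (p @ q)"
    if "path C W a' p b'" "path C W b' q c'" for a' b' c' p q
  proof -
    have "(\<exists>u\<in>{v. gz_eq C W a' b' p v}. \<exists>v\<in>{v. gz_eq C W b' c' q v}. gz_eq C W a' c' (u @ v) w)
        \<longleftrightarrow> gz_eq C W a' c' (p @ q) w" for w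
    proof
      assume "gz_eq C W a' c' (p @ q) w"
      then show "\<exists>u\<in>{v. gz_eq C W a' b' p v}. \<exists>v\<in>{v. gz_eq C W b' c' q v}. gz_eq C W a' c' (u @ v) w"
        using that gz_eq.refl[of C W] by blast
    next
      assume "\<exists>u\<in>{v. gz_eq C W a' b' p v}. \<exists>v\<in>{v. gz_eq C W b' c' q v}. gz_eq C W a' c' (u @ v) w"
      then obtain u v where "gz_eq C W a' b' p u" "gz_eq C W b' c' q v" and w: "gz_eq C W a' c' (u @ v) w" by blast
      then have "gz_eq C W a' c' (p @ q) (u @ v)" by (intro gz_eq.append)
      then show "gz_eq C W a' c' (p @ q) w" using w by (rule gz_eq.trans)
    qed
    then show ?thesis by (simp add: localization_def gz_class_def)
  qed
  have cl: "gz_class C W c' c' w = Ide ?L c'" if "gz_eq C W c' c' w []" for c' w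
  proof -
    have "gz_eq C W c' c' w v \<longleftrightarrow> gz_eq C W c' c' [] v" for v
      using that gz_eq.sym gz_eq.trans by metis
    then show ?thesis by (simp add: localization_def gz_class_def)
  qed
  have pf: "path C W a [Fwd f] b" and pv: "path C W b v a" using v by (auto simp: gz_inverse_def)
  have F: "loc_arr C W f = gz_class C W a b [Fwd f]" by (simp add: loc_arr_def f')
  have "is_iso ?L (loc_arr C W f)"
    unfolding is_iso_def
  proof (intro conjI bexI)
    show "loc_arr C W f \<in> Arr ?L" unfolding F using pf unfolding localization_def by auto (metis pf)
    have DC: "Dom ?L (loc_arr C W f) = a" "Cod ?L (loc_arr C W f) = b"
      by (simp_all add: F localization_def gz_class_def)
    show "gz_class C W b a v \<in> hom ?L (Cod ?L (loc_arr C W f)) (Dom ?L (loc_arr C W f))"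
      unfolding DC using pv by (auto simp: hom_def localization_def gz_class_def)
    show "gz_class C W b a v \<cdot>\<^bsub>?L\<^esub> loc_arr C W f = Ide ?L (Dom ?L (loc_arr C W f))"
      unfolding DC unfolding F cmp[OF pf pv] by (rule cl) (use v in \<open>auto simp: gz_inverse_def\<close>)
    show "loc_arr C W f \<cdot>\<^bsub>?L\<^esub> gz_class C W b a v = Ide ?L (Cod ?L (loc_arr C W f))"
      unfolding DC unfolding F cmp[OF pv pf] by (rule cl) (use v in \<open>auto simp: gz_inverse_def\<close>)
  qed
  then show ?thesis using sat f' unfolding saturated_def by blast
qed

lemma weq_Arr: "relative_category C W \<Longrightarrow> f \<in> W \<Longrightarrow> f \<in> Arr C"
  by (auto simp: relative_category_def saturated_def)

lemma weq_comp:
  assumes R: "relative_category C W" and f: "f \<in> hom C a b" "f \<in> W" and g: "g \<in> hom C b c" "g \<in> W"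
  shows "g \<cdot>\<^bsub>C\<^esub> f \<in> W"
proof -
  have C: "category C" using R by (auto simp: relative_category_def)
  have "gz_inverse C W a c ([Fwd f] @ [Fwd g]) ([Bwd g] @ [Bwd f])"
    using gz_inverse_append gz_inverse_weq f g C by metis
  moreover have "gz_eq C W a c ([Fwd f] @ [Fwd g]) [Fwd (g \<cdot>\<^bsub>C\<^esub> f)]" using gz_eq.comp f g by fastforce
  ultimately show ?thesis
    using saturatedD[OF C] gz_inverse_cong[OF C] R category.comp_in_hom[OF C] f(1) g(1)
    unfolding relative_category_def by metis
qed

lemma weq_iso:
  assumes R: "relative_category C W" and f: "f \<in> hom C a b" and g: "g \<in> hom C b a"
    and gf: "g \<cdot>\<^bsub>C\<^esub> f = Ide C a" and fg: "f \<cdot>\<^bsub>C\<^esub> g = Ide C b"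
  shows "f \<in> W"
proof -
  have C: "category C" using R by (auto simp: relative_category_def)
  have ab: "a \<in> Obj C" "b \<in> Obj C" using hom_Obj[OF C f] by auto
  have "gz_eq C W a a [Fwd f, Fwd g] []"
    using gz_eq.trans[OF gz_eq.comp[OF f g]] gz_eq.ide[OF ab(1)] gf by metis
  moreover have "gz_eq C W b b [Fwd g, Fwd f] []"
    using gz_eq.trans[OF gz_eq.comp[OF g f]] gz_eq.ide[OF ab(2)] fg by metis
  ultimately have "gz_inverse C W a b [Fwd f] [Fwd g]"
    using f g ab by (auto simp: gz_inverse_def hom_def)
  then show ?thesis using saturatedD[OF C _ f] R unfolding relative_category_def by blast
qed

text \<open>Saturated classes have the two-out-of-six property, because isomorphisms do: in the
  localization the middle arrow has a left inverse and a right inverse.\<close>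

lemma two_out_of_six_middle:
  assumes R: "relative_category C W" and f: "f \<in> hom C a b" and g: "g \<in> hom C b c" and h: "h \<in> hom C c d"
    and gf: "g \<cdot>\<^bsub>C\<^esub> f \<in> W" and hg: "h \<cdot>\<^bsub>C\<^esub> g \<in> W"
  shows "g \<in> W"
proof -
  have C: "category C" using R by (auto simp: relative_category_def)
  have pf: "path C W a [Fwd f] b" and pg: "path C W b [Fwd g] c" and ph: "path C W c [Fwd h] d"
    using f g h hom_Obj[OF C f] hom_Obj[OF C h] by (auto simp: hom_def)
  have gf': "g \<cdot>\<^bsub>C\<^esub> f \<in> hom C a c" and hg': "h \<cdot>\<^bsub>C\<^esub> g \<in> hom C b d"
    using category.comp_in_hom[OF C] f g h by blast+
  have i1: "gz_inverse C W a c ([Fwd f] @ [Fwd g]) [Bwd (g \<cdot>\<^bsub>C\<^esub> f)]"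
    using gz_inverse_cong[OF C gz_inverse_weq[OF C gf gf'] gz_eq.sym[OF gz_eq.comp[OF f g]]] by simp
  have i2: "gz_inverse C W b d ([Fwd g] @ [Fwd h]) [Bwd (h \<cdot>\<^bsub>C\<^esub> g)]"
    using gz_inverse_cong[OF C gz_inverse_weq[OF C hg hg'] gz_eq.sym[OF gz_eq.comp[OF g h]]] by simp
  have "gz_inverse C W b c [Fwd g] ([Fwd h] @ [Bwd (h \<cdot>\<^bsub>C\<^esub> g)])"
  proof (rule gz_inverse_left_right[OF C pg, of "[Bwd (g \<cdot>\<^bsub>C\<^esub> f)] @ [Fwd f]"])
    show "path C W c ([Bwd (g \<cdot>\<^bsub>C\<^esub> f)] @ [Fwd f]) b"
      using path_append[OF _ pf] i1 unfolding gz_inverse_def by blast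
    show "path C W c ([Fwd h] @ [Bwd (h \<cdot>\<^bsub>C\<^esub> g)]) b"
      using path_append[OF ph] i2 unfolding gz_inverse_def by blast
  qed (use i1 i2 in \<open>auto simp: gz_inverse_def\<close>)
  then show ?thesis using saturatedD[OF C _ g] R unfolding relative_category_def by blast
qed

lemma weq_cancel_left:
  assumes R: "relative_category C W" and f: "f \<in> hom C a b" and g: "g \<in> hom C b c"
    and gf: "g \<cdot>\<^bsub>C\<^esub> f \<in> W" and "g \<in> W"
  shows "f \<in> W"
proof -
  have C: "category C" using R by (auto simp: relative_category_def)
  have gf': "g \<cdot>\<^bsub>C\<^esub> f \<in> hom C a c" using category.comp_in_hom[OF C f g] .
  have "gz_inverse C W a b ([Fwd (g \<cdot>\<^bsub>C\<^esub> f)] @ [Bwd g]) ([Fwd g] @ [Bwd (g \<cdot>\<^bsub>C\<^esub> f)])"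
    using gz_inverse_append[OF C gz_inverse_weq[OF C gf gf']] gz_inverse_weq[OF C \<open>g \<in> W\<close> g]
    unfolding gz_inverse_def by blast
  moreover have "gz_eq C W a b ([Fwd f, Fwd g] @ [Bwd g]) ([Fwd (g \<cdot>\<^bsub>C\<^esub> f)] @ [Bwd g])"
    using gz_append_right[OF gz_eq.comp[OF f g]] gz_inverse_weq[OF C \<open>g \<in> W\<close> g]
    unfolding gz_inverse_def by metis
  moreover have "gz_eq C W a b ([Fwd f] @ [Fwd g, Bwd g]) ([Fwd f] @ [])"
    using f hom_Obj[OF C f] by (intro gz_append_left[OF _ gz_eq.inv_right[OF \<open>g \<in> W\<close> g]]) (simp add: hom_def)
  ultimately have "gz_inverse C W a b ([Fwd f] @ [Fwd g, Bwd g]) ([Fwd g] @ [Bwd (g \<cdot>\<^bsub>C\<^esub> f)])"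
    and e: "gz_eq C W a b ([Fwd f] @ [Fwd g, Bwd g]) ([Fwd f] @ [])"
    using gz_inverse_cong[OF C _ gz_eq.sym, of W a b _ _ "[Fwd f, Fwd g] @ [Bwd g]"] by simp_all
  from gz_inverse_cong[OF C this]
  have "gz_inverse C W a b [Fwd f] ([Fwd g] @ [Bwd (g \<cdot>\<^bsub>C\<^esub> f)])" by simp
  then show ?thesis using saturatedD[OF C _ f] R unfolding relative_category_def by blast
qed

lemma weq_cancel_right:
  assumes R: "relative_category C W" and f: "f \<in> hom C a b" and g: "g \<in> hom C b c"
    and gf: "g \<cdot>\<^bsub>C\<^esub> f \<in> W" and "f \<in> W"
  shows "g \<in> W"
proof -
  have C: "category C" using R by (auto simp: relative_category_def)
  have gf': "g \<cdot>\<^bsub>C\<^esub> f \<in> hom C a c" using category.comp_in_hom[OF C f g] .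
  have "gz_inverse C W b c ([Bwd f] @ [Fwd (g \<cdot>\<^bsub>C\<^esub> f)]) ([Bwd (g \<cdot>\<^bsub>C\<^esub> f)] @ [Fwd f])"
    using gz_inverse_append[OF C _ gz_inverse_weq[OF C gf gf']] gz_inverse_weq[OF C \<open>f \<in> W\<close> f]
    unfolding gz_inverse_def by blast
  moreover have "gz_eq C W b c ([Bwd f] @ [Fwd f, Fwd g]) ([Bwd f] @ [Fwd (g \<cdot>\<^bsub>C\<^esub> f)])"
    using gz_append_left[OF _ gz_eq.comp[OF f g]] gz_inverse_weq[OF C \<open>f \<in> W\<close> f]
    unfolding gz_inverse_def by metis
  moreover have "gz_eq C W b c ([Bwd f, Fwd f] @ [Fwd g]) ([] @ [Fwd g])"
    using g hom_Obj[OF C g] by (intro gz_append_right[OF gz_eq.inv_left[OF \<open>f \<in> W\<close> f]]) (simp add: hom_def)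
  ultimately have "gz_inverse C W b c ([Bwd f, Fwd f] @ [Fwd g]) ([Bwd (g \<cdot>\<^bsub>C\<^esub> f)] @ [Fwd f])"
    and e: "gz_eq C W b c ([Bwd f, Fwd f] @ [Fwd g]) ([] @ [Fwd g])"
    using gz_inverse_cong[OF C _ gz_eq.sym, of W b c _ _ "[Bwd f] @ [Fwd f, Fwd g]"] by simp_all
  from gz_inverse_cong[OF C this]
  have "gz_inverse C W b c [Fwd g] ([Bwd (g \<cdot>\<^bsub>C\<^esub> f)] @ [Fwd f])" by simp
  then show ?thesis using saturatedD[OF C _ g] R unfolding relative_category_def by blast
qed

section \<open>Composition of functors and whiskering\<close>

lemma comp_func_sel [simp]:
  "Src (G \<circ>\<^sub>F F) = Src F" "Tgt (G \<circ>\<^sub>F F) = Tgt G"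
  "a \<in> Obj (Src F) \<Longrightarrow> OMap (G \<circ>\<^sub>F F) a = OMap G (OMap F a)"
  "f \<in> Arr (Src F) \<Longrightarrow> AMap (G \<circ>\<^sub>F F) f = AMap G (AMap F f)"
  by (simp_all add: comp_func_def compose_def)

lemma id_func_sel [simp]:
  "Src (id_func C) = C" "Tgt (id_func C) = C"
  "a \<in> Obj C \<Longrightarrow> OMap (id_func C) a = a" "f \<in> Arr C \<Longrightarrow> AMap (id_func C) f = f"
  by (simp_all add: id_func_def)

lemma functor_id_func: "category C \<Longrightarrow> is_functor C C (id_func C)"
  by (rule functorI)
    (auto simp: id_func_def hom_Obj homD category.ide_in_hom[THEN homD] category.comp_in_hom[THEN homD]
      dest: hom_Obj)

lemma functor_comp_func:
  assumes F: "is_functor A B F" and G: "is_functor B C G"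
  shows "is_functor A C (G \<circ>\<^sub>F F)"
proof -
  have A: "category A" using F functor_cat by blast
  show ?thesis
  proof (rule functorI)
    fix a b f assume f: "f \<in> hom A a b"
    then show "AMap (G \<circ>\<^sub>F F) f \<in> hom C (OMap (G \<circ>\<^sub>F F) a) (OMap (G \<circ>\<^sub>F F) b)"
      using F functor_hom[OF G functor_hom[OF F f]] hom_Obj[OF A f] homD[OF f] by simp
  next
    fix a assume "a \<in> Obj A"
    then show "AMap (G \<circ>\<^sub>F F) (Ide A a) = Ide C (OMap (G \<circ>\<^sub>F F) a)"
      using F functor_ide[OF F] functor_ide[OF G functor_ob[OF F]] category.ide_in_hom[OF A, THEN homD] by simp
  next
    fix a b c f g assume f: "f \<in> hom A a b" and g: "g \<in> hom A b c"
    then show "AMap (G \<circ>\<^sub>F F) (g \<cdot>\<^bsub>A\<^esub> f) = AMap (G \<circ>\<^sub>F F) g \<cdot>\<^bsub>C\<^esub> AMap (G \<circ>\<^sub>F F) f"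
      using F functor_comp[OF F f g] functor_comp[OF G functor_hom[OF F f] functor_hom[OF F g]]
        category.comp_in_hom[OF A f g, THEN homD] homD[OF f] homD[OF g] by simp
  qed (use assms in \<open>auto simp: functor_cat functor_ob comp_func_def compose_def\<close>)
qed

lemma comp_func_assoc:
  assumes "is_functor A B F" "is_functor B C G"
  shows "(H \<circ>\<^sub>F G) \<circ>\<^sub>F F = H \<circ>\<^sub>F (G \<circ>\<^sub>F F)"
  using assms by (auto simp: comp_func_def compose_def functor_ob functor_ar restrict_def fun_eq_iff)

lemma comp_id_func_right: "is_functor A B F \<Longrightarrow> F \<circ>\<^sub>F id_func A = F"
  by (rule functor_eqI[of A B]) (auto simp: functor_comp_func[OF functor_id_func] functor_cat)

lemma comp_id_func_left: "is_functor A B F \<Longrightarrow> id_func B \<circ>\<^sub>F F = F"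
  by (rule functor_eqI[of A B])
    (auto simp: functor_comp_func[OF _ functor_id_func] functor_cat functor_ob functor_ar)

lemma whisker_left_sel [simp]:
  "NDom (whisker_left K t) = K \<circ>\<^sub>F NDom t" "NCod (whisker_left K t) = K \<circ>\<^sub>F NCod t"
  "a \<in> Obj (Src (NDom t)) \<Longrightarrow> Cmp (whisker_left K t) a = AMap K (Cmp t a)"
  by (simp_all add: whisker_left_def compose_def)

lemma whisker_right_sel [simp]:
  "NDom (whisker_right t H) = NDom t \<circ>\<^sub>F H" "NCod (whisker_right t H) = NCod t \<circ>\<^sub>F H"
  "a \<in> Obj (Src H) \<Longrightarrow> Cmp (whisker_right t H) a = Cmp t (OMap H a)"
  by (simp_all add: whisker_right_def compose_def)

lemma nattrans_Src [simp]:
  "is_nattrans A B t \<Longrightarrow> Src (NDom t) = A" "is_nattrans A B t \<Longrightarrow> Src (NCod t) = A"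
  "is_nattrans A B t \<Longrightarrow> Tgt (NDom t) = B" "is_nattrans A B t \<Longrightarrow> Tgt (NCod t) = B"
  using nattransD(1,2)[of A B t] by auto

lemma nattrans_whisker_left:
  assumes t: "is_nattrans A B t" and K: "is_functor B C K"
  shows "is_nattrans A C (whisker_left K t)"
proof (rule nattransI)
  note tD = nattransD[OF t]
  show "is_functor A C (NDom (whisker_left K t))" "is_functor A C (NCod (whisker_left K t))"
    using functor_comp_func tD K by fastforce+
  show "Cmp (whisker_left K t) \<in> extensional (Obj A)"
    using t by (simp add: whisker_left_def compose_def)
  fix a assume "a \<in> Obj A"
  then show "Cmp (whisker_left K t) a \<in> hom C (OMap (NDom (whisker_left K t)) a) (OMap (NCod (whisker_left K t)) a)"
    using functor_hom[OF K tD(4)] t by simp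
next
  note tD = nattransD[OF t]
  fix a b f assume f: "f \<in> hom A a b"
  then have ab: "a \<in> Obj A" "b \<in> Obj A" "f \<in> Arr A" using hom_Obj[OF tD(6) f] homD[OF f] by auto
  show "Cmp (whisker_left K t) b \<cdot>\<^bsub>C\<^esub> AMap (NDom (whisker_left K t)) f
     = AMap (NCod (whisker_left K t)) f \<cdot>\<^bsub>C\<^esub> Cmp (whisker_left K t) a"
    using functor_comp[OF K functor_hom[OF tD(1) f] tD(4)[OF ab(2)]]
      functor_comp[OF K tD(4)[OF ab(1)] functor_hom[OF tD(2) f]] tD(5)[OF f] ab t by simp
qed

lemma nattrans_whisker_right:
  assumes t: "is_nattrans B C t" and H: "is_functor A B H"
  shows "is_nattrans A C (whisker_right t H)"
proof (rule nattransI)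
  note tD = nattransD[OF t]
  show "is_functor A C (NDom (whisker_right t H))" "is_functor A C (NCod (whisker_right t H))"
    using functor_comp_func tD H by fastforce+
  show "Cmp (whisker_right t H) \<in> extensional (Obj A)"
    using H by (simp add: whisker_right_def compose_def)
  fix a assume "a \<in> Obj A"
  then show "Cmp (whisker_right t H) a \<in> hom C (OMap (NDom (whisker_right t H)) a) (OMap (NCod (whisker_right t H)) a)"
    using tD(4) functor_ob[OF H] H by simp
next
  note tD = nattransD[OF t]
  fix a b f assume f: "f \<in> hom A a b"
  then have ab: "a \<in> Obj A" "b \<in> Obj A" "f \<in> Arr A" using hom_Obj functor_cat[OF H] homD[OF f] by metis+
  show "Cmp (whisker_right t H) b \<cdot>\<^bsub>C\<^esub> AMap (NDom (whisker_right t H)) f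
     = AMap (NCod (whisker_right t H)) f \<cdot>\<^bsub>C\<^esub> Cmp (whisker_right t H) a"
    using tD(5)[OF functor_hom[OF H f]] H ab by simp
qed

lemma whisker_left_comp:
  assumes t: "is_nattrans A B t" and L: "is_functor B C L" and K: "is_functor C D K"
  shows "whisker_left K (whisker_left L t) = whisker_left (K \<circ>\<^sub>F L) t"
proof (rule nattrans_eqI[of A D])
  show "is_nattrans A D (whisker_left K (whisker_left L t))" "is_nattrans A D (whisker_left (K \<circ>\<^sub>F L) t)"
    using assms nattrans_whisker_left functor_comp_func by metis+
  fix a assume "a \<in> Obj A"
  then show "Cmp (whisker_left K (whisker_left L t)) a = Cmp (whisker_left (K \<circ>\<^sub>F L) t) a"
    using t L nattransD(4)[OF t, THEN homD] by simp
qed (simp_all add: comp_func_assoc[OF nattransD(1)[OF t] L] comp_func_assoc[OF nattransD(2)[OF t] L])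

lemma whisker_right_comp:
  assumes t: "is_nattrans C D t" and L: "is_functor B C L" and K: "is_functor A B K"
  shows "whisker_right (whisker_right t L) K = whisker_right t (L \<circ>\<^sub>F K)"
proof (rule nattrans_eqI[of A D])
  show "is_nattrans A D (whisker_right (whisker_right t L) K)" "is_nattrans A D (whisker_right t (L \<circ>\<^sub>F K))"
    using assms nattrans_whisker_right functor_comp_func by metis+
  fix a assume "a \<in> Obj A"
  then show "Cmp (whisker_right (whisker_right t L) K) a = Cmp (whisker_right t (L \<circ>\<^sub>F K)) a"
    using t L K functor_ob[OF K] by simp
qed (simp_all add: comp_func_assoc[OF K L])

lemma whisker_left_right:
  assumes t: "is_nattrans B C t" and H: "is_functor A B H" and K: "is_functor C D K"
  shows "whisker_right (whisker_left K t) H = whisker_left K (whisker_right t H)"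
proof (rule nattrans_eqI[of A D])
  show "is_nattrans A D (whisker_right (whisker_left K t) H)" "is_nattrans A D (whisker_left K (whisker_right t H))"
    using assms nattrans_whisker_right nattrans_whisker_left by metis+
  fix a assume "a \<in> Obj A"
  then show "Cmp (whisker_right (whisker_left K t) H) a = Cmp (whisker_left K (whisker_right t H)) a"
    using t H K functor_ob[OF H] by simp
qed (simp_all add: comp_func_assoc[OF H nattransD(1)[OF t]] comp_func_assoc[OF H nattransD(2)[OF t]])

lemma whisker_left_id:
  assumes "is_nattrans A B t"
  shows "whisker_left (id_func B) t = t"
proof (rule nattrans_eqI[of A B])
  show "is_nattrans A B (whisker_left (id_func B) t)"
    using assms nattrans_whisker_left functor_id_func nattransD(7) by blast
qed (use assms nattransD(4)[OF assms, THEN homD] comp_id_func_left nattransD(1,2)[OF assms] in auto)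

lemma whisker_right_id:
  assumes "is_nattrans A B t"
  shows "whisker_right t (id_func A) = t"
proof (rule nattrans_eqI[of A B])
  show "is_nattrans A B (whisker_right t (id_func A))"
    using assms nattrans_whisker_right functor_id_func nattransD(6) by blast
qed (use assms comp_id_func_right nattransD(1,2)[OF assms] in auto)

lemma whisker_left_comp_nt:
  assumes t: "t \<in> hom (FunCat A B) P Q" and u: "u \<in> hom (FunCat A B) Q R" and K: "is_functor B C K"
  shows "whisker_left K (u \<cdot>\<^bsub>FunCat A B\<^esub> t) = whisker_left K u \<cdot>\<^bsub>FunCat A C\<^esub> whisker_left K t"
proof -
  have t': "is_nattrans A B t" "NDom t = P" "NCod t = Q" and u': "is_nattrans A B u" "NDom u = Q" "NCod u = R"
    using t u by (auto simp: hom_FunCat)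
  have ut: "is_nattrans A B (u \<cdot>\<^bsub>FunCat A B\<^esub> t)" using nattrans_comp t' u' by metis
  have "is_nattrans A C (whisker_left K u \<cdot>\<^bsub>FunCat A C\<^esub> whisker_left K t)"
    using nattrans_whisker_left[OF t'(1) K] nattrans_whisker_left[OF u'(1) K] t' u'
    by (intro nattrans_comp) auto
  then show ?thesis
    by (rule nattrans_eqI[OF nattrans_whisker_left[OF ut K]])
      (use t' u' functor_comp[OF K nattransD(4)[OF t'(1), unfolded t'] nattransD(4)[OF u'(1), unfolded u']] in auto)
qed

lemma whisker_right_comp_nt:
  assumes t: "t \<in> hom (FunCat B C) P Q" and u: "u \<in> hom (FunCat B C) Q R" and H: "is_functor A B H"
  shows "whisker_right (u \<cdot>\<^bsub>FunCat B C\<^esub> t) H = whisker_right u H \<cdot>\<^bsub>FunCat A C\<^esub> whisker_right t H"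
proof -
  have t': "is_nattrans B C t" "NDom t = P" "NCod t = Q" and u': "is_nattrans B C u" "NDom u = Q" "NCod u = R"
    using t u by (auto simp: hom_FunCat)
  have ut: "is_nattrans B C (u \<cdot>\<^bsub>FunCat B C\<^esub> t)" using nattrans_comp t' u' by metis
  have "is_nattrans A C (whisker_right u H \<cdot>\<^bsub>FunCat A C\<^esub> whisker_right t H)"
    using nattrans_whisker_right[OF t'(1) H] nattrans_whisker_right[OF u'(1) H] t' u'
    by (intro nattrans_comp) auto
  then show ?thesis
    by (rule nattrans_eqI[OF nattrans_whisker_right[OF ut H]]) (use t' u' H functor_ob[OF H] in auto)
qed

section \<open>Postcomposition as a 2-functor\<close>

lemma post_sel [simp]:
  "Src (post J F) = FunCat J (Src F)" "Tgt (post J F) = FunCat J (Tgt F)"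
  "is_functor J (Src F) X \<Longrightarrow> OMap (post J F) X = F \<circ>\<^sub>F X"
  "is_nattrans J (Src F) t \<Longrightarrow> AMap (post J F) t = whisker_left F t"
  by (simp_all add: post_def)

lemma whisker_left_ide:
  assumes X: "is_functor A B X" and K: "is_functor B C K"
  shows "whisker_left K (Ide (FunCat A B) X) = Ide (FunCat A C) (K \<circ>\<^sub>F X)"
  by (rule nattrans_eqI[OF nattrans_whisker_left[OF nattrans_ide[OF X] K] nattrans_ide[OF functor_comp_func[OF X K]]])
    (use X functor_ide[OF K] functor_ob[OF X] in auto)

lemma whisker_right_ide:
  assumes X: "is_functor B C X" and H: "is_functor A B H"
  shows "whisker_right (Ide (FunCat B C) X) H = Ide (FunCat A C) (X \<circ>\<^sub>F H)"
  by (rule nattrans_eqI[OF nattrans_whisker_right[OF nattrans_ide[OF X] H] nattrans_ide[OF functor_comp_func[OF H X]]])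
    (use X H functor_ob[OF H] in auto)

lemma functor_post:
  assumes J: "category J" and F: "is_functor C D F"
  shows "is_functor (FunCat J C) (FunCat J D) (post J F)"
proof (rule functorI)
  show "category (FunCat J C)" "category (FunCat J D)" using category_FunCat J functor_cat[OF F] by blast+
  show "OMap (post J F) a \<in> Obj (FunCat J D)" if "a \<in> Obj (FunCat J C)" for a
    using that F functor_comp_func[OF _ F] by simp
  show "AMap (post J F) f \<in> hom (FunCat J D) (OMap (post J F) a) (OMap (post J F) b)"
    if "f \<in> hom (FunCat J C) a b" for f a b
    using that F nattrans_whisker_left[OF _ F] nattransD(1,2)[of J C f] by (auto simp: hom_FunCat)
  show "AMap (post J F) (Ide (FunCat J C) X) = Ide (FunCat J D) (OMap (post J F) X)"
    if "X \<in> Obj (FunCat J C)" for X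
    using that F whisker_left_ide[OF _ F, of J X] nattrans_ide[of J C X] by simp
  show "AMap (post J F) (g \<cdot>\<^bsub>FunCat J C\<^esub> f) = AMap (post J F) g \<cdot>\<^bsub>FunCat J D\<^esub> AMap (post J F) f"
    if "f \<in> hom (FunCat J C) a b" "g \<in> hom (FunCat J C) b c" for a b c f g
    using that F whisker_left_comp_nt[OF that F] nattrans_comp[of J C f g] by (simp add: hom_FunCat)
qed (use F in \<open>auto simp: post_def\<close>)

lemma post_comp:
  assumes J: "category J" and F: "is_functor A B F" and G: "is_functor B C G"
  shows "post J (G \<circ>\<^sub>F F) = post J G \<circ>\<^sub>F post J F"
proof (rule functor_eqI)
  show "is_functor (FunCat J A) (FunCat J C) (post J (G \<circ>\<^sub>F F))"
    by (rule functor_post[OF J functor_comp_func[OF F G]])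
  show "is_functor (FunCat J A) (FunCat J C) (post J G \<circ>\<^sub>F post J F)"
    by (rule functor_comp_func[OF functor_post[OF J F] functor_post[OF J G]])
  show "OMap (post J (G \<circ>\<^sub>F F)) a = OMap (post J G \<circ>\<^sub>F post J F) a" if "a \<in> Obj (FunCat J A)" for a
    using that F G by (simp add: comp_func_assoc[OF _ F] functor_comp_func[OF _ F])
  show "AMap (post J (G \<circ>\<^sub>F F)) a = AMap (post J G \<circ>\<^sub>F post J F) a" if "a \<in> Arr (FunCat J A)" for a
    using that F G by (simp add: whisker_left_comp[OF _ F G] nattrans_whisker_left[OF _ F])
qed

lemma post_id:
  assumes J: "category J" and A: "category A"
  shows "post J (id_func A) = id_func (FunCat J A)"
  by (rule functor_eqI[OF functor_post[OF J functor_id_func[OF A]] functor_id_func[OF category_FunCat[OF J A]]])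
    (auto simp: comp_id_func_left whisker_left_id)

lemma post_nt_sel [simp]:
  "NDom (post_nt J t) = post J (NDom t)" "NCod (post_nt J t) = post J (NCod t)"
  "is_functor J (Src (NDom t)) X \<Longrightarrow> Cmp (post_nt J t) X = whisker_right t X"
  by (simp_all add: post_nt_def)

lemma nattrans_post_nt:
  assumes J: "category J" and t: "is_nattrans C D t"
  shows "is_nattrans (FunCat J C) (FunCat J D) (post_nt J t)"
proof (rule nattransI)
  note tD = nattransD[OF t]
  show "is_functor (FunCat J C) (FunCat J D) (NDom (post_nt J t))"
    "is_functor (FunCat J C) (FunCat J D) (NCod (post_nt J t))"
    using functor_post J tD by auto
  show "Cmp (post_nt J t) \<in> extensional (Obj (FunCat J C))"
    using t by (simp add: post_nt_def)
  show "Cmp (post_nt J t) X \<in> hom (FunCat J D) (OMap (NDom (post_nt J t)) X) (OMap (NCod (post_nt J t)) X)"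
    if "X \<in> Obj (FunCat J C)" for X
    using that t nattrans_whisker_right[OF t, of J X] by (simp add: hom_FunCat)
  show "Cmp (post_nt J t) Y \<cdot>\<^bsub>FunCat J D\<^esub> AMap (NDom (post_nt J t)) f
      = AMap (NCod (post_nt J t)) f \<cdot>\<^bsub>FunCat J D\<^esub> Cmp (post_nt J t) X"
    if "f \<in> hom (FunCat J C) X Y" for X Y f
  proof -
    have f: "is_nattrans J C f" "NDom f = X" "NCod f = Y" using that by (auto simp: hom_FunCat)
    note fD = nattransD[OF f(1), unfolded f]
    have "Cmp t (OMap Y a) \<cdot>\<^bsub>D\<^esub> AMap (NDom t) (Cmp f a) = AMap (NCod t) (Cmp f a) \<cdot>\<^bsub>D\<^esub> Cmp t (OMap X a)"
      if "a \<in> Obj J" for a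
      using tD(5)[OF fD(4)[OF that]] .
    then show ?thesis using f fD(1,2) t
      by (auto simp: comp_func_assoc)
  qed
qed

lemma post_nt_whisker_left:
  assumes J: "category J" and t: "is_nattrans A B t" and K: "is_functor B C K"
  shows "post_nt J (whisker_left K t) = whisker_left (post J K) (post_nt J t)"
proof (rule nattrans_eqI)
  show "is_nattrans (FunCat J A) (FunCat J C) (post_nt J (whisker_left K t))"
    using nattrans_post_nt[OF J nattrans_whisker_left[OF t K]] .
  show "is_nattrans (FunCat J A) (FunCat J C) (whisker_left (post J K) (post_nt J t))"
    using nattrans_whisker_left[OF nattrans_post_nt[OF J t] functor_post[OF J K]] .
  show "Cmp (post_nt J (whisker_left K t)) X = Cmp (whisker_left (post J K) (post_nt J t)) X"
    if "X \<in> Obj (FunCat J A)" for X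
    using that t K by (simp add: whisker_left_right[OF t _ K] nattrans_whisker_right[OF t])
qed (use post_comp[OF J nattransD(1)[OF t] K] post_comp[OF J nattransD(2)[OF t] K] in auto)

lemma post_nt_whisker_right:
  assumes J: "category J" and t: "is_nattrans B C t" and H: "is_functor A B H"
  shows "post_nt J (whisker_right t H) = whisker_right (post_nt J t) (post J H)"
proof (rule nattrans_eqI)
  show "is_nattrans (FunCat J A) (FunCat J C) (post_nt J (whisker_right t H))"
    using nattrans_post_nt[OF J nattrans_whisker_right[OF t H]] .
  show "is_nattrans (FunCat J A) (FunCat J C) (whisker_right (post_nt J t) (post J H))"
    using nattrans_whisker_right[OF nattrans_post_nt[OF J t] functor_post[OF J H]] .
  show "Cmp (post_nt J (whisker_right t H)) X = Cmp (whisker_right (post_nt J t) (post J H)) X"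
    if "X \<in> Obj (FunCat J A)" for X
    using that t H by (simp add: whisker_right_comp[OF t H] functor_comp_func[OF _ H])
qed (use post_comp[OF J H nattransD(1)[OF t]] post_comp[OF J H nattransD(2)[OF t]] in auto)

lemma post_nt_ide:
  assumes J: "category J" and F: "is_functor A B F"
  shows "post_nt J (Ide (FunCat A B) F) = Ide (FunCat (FunCat J A) (FunCat J B)) (post J F)"
proof (rule nattrans_eqI[OF nattrans_post_nt[OF J nattrans_ide[OF F]] nattrans_ide[OF functor_post[OF J F]]])
  show "Cmp (post_nt J (Ide (FunCat A B) F)) X = Cmp (Ide (FunCat (FunCat J A) (FunCat J B)) (post J F)) X"
    if "X \<in> Obj (FunCat J A)" for X
    using that F whisker_right_ide[OF F, of J X] by simp
qed auto

lemma post_nt_comp: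
  assumes J: "category J" and t: "t \<in> hom (FunCat A B) P Q" and u: "u \<in> hom (FunCat A B) Q R"
  shows "post_nt J (u \<cdot>\<^bsub>FunCat A B\<^esub> t) = post_nt J u \<cdot>\<^bsub>FunCat (FunCat J A) (FunCat J B)\<^esub> post_nt J t"
proof -
  have t': "is_nattrans A B t" "NDom t = P" "NCod t = Q" and u': "is_nattrans A B u" "NDom u = Q" "NCod u = R"
    using t u by (auto simp: hom_FunCat)
  have ut: "is_nattrans A B (u \<cdot>\<^bsub>FunCat A B\<^esub> t)" using nattrans_comp t' u' by metis
  have "is_nattrans (FunCat J A) (FunCat J B) (post_nt J u \<cdot>\<^bsub>FunCat (FunCat J A) (FunCat J B)\<^esub> post_nt J t)"
    using nattrans_post_nt[OF J t'(1)] nattrans_post_nt[OF J u'(1)] t' u'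
    by (intro nattrans_comp) auto
  then show ?thesis
  proof (rule nattrans_eqI[OF nattrans_post_nt[OF J ut]])
    show "Cmp (post_nt J (u \<cdot>\<^bsub>FunCat A B\<^esub> t)) X
        = Cmp (post_nt J u \<cdot>\<^bsub>FunCat (FunCat J A) (FunCat J B)\<^esub> post_nt J t) X"
      if "X \<in> Obj (FunCat J A)" for X
      using that whisker_right_comp_nt[OF t u, of J X] t'(1) u'(1) ut by simp
  qed (use t' u' in auto)
qed

section \<open>Constant simplicial objects and diagonals\<close>

lemma Delta_sel [simp]:
  "Obj Delta = UNIV" "Dom Delta (m, n, f) = m" "Cod Delta (m, n, f) = n"
  "Ide Delta n = (n, n, \<lambda>i\<in>{..n}. i)"
  "Comp Delta (n', p, g) (m, n, f) = (m, p, compose {..m} g f)"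
  by (simp_all add: Delta_def)

lemma hom_Delta: "x \<in> hom Delta m n \<longleftrightarrow> (\<exists>f. x = (m, n, f) \<and> f \<in> {..m} \<rightarrow>\<^sub>E {..n} \<and> mono_on {..m} f)"
  by (auto simp: hom_def Delta_def)

lemma category_Delta: "category Delta"
proof
  fix f a b g c
  assume f: "f \<in> hom Delta a b" and g: "g \<in> hom Delta b c"
  then obtain f' g' where e: "f = (a, b, f')" "f' \<in> {..a} \<rightarrow>\<^sub>E {..b}" "mono_on {..a} f'"
    "g = (b, c, g')" "g' \<in> {..b} \<rightarrow>\<^sub>E {..c}" "mono_on {..b} g'" by (auto simp: hom_Delta)
  then have "compose {..a} g' f' \<in> {..a} \<rightarrow>\<^sub>E {..c}" by (auto simp: compose_def PiE_def Pi_def)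
  moreover have "mono_on {..a} (compose {..a} g' f')"
    using e unfolding mono_on_def compose_def PiE_def Pi_def by simp
  ultimately show "g \<cdot>\<^bsub>Delta\<^esub> f \<in> hom Delta a c" using e by (auto simp: hom_Delta)
next
  fix f a b g c h d
  assume "f \<in> hom Delta a b" "g \<in> hom Delta b c" "h \<in> hom Delta c d"
  then show "(h \<cdot>\<^bsub>Delta\<^esub> g) \<cdot>\<^bsub>Delta\<^esub> f = h \<cdot>\<^bsub>Delta\<^esub> (g \<cdot>\<^bsub>Delta\<^esub> f)"
    by (auto simp: hom_Delta PiE_def Pi_def compose_def restrict_def fun_eq_iff)
next
  fix a show "Ide Delta a \<in> hom Delta a a" by (auto simp: hom_Delta mono_on_def)
qed (auto simp: hom_Delta compose_def PiE_def Pi_def extensional_def restrict_def fun_eq_iff)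

abbreviation \<Delta>op where "\<Delta>op \<equiv> opp Delta"

lemma category_Dop: "category \<Delta>op"
  using category_opp category_Delta by blast

lemma const_obj_sel [simp]:
  "Src (const_obj D A) = \<Delta>op" "Tgt (const_obj D A) = D" "OMap (const_obj D A) n = A"
  "f \<in> Arr Delta \<Longrightarrow> AMap (const_obj D A) f = Ide D A"
  by (simp_all add: const_obj_def)

lemma functor_const_obj:
  assumes D: "category D" and A: "A \<in> Obj D"
  shows "is_functor \<Delta>op D (const_obj D A)"
  by (rule functorI)
    (use D A category_Dop category.ide_in_hom[OF D A] category.comp_ide_left[OF D] in
      \<open>auto simp: const_obj_def hom_opp homD category.ide_in_hom[OF category_Delta, THEN homD, simplified]
        category.comp_in_hom[OF category_Delta, THEN homD]\<close>)

lemma const_func_sel [simp]: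
  "Src (const_func D) = D" "Tgt (const_func D) = Simp D"
  "A \<in> Obj D \<Longrightarrow> OMap (const_func D) A = const_obj D A"
  "f \<in> Arr D \<Longrightarrow> AMap (const_func D) f = \<lparr>NDom = const_obj D (Dom D f), NCod = const_obj D (Cod D f),
                         Cmp = (\<lambda>n\<in>Obj Delta. f)\<rparr>"
  by (simp_all add: const_func_def)

lemma nattrans_const:
  assumes D: "category D" and f: "f \<in> hom D a b"
  shows "is_nattrans \<Delta>op D \<lparr>NDom = const_obj D a, NCod = const_obj D b, Cmp = (\<lambda>n\<in>UNIV. f)\<rparr>"
  by (rule nattransI)
    (use D f hom_Obj[OF D f] functor_const_obj[OF D] category.comp_ide_left[OF D f] category.comp_ide_right[OF D f]
      in \<open>auto simp: hom_opp homD\<close>)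

lemma functor_const_func:
  assumes D: "category D"
  shows "is_functor D (Simp D) (const_func D)"
proof (rule functorI)
  show "OMap (const_func D) a \<in> Obj (Simp D)" if "a \<in> Obj D" for a
    using that functor_const_obj[OF D] by simp
  show "AMap (const_func D) f \<in> hom (Simp D) (OMap (const_func D) a) (OMap (const_func D) b)"
    if "f \<in> hom D a b" for a b f
    using that nattrans_const[OF D that] hom_Obj[OF D that] homD[OF that] by (simp add: hom_FunCat)
  show "AMap (const_func D) (Ide D a) = Ide (Simp D) (OMap (const_func D) a)" if "a \<in> Obj D" for a
    using that homD[OF category.ide_in_hom[OF D that]] by auto
  show "AMap (const_func D) (g \<cdot>\<^bsub>D\<^esub> f) = AMap (const_func D) g \<cdot>\<^bsub>Simp D\<^esub> AMap (const_func D) f"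
    if "f \<in> hom D a b" "g \<in> hom D b c" for a b c f g
    using homD[OF that(1)] homD[OF that(2)] homD[OF category.comp_in_hom[OF D that]] by auto
qed (use D category_FunCat[OF category_Dop D] in \<open>auto simp: const_func_def\<close>)

lemma comp_const_obj:
  assumes F: "is_functor C D F" and A: "A \<in> Obj C"
  shows "F \<circ>\<^sub>F const_obj C A = const_obj D (OMap F A)"
proof -
  have CD: "category C" "category D" using functor_cat F by auto
  show ?thesis
    by (rule functor_eqI[OF functor_comp_func[OF functor_const_obj[OF CD(1) A] F]
          functor_const_obj[OF CD(2) functor_ob[OF F A]]])
      (use functor_ide[OF F A] in auto)
qed

lemma post_const_func:
  assumes F: "is_functor C D F"
  shows "post \<Delta>op F \<circ>\<^sub>F const_func C = const_func D \<circ>\<^sub>F F"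
proof -
  have CD: "category C" "category D" using functor_cat F by auto
  show ?thesis
  proof (rule functor_eqI[OF functor_comp_func[OF functor_const_func[OF CD(1)] functor_post[OF category_Dop F]]
          functor_comp_func[OF F functor_const_func[OF CD(2)]]])
    show "OMap (post \<Delta>op F \<circ>\<^sub>F const_func C) a = OMap (const_func D \<circ>\<^sub>F F) a" if "a \<in> Obj C" for a
      using that F functor_const_obj[OF CD(1) that] comp_const_obj[OF F that] functor_ob[OF F that] by simp
    show "AMap (post \<Delta>op F \<circ>\<^sub>F const_func C) f = AMap (const_func D \<circ>\<^sub>F F) f" if "f \<in> Arr C" for f
    proof -
      note f = Arr_hom[OF that]
      let ?n = "\<lparr>NDom = const_obj C (Dom C f), NCod = const_obj C (Cod C f), Cmp = (\<lambda>n\<in>UNIV. f)\<rparr>"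
      have n: "is_nattrans \<Delta>op C ?n" by (rule nattrans_const[OF CD(1) f])
      have "whisker_left F ?n = \<lparr>NDom = const_obj D (OMap F (Dom C f)), NCod = const_obj D (OMap F (Cod C f)),
          Cmp = (\<lambda>n\<in>UNIV. AMap F f)\<rparr>"
        by (rule nattrans_eqI[OF nattrans_whisker_left[OF n F] nattrans_const[OF CD(2) functor_hom[OF F f]]])
          (use hom_Obj[OF CD(1) f] comp_const_obj[OF F] in auto)
      then show ?thesis using that F n functor_ar[OF F that] functor_dom[OF F that] functor_cod[OF F that] by simp
    qed
  qed
qed

lemma post_nt_const_func:
  assumes t: "is_nattrans C D t"
  shows "whisker_right (post_nt \<Delta>op t) (const_func C) = whisker_left (const_func D) t"
proof -
  note tD = nattransD[OF t]
  note pt = nattrans_post_nt[OF category_Dop t]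
  show ?thesis
  proof (rule nattrans_eqI[OF nattrans_whisker_right[OF pt functor_const_func[OF tD(6)]]
        nattrans_whisker_left[OF t functor_const_func[OF tD(7)]]])
    fix a assume a: "a \<in> Obj C"
    have "whisker_right t (const_obj C a) = \<lparr>NDom = const_obj D (OMap (NDom t) a), NCod = const_obj D (OMap (NCod t) a),
          Cmp = (\<lambda>n\<in>UNIV. Cmp t a)\<rparr>"
      by (rule nattrans_eqI[OF nattrans_whisker_right[OF t functor_const_obj[OF tD(6) a]]
            nattrans_const[OF tD(7) tD(4)[OF a]]])
        (use comp_const_obj[OF tD(1) a] comp_const_obj[OF tD(2) a] in auto)
    then show "Cmp (whisker_right (post_nt \<Delta>op t) (const_func C)) a = Cmp (whisker_left (const_func D) t) a"
      using a t functor_const_obj[OF tD(6) a] homD[OF tD(4)[OF a]] by simp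
  qed (use post_const_func[OF tD(1)] post_const_func[OF tD(2)] in auto)
qed

lemma diag_obj_sel [simp]:
  "Src (diag_obj D Z) = \<Delta>op" "Tgt (diag_obj D Z) = D" "OMap (diag_obj D Z) n = OMap (OMap Z n) n"
  "x \<in> Arr Delta \<Longrightarrow> AMap (diag_obj D Z) x = AMap (OMap Z (Dom Delta x)) x \<cdot>\<^bsub>D\<^esub> Cmp (AMap Z x) (Cod Delta x)"
  by (simp_all add: diag_obj_def)

text \<open>An arrow \<open>x : [m] \<rightarrow> [n]\<close> of \<open>\<Delta>\<close> acts on the first index of a bisimplicial object \<open>Z\<close> by maps
  \<open>Z\<^sub>n\<^sub>,\<^sub>k \<rightarrow> Z\<^sub>m\<^sub>,\<^sub>k\<close>, which commute with the action on the second index.\<close>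

lemma bisimplicial_hom:
  assumes Z: "is_functor \<Delta>op (Simp D) Z" and x: "x \<in> hom Delta m n"
  shows "is_functor \<Delta>op D (OMap Z m)" "is_nattrans \<Delta>op D (AMap Z x)"
    "NDom (AMap Z x) = OMap Z n" "NCod (AMap Z x) = OMap Z m"
    "Cmp (AMap Z x) k \<in> hom D (OMap (OMap Z n) k) (OMap (OMap Z m) k)"
    "y \<in> hom Delta k l \<Longrightarrow> AMap (OMap Z m) y \<in> hom D (OMap (OMap Z m) l) (OMap (OMap Z m) k)"
    "y \<in> hom Delta k l \<Longrightarrow> Cmp (AMap Z x) k \<cdot>\<^bsub>D\<^esub> AMap (OMap Z n) y = AMap (OMap Z m) y \<cdot>\<^bsub>D\<^esub> Cmp (AMap Z x) l"
proof -
  show f: "is_functor \<Delta>op D (OMap Z m)" using functor_ob[OF Z, of m] by simp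
  have "AMap Z x \<in> hom (Simp D) (OMap Z n) (OMap Z m)" using functor_hom[OF Z] x by (simp add: hom_opp)
  then show n: "is_nattrans \<Delta>op D (AMap Z x)"
    "NDom (AMap Z x) = OMap Z n" "NCod (AMap Z x) = OMap Z m" by (auto simp: hom_FunCat)
  show "Cmp (AMap Z x) k \<in> hom D (OMap (OMap Z n) k) (OMap (OMap Z m) k)"
    using nattransD(4)[OF n(1), of k] n by simp
  show "AMap (OMap Z m) y \<in> hom D (OMap (OMap Z m) l) (OMap (OMap Z m) k)" if "y \<in> hom Delta k l"
    using functor_hom[OF f] that by (simp add: hom_opp)
  show "Cmp (AMap Z x) k \<cdot>\<^bsub>D\<^esub> AMap (OMap Z n) y = AMap (OMap Z m) y \<cdot>\<^bsub>D\<^esub> Cmp (AMap Z x) l" if "y \<in> hom Delta k l"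
    using nattransD(5)[OF n(1)] n that by (simp add: hom_opp)
qed

lemma functor_diag_obj:
  assumes Z: "is_functor \<Delta>op (Simp D) Z" and D: "category D"
  shows "is_functor \<Delta>op D (diag_obj D Z)"
proof (rule functorI)
  note h = bisimplicial_hom[OF Z]
  have i: "Ide Delta n \<in> hom Delta n n" for n using category.ide_in_hom[OF category_Delta] by simp
  show "OMap (diag_obj D Z) n \<in> Obj D" for n
    using functor_ob[OF h(1)[OF i]] by simp
  show d: "AMap (diag_obj D Z) x \<in> hom D (OMap (diag_obj D Z) n) (OMap (diag_obj D Z) m)" if x: "x \<in> hom \<Delta>op n m" for x n m
    using category.comp_in_hom[OF D h(5)[of x m n n] h(6)[OF i, of x m n m]] x homD[of x Delta m n]
    by (simp add: hom_opp)
  show "AMap (diag_obj D Z) (Ide \<Delta>op n) = Ide D (OMap (diag_obj D Z) n)" for n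
  proof -
    have "AMap Z (Ide Delta n) = Ide (Simp D) (OMap Z n)" using functor_ide[OF Z, of n] by simp
    moreover have "AMap (OMap Z n) (Ide Delta n) = Ide D (OMap (OMap Z n) n)"
      using functor_ide[OF h(1)[OF i], of n n] by simp
    moreover have "Ide D (OMap (OMap Z n) n) \<in> hom D (OMap (OMap Z n) n) (OMap (OMap Z n) n)"
      using category.ide_in_hom[OF D] functor_ob[OF h(1)[OF i]] by simp
    ultimately show ?thesis using homD[OF i[of n]] category.comp_ide_left[OF D] by simp
  qed
  show "AMap (diag_obj D Z) (x \<cdot>\<^bsub>\<Delta>op\<^esub> y) = AMap (diag_obj D Z) x \<cdot>\<^bsub>D\<^esub> AMap (diag_obj D Z) y"
    if y: "y \<in> hom \<Delta>op p n" and x: "x \<in> hom \<Delta>op n m" for x y p n m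
  proof -
    have x': "x \<in> hom Delta m n" and y': "y \<in> hom Delta n p" using x y by (auto simp: hom_opp)
    note yx = category.comp_in_hom[OF category_Delta x' y']
    note as = category.comp_assoc[OF D]
    let ?Zx = "Cmp (AMap Z x)" and ?Zy = "Cmp (AMap Z y)" and ?x = "AMap (OMap Z m) x" and ?y = "AMap (OMap Z m) y"
    have "AMap Z (y \<cdot>\<^bsub>Delta\<^esub> x) = AMap Z x \<cdot>\<^bsub>Simp D\<^esub> AMap Z y" using functor_comp[OF Z y x] by simp
    then have 1: "Cmp (AMap Z (y \<cdot>\<^bsub>Delta\<^esub> x)) p = ?Zx p \<cdot>\<^bsub>D\<^esub> ?Zy p" by simp
    have 2: "AMap (OMap Z m) (y \<cdot>\<^bsub>Delta\<^esub> x) = ?x \<cdot>\<^bsub>D\<^esub> ?y" using functor_comp[OF h(1)[OF x'] y x] by simp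
    note hx = h(6)[OF x' x'] and hy = h(6)[OF x' y'] and hZx = h(5)[OF x', of p] and hZy = h(5)[OF y', of p]
    note hZx' = h(5)[OF x', of n] and hyn = h(6)[OF y' y']
    have "AMap (diag_obj D Z) (y \<cdot>\<^bsub>Delta\<^esub> x) = (?x \<cdot>\<^bsub>D\<^esub> ?y) \<cdot>\<^bsub>D\<^esub> (?Zx p \<cdot>\<^bsub>D\<^esub> ?Zy p)"
      using homD[OF yx] 1 2 by simp
    also have "\<dots> = ?x \<cdot>\<^bsub>D\<^esub> ((?y \<cdot>\<^bsub>D\<^esub> ?Zx p) \<cdot>\<^bsub>D\<^esub> ?Zy p)"
      using as[OF category.comp_in_hom[OF D hZy hZx] hy hx] as[OF hZy hZx hy] by simp
    also have "\<dots> = ?x \<cdot>\<^bsub>D\<^esub> ((?Zx n \<cdot>\<^bsub>D\<^esub> AMap (OMap Z n) y) \<cdot>\<^bsub>D\<^esub> ?Zy p)"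
      using h(7)[OF x' y'] by simp
    also have "\<dots> = (?x \<cdot>\<^bsub>D\<^esub> ?Zx n) \<cdot>\<^bsub>D\<^esub> (AMap (OMap Z n) y \<cdot>\<^bsub>D\<^esub> ?Zy p)"
      using as[OF hZy hyn hZx'] as[OF category.comp_in_hom[OF D hZy hyn] hZx' hx] by simp
    finally show ?thesis using homD[OF x'] homD[OF y'] by simp
  qed
qed (use D category_Dop in \<open>auto simp: diag_obj_def\<close>)

lemma diag_func_sel [simp]:
  "Src (diag_func D) = Simp (Simp D)" "Tgt (diag_func D) = Simp D"
  "is_functor \<Delta>op (Simp D) Z \<Longrightarrow> OMap (diag_func D) Z = diag_obj D Z"
  "is_nattrans \<Delta>op (Simp D) t \<Longrightarrow> AMap (diag_func D) t = \<lparr>NDom = diag_obj D (NDom t), NCod = diag_obj D (NCod t),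
        Cmp = (\<lambda>n\<in>Obj Delta. Cmp (Cmp t n) n)\<rparr>"
  by (simp_all add: diag_func_def)

lemma bisimplicial_map:
  assumes "is_nattrans \<Delta>op (Simp D) t"
  shows "is_nattrans \<Delta>op D (Cmp t n)" "NDom (Cmp t n) = OMap (NDom t) n" "NCod (Cmp t n) = OMap (NCod t) n"
  using nattransD(4)[OF assms, of n] by (auto simp: hom_FunCat)

lemma nattrans_diag:
  assumes t: "is_nattrans \<Delta>op (Simp D) t" and D: "category D"
  shows "is_nattrans \<Delta>op D \<lparr>NDom = diag_obj D (NDom t), NCod = diag_obj D (NCod t),
        Cmp = (\<lambda>n\<in>Obj Delta. Cmp (Cmp t n) n)\<rparr>" (is "is_nattrans _ _ ?d")
proof (rule nattransI)
  note tD = nattransD[OF t] and tc = bisimplicial_map[OF t]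
  show "is_functor \<Delta>op D (NDom ?d)" "is_functor \<Delta>op D (NCod ?d)" "Cmp ?d \<in> extensional (Obj \<Delta>op)"
    using functor_diag_obj[OF _ D] tD by auto
  have th: "Cmp (Cmp t n) k \<in> hom D (OMap (OMap (NDom t) n) k) (OMap (OMap (NCod t) n) k)" for n k
    using nattransD(4)[OF tc(1), of k n] tc by simp
  then show "Cmp ?d n \<in> hom D (OMap (NDom ?d) n) (OMap (NCod ?d) n)" for n by simp
  show "Cmp ?d m \<cdot>\<^bsub>D\<^esub> AMap (NDom ?d) x = AMap (NCod ?d) x \<cdot>\<^bsub>D\<^esub> Cmp ?d n" if "x \<in> hom \<Delta>op n m" for x n m
  proof -
    have x: "x \<in> hom Delta m n" using that by (simp add: hom_opp)
    note hZ = bisimplicial_hom[OF tD(1)] and hY = bisimplicial_hom[OF tD(2)]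
    note as = category.comp_assoc[OF D]
    have "Cmp (Cmp t m) m \<cdot>\<^bsub>D\<^esub> (AMap (OMap (NDom t) m) x \<cdot>\<^bsub>D\<^esub> Cmp (AMap (NDom t) x) n)
       = (Cmp (Cmp t m) m \<cdot>\<^bsub>D\<^esub> AMap (OMap (NDom t) m) x) \<cdot>\<^bsub>D\<^esub> Cmp (AMap (NDom t) x) n"
      using as[OF hZ(5)[OF x] hZ(6)[OF x x] th] by simp
    also have "\<dots> = (AMap (OMap (NCod t) m) x \<cdot>\<^bsub>D\<^esub> Cmp (Cmp t m) n) \<cdot>\<^bsub>D\<^esub> Cmp (AMap (NDom t) x) n"
      using nattransD(5)[OF tc(1), of x n m m] that tc by simp
    also have "\<dots> = AMap (OMap (NCod t) m) x \<cdot>\<^bsub>D\<^esub> (Cmp (Cmp t m) n \<cdot>\<^bsub>D\<^esub> Cmp (AMap (NDom t) x) n)"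
      using as[OF hZ(5)[OF x] th hY(6)[OF x x]] by simp
    also have "Cmp (Cmp t m) n \<cdot>\<^bsub>D\<^esub> Cmp (AMap (NDom t) x) n = Cmp (AMap (NCod t) x) n \<cdot>\<^bsub>D\<^esub> Cmp (Cmp t n) n"
      using arg_cong[OF tD(5)[OF that], of "\<lambda>u. Cmp u n"] by simp
    also have "AMap (OMap (NCod t) m) x \<cdot>\<^bsub>D\<^esub> (Cmp (AMap (NCod t) x) n \<cdot>\<^bsub>D\<^esub> Cmp (Cmp t n) n)
        = (AMap (OMap (NCod t) m) x \<cdot>\<^bsub>D\<^esub> Cmp (AMap (NCod t) x) n) \<cdot>\<^bsub>D\<^esub> Cmp (Cmp t n) n"
      using as[OF th hY(5)[OF x] hY(6)[OF x x]] by simp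
    finally show ?thesis using homD[OF x] by simp
  qed
qed

lemma functor_diag_func:
  assumes D: "category D"
  shows "is_functor (Simp (Simp D)) (Simp D) (diag_func D)"
proof (rule functorI)
  have S: "category (Simp D)" by (rule category_FunCat[OF category_Dop D])
  show "category (Simp D)" "category (Simp (Simp D))" using S category_FunCat[OF category_Dop S] by auto
  show "OMap (diag_func D) Z \<in> Obj (Simp D)" if "Z \<in> Obj (Simp (Simp D))" for Z
    using that functor_diag_obj[OF _ D] by simp
  show "AMap (diag_func D) t \<in> hom (Simp D) (OMap (diag_func D) Z) (OMap (diag_func D) Y)"
    if "t \<in> hom (Simp (Simp D)) Z Y" for t Z Y
    using that nattrans_diag[OF _ D, of t] nattransD(1,2)[of \<Delta>op "Simp D" t] by (auto simp: hom_FunCat)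
  show "AMap (diag_func D) (Ide (Simp (Simp D)) Z) = Ide (Simp D) (OMap (diag_func D) Z)"
    if "Z \<in> Obj (Simp (Simp D))" for Z
    using that nattrans_ide[of \<Delta>op "Simp D" Z] by simp
  show "AMap (diag_func D) (u \<cdot>\<^bsub>Simp (Simp D)\<^esub> t) = AMap (diag_func D) u \<cdot>\<^bsub>Simp D\<^esub> AMap (diag_func D) t"
    if t: "t \<in> hom (Simp (Simp D)) P Q" and u: "u \<in> hom (Simp (Simp D)) Q R" for t u P Q R
    using t u nattrans_comp[of \<Delta>op "Simp D" t u] by (auto simp: hom_FunCat)
qed (auto simp: diag_func_def)

lemma post_diag_obj:
  assumes F: "is_functor C D F" and Z: "is_functor \<Delta>op (Simp C) Z"
  shows "F \<circ>\<^sub>F diag_obj C Z = diag_obj D (post \<Delta>op F \<circ>\<^sub>F Z)"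
proof -
  have CD: "category C" "category D" using functor_cat F by auto
  note P = functor_post[OF category_Dop F]
  have Zn: "is_functor \<Delta>op C (OMap Z n)" for n using functor_ob[OF Z, of n] by simp
  show ?thesis
  proof (rule functor_eqI[OF functor_comp_func[OF functor_diag_obj[OF Z CD(1)] F]
        functor_diag_obj[OF functor_comp_func[OF Z P] CD(2)]])
    show "OMap (F \<circ>\<^sub>F diag_obj C Z) n = OMap (diag_obj D (post \<Delta>op F \<circ>\<^sub>F Z)) n" for n
      using F Z Zn[of n] by simp
    show "AMap (F \<circ>\<^sub>F diag_obj C Z) x = AMap (diag_obj D (post \<Delta>op F \<circ>\<^sub>F Z)) x" if "x \<in> Arr \<Delta>op" for x
    proof -
      have x: "x \<in> hom Delta (Dom Delta x) (Cod Delta x)" using that by (simp add: hom_def)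
      note h = bisimplicial_hom[OF Z x]
      show ?thesis using functor_comp[OF F h(5) h(6)[OF x]] F Z Zn[of "Dom Delta x"] Zn[of "Cod Delta x"] h(2,3) that by simp
    qed
  qed
qed

lemma post_diag_func:
  assumes F: "is_functor C D F"
  shows "diag_func D \<circ>\<^sub>F post \<Delta>op (post \<Delta>op F) = post \<Delta>op F \<circ>\<^sub>F diag_func C"
proof -
  have CD: "category C" "category D" using functor_cat F by auto
  note P = functor_post[OF category_Dop F]
  note P2 = functor_post[OF category_Dop P]
  note dC = functor_diag_func[OF CD(1)] and dD = functor_diag_func[OF CD(2)]
  show ?thesis
  proof (rule functor_eqI[OF functor_comp_func[OF P2 dD] functor_comp_func[OF dC P]])
    fix Z assume Z: "Z \<in> Obj (Simp (Simp C))"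
    then have Z': "is_functor \<Delta>op (Simp C) Z" by simp
    show "OMap (diag_func D \<circ>\<^sub>F post \<Delta>op (post \<Delta>op F)) Z = OMap (post \<Delta>op F \<circ>\<^sub>F diag_func C) Z"
      using Z' F post_diag_obj[OF F Z'] functor_comp_func[OF Z' P] functor_diag_obj[OF Z' CD(1)] by simp
  next
    fix t assume "t \<in> Arr (Simp (Simp C))"
    then have t: "is_nattrans \<Delta>op (Simp C) t" by simp
    note tD = nattransD[OF t] and tc = bisimplicial_map[OF t]
    note n = nattrans_whisker_left[OF t P]
    let ?d = "\<lparr>NDom = diag_obj C (NDom t), NCod = diag_obj C (NCod t), Cmp = (\<lambda>n\<in>UNIV. Cmp (Cmp t n) n)\<rparr>"
    have d: "is_nattrans \<Delta>op C ?d" using nattrans_diag[OF t CD(1)] by simp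
    have "AMap (diag_func D) (whisker_left (post \<Delta>op F) t) = whisker_left F ?d"
    proof (rule nattrans_eqI[OF _ nattrans_whisker_left[OF d F]])
      show "is_nattrans \<Delta>op D (AMap (diag_func D) (whisker_left (post \<Delta>op F) t))"
        using nattrans_diag[OF n CD(2)] n by simp
      show "Cmp (AMap (diag_func D) (whisker_left (post \<Delta>op F) t)) k = Cmp (whisker_left F ?d) k" for k
      proof -
        have "Cmp (whisker_left (post \<Delta>op F) t) k = whisker_left F (Cmp t k)"
          using t F tc(1)[of k] by simp
        then show ?thesis using n d tc(1)[of k] by simp
      qed
      show "NDom (AMap (diag_func D) (whisker_left (post \<Delta>op F) t)) = NDom (whisker_left F ?d)"
        "NCod (AMap (diag_func D) (whisker_left (post \<Delta>op F) t)) = NCod (whisker_left F ?d)"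
        using n by (simp_all add: post_diag_obj[OF F tD(1)] post_diag_obj[OF F tD(2)])
    qed
    then show "AMap (diag_func D \<circ>\<^sub>F post \<Delta>op (post \<Delta>op F)) t = AMap (post \<Delta>op F \<circ>\<^sub>F diag_func C) t"
      using t F d by simp
  qed
qed

text \<open>The diagonals of \<open>\<Delta> \<times> X\<close> and of \<open>X \<times> \<Delta>\<close> are \<open>X\<close>.\<close>

lemma diag_const:
  assumes D: "category D"
  shows "diag_func D \<circ>\<^sub>F const_func (Simp D) = id_func (Simp D)"
proof -
  have S: "category (Simp D)" by (rule category_FunCat[OF category_Dop D])
  note c = functor_const_func[OF S]
  have e: "diag_obj D (const_obj (Simp D) X) = X" if X: "is_functor \<Delta>op D X" for X
  proof -
    have cX: "is_functor \<Delta>op (Simp D) (const_obj (Simp D) X)" using functor_const_obj[OF S] X by simp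
    show ?thesis
    proof (rule functor_eqI[OF functor_diag_obj[OF cX D] X])
      show "AMap (diag_obj D (const_obj (Simp D) X)) x = AMap X x" if "x \<in> Arr \<Delta>op" for x
        using that category.comp_ide_right[OF D functor_hom[OF X Arr_hom[OF that]]] by simp
    qed simp
  qed
  show ?thesis
  proof (rule functor_eqI[OF functor_comp_func[OF c functor_diag_func[OF D]] functor_id_func[OF S]])
    show "OMap (diag_func D \<circ>\<^sub>F const_func (Simp D)) X = OMap (id_func (Simp D)) X" if "X \<in> Obj (Simp D)" for X
      using that e functor_const_obj[OF S that] by simp
    show "AMap (diag_func D \<circ>\<^sub>F const_func (Simp D)) t = AMap (id_func (Simp D)) t" if "t \<in> Arr (Simp D)" for t
    proof -
      have t: "is_nattrans \<Delta>op D t" using that by simp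
      have "is_nattrans \<Delta>op (Simp D) (AMap (const_func (Simp D)) t)" using functor_ar[OF c that] by simp
      moreover have "Cmp t = (\<lambda>n\<in>UNIV. Cmp t n)" by auto
      ultimately show ?thesis using that t e[OF nattransD(1)[OF t]] e[OF nattransD(2)[OF t]] by simp
    qed
  qed
qed

lemma diag_post_const:
  assumes D: "category D"
  shows "diag_func D \<circ>\<^sub>F post \<Delta>op (const_func D) = id_func (Simp D)"
proof -
  have S: "category (Simp D)" by (rule category_FunCat[OF category_Dop D])
  note k = functor_const_func[OF D]
  note c = functor_post[OF category_Dop k]
  have e: "diag_obj D (const_func D \<circ>\<^sub>F X) = X" if X: "is_functor \<Delta>op D X" for X
  proof -
    note cX = functor_comp_func[OF X k]
    note SX = functor_sel[OF X]
    show ?thesis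
    proof (rule functor_eqI[OF functor_diag_obj[OF cX D] X])
      show "OMap (diag_obj D (const_func D \<circ>\<^sub>F X)) n = OMap X n" for n
        using functor_ob[OF X, of n] by (simp add: SX)
      show "AMap (diag_obj D (const_func D \<circ>\<^sub>F X)) x = AMap X x" if "x \<in> Arr \<Delta>op" for x
        using that category.comp_ide_left[OF D functor_hom[OF X Arr_hom[OF that]]]
          functor_ob[OF X, of "Dom Delta x"] functor_ar[OF X that] by (simp add: SX)
    qed
  qed
  show ?thesis
  proof (rule functor_eqI[OF functor_comp_func[OF c functor_diag_func[OF D]] functor_id_func[OF S]])
    show "OMap (diag_func D \<circ>\<^sub>F post \<Delta>op (const_func D)) X = OMap (id_func (Simp D)) X" if "X \<in> Obj (Simp D)" for X
      using that e functor_comp_func[OF _ k, of \<Delta>op X] by simp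
    show "AMap (diag_func D \<circ>\<^sub>F post \<Delta>op (const_func D)) t = AMap (id_func (Simp D)) t" if "t \<in> Arr (Simp D)" for t
    proof -
      have t: "is_nattrans \<Delta>op D t" using that by simp
      note n = nattrans_whisker_left[OF t k]
      have "Cmp (Cmp (whisker_left (const_func D) t) n) n = Cmp t n" for n
        using homD[OF nattransD(4)[OF t, of n]] by (simp add: nattrans_Src[OF t])
      moreover have "Cmp t = (\<lambda>n\<in>UNIV. Cmp t n)" by auto
      ultimately show ?thesis using that t n e[OF nattransD(1)[OF t]] e[OF nattransD(2)[OF t]] by simp
    qed
  qed
qed

section \<open>The calculus of zigzags\<close>

text \<open>\<open>zig X V a u b\<close>: the word \<open>u\<close> is a zigzag of weak equivalences from \<open>a\<close> to \<open>b\<close>.\<close>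

definition zig :: "('o, 'm) category \<Rightarrow> 'm set \<Rightarrow> 'o \<Rightarrow> 'm letter list \<Rightarrow> 'o \<Rightarrow> bool" where
  "zig X V a u b \<longleftrightarrow> path X V a u b \<and> arrow ` set u \<subseteq> V"

text \<open>\<open>zeq X V a b u v\<close>: the zigzags \<open>u\<close> and \<open>v\<close> become equal in the localization.\<close>

definition zeq :: "('o, 'm) category \<Rightarrow> 'm set \<Rightarrow> 'o \<Rightarrow> 'o \<Rightarrow> 'm letter list \<Rightarrow> 'm letter list \<Rightarrow> bool" where
  "zeq X V a b u v \<longleftrightarrow> gz_eq X V a b u v \<and> zig X V a u b \<and> zig X V a v b"

text \<open>The formal inverse of a letter and of a word. For zigzags it represents the inverse arrow of the
  localization.\<close>

fun flip :: "'m letter \<Rightarrow> 'm letter" where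
  "flip (Fwd f) = Bwd f"
| "flip (Bwd f) = Fwd f"

definition winv :: "'m letter list \<Rightarrow> 'm letter list" where
  "winv u = rev (map flip u)"

lemma arrow_flip [simp]: "arrow (flip l) = arrow l"
  by (cases l) auto

lemma winv_simps [simp]:
  "winv [] = []" "winv (l # u) = winv u @ [flip l]" "winv (u @ v) = winv v @ winv u"
  by (simp_all add: winv_def)

lemma map_letter_flip: "map_letter \<phi> (flip l) = flip (map_letter \<phi> l)"
  by (cases l) auto

lemma wmap_winv: "map (map_letter \<phi>) (winv u) = winv (map (map_letter \<phi>) u)"
  by (simp add: winv_def rev_map map_letter_flip)

lemma zig_append: "zig X V a u b \<Longrightarrow> zig X V b v c \<Longrightarrow> zig X V a (u @ v) c"
  by (auto simp: zig_def path_append)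

lemma zig_Obj: "category X \<Longrightarrow> zig X V a u b \<Longrightarrow> a \<in> Obj X \<and> b \<in> Obj X"
  using path_Obj zig_def by metis

lemma zig_Nil: "zig X V a [] b \<longleftrightarrow> a \<in> Obj X \<and> a = b"
  by (auto simp: zig_def)

lemma zig_Fwd: "zig X V a (Fwd f # u) b \<longleftrightarrow> f \<in> V \<and> f \<in> Arr X \<and> Dom X f = a \<and> zig X V (Cod X f) u b"
  by (auto simp: zig_def)

lemma zig_Bwd: "zig X V a (Bwd f # u) b \<longleftrightarrow> f \<in> V \<and> f \<in> Arr X \<and> Cod X f = a \<and> zig X V (Dom X f) u b"
  by (auto simp: zig_def)

lemma zig_winv: "category X \<Longrightarrow> zig X V a u b \<Longrightarrow> zig X V b (winv u) a"
proof (induction u arbitrary: a)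
  case Nil
  then show ?case by (auto simp: zig_Nil)
next
  case (Cons l u)
  show ?case
  proof (cases l)
    case (Fwd f)
    then have f: "f \<in> V" "f \<in> Arr X" "Dom X f = a" "zig X V (Cod X f) u b" using Cons.prems by (auto simp: zig_Fwd)
    then show ?thesis using zig_append[OF Cons.IH[OF Cons.prems(1) f(4)], of "[Bwd f]" a] Fwd
      category.dom_in_Obj[OF Cons.prems(1)] by (auto simp: zig_Bwd zig_Nil)
  next
    case (Bwd f)
    then have f: "f \<in> V" "f \<in> Arr X" "Cod X f = a" "zig X V (Dom X f) u b" using Cons.prems by (auto simp: zig_Bwd)
    then show ?thesis using zig_append[OF Cons.IH[OF Cons.prems(1) f(4)], of "[Fwd f]" a] Bwd
      category.cod_in_Obj[OF Cons.prems(1)] by (auto simp: zig_Fwd zig_Nil)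
  qed
qed

lemma zeq_refl: "zig X V a u b \<Longrightarrow> zeq X V a b u u"
  by (auto simp: zeq_def zig_def intro: gz_eq.refl)

lemma zeq_sym: "zeq X V a b u v \<Longrightarrow> zeq X V a b v u"
  by (auto simp: zeq_def intro: gz_eq.sym)

lemma zeq_trans [trans]: "zeq X V a b u v \<Longrightarrow> zeq X V a b v w \<Longrightarrow> zeq X V a b u w"
  by (auto simp: zeq_def intro: gz_eq.trans)

lemma zeq_append: "zeq X V a b u u' \<Longrightarrow> zeq X V b c v v' \<Longrightarrow> zeq X V a c (u @ v) (u' @ v')"
  by (auto simp: zeq_def intro: gz_eq.append zig_append)

lemma zeq_append_left: "zig X V a u b \<Longrightarrow> zeq X V b c v v' \<Longrightarrow> zeq X V a c (u @ v) (u @ v')"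
  by (rule zeq_append[OF zeq_refl])

lemma zeq_append_right: "zeq X V a b u u' \<Longrightarrow> zig X V b v c \<Longrightarrow> zeq X V a c (u @ v) (u' @ v)"
  by (rule zeq_append[OF _ zeq_refl])

lemma winv_winv [simp]: "winv (winv u) = u"
proof -
  have "flip (flip l) = l" for l :: "'a letter" by (cases l) auto
  then show ?thesis by (simp add: winv_def rev_map comp_def)
qed

lemma zeq_winv_right: "category X \<Longrightarrow> zig X V a u b \<Longrightarrow> zeq X V a a (u @ winv u) []"
proof (induction u arbitrary: a)
  case Nil
  then show ?case by (auto simp: zig_Nil intro: zeq_refl)
next
  case (Cons l u)
  define c where "c = (case l of Fwd f \<Rightarrow> Cod X f | Bwd f \<Rightarrow> Dom X f)"
  have u: "zig X V c u b" and l: "zig X V a [l] c"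
    using Cons.prems category.dom_in_Obj[OF Cons.prems(1)] category.cod_in_Obj[OF Cons.prems(1)]
    by (cases l; auto simp: c_def zig_Fwd zig_Bwd zig_Nil)+
  have l': "zig X V c [flip l] a" using zig_winv[OF Cons.prems(1) l] by simp
  have "zeq X V a a ([l] @ ((u @ winv u) @ [flip l])) ([l] @ ([] @ [flip l]))"
    using zeq_append_left[OF l zeq_append_right[OF Cons.IH[OF Cons.prems(1) u] l']] .
  moreover have "gz_eq X V a a [l, flip l] []"
    by (cases l) (use l gz_eq.inv_right[of _ V X] gz_eq.inv_left[of _ V X] in
      \<open>auto simp: zig_Fwd zig_Bwd zig_Nil hom_def\<close>)
  then have "zeq X V a a [l, flip l] []"
    using zig_append[OF l l'] zig_Obj[OF Cons.prems(1) l] by (auto simp: zeq_def zig_Nil)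
  ultimately show ?case using zeq_trans by fastforce
qed

lemma zeq_winv_left: "category X \<Longrightarrow> zig X V a u b \<Longrightarrow> zeq X V b b (winv u @ u) []"
  using zeq_winv_right[of X V b "winv u" a] zig_winv[of X V a u b] by simp

text \<open>If \<open>p r = q t\<close> (in diagrammatic order), then \<open>p\<^sup>-\<^sup>1 q = r t\<^sup>-\<^sup>1\<close>.\<close>

lemma zeq_rotate:
  assumes X: "category X" and e: "zeq X V a d (p @ r) (q @ t)"
    and p: "zig X V a p b" and r: "zig X V b r d" and q: "zig X V a q c" and t: "zig X V c t d"
  shows "zeq X V b c (winv p @ q) (r @ winv t)"
proof -
  note z = zig_winv[OF X p] zig_winv[OF X t]
  have "zeq X V b c (winv p @ (q @ (t @ winv t))) (winv p @ (q @ []))"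
    by (rule zeq_append_left[OF z(1)], rule zeq_append_left[OF q], rule zeq_winv_right[OF X t])
  then have "zeq X V b c (winv p @ q) (winv p @ ((q @ t) @ winv t))"
    by (simp add: zeq_sym)
  also have "zeq X V b c (winv p @ ((q @ t) @ winv t)) (winv p @ ((p @ r) @ winv t))"
    by (rule zeq_append_left[OF z(1)], rule zeq_append_right[OF zeq_sym[OF e] z(2)])
  also have "zeq X V b c (winv p @ ((p @ r) @ winv t)) (r @ winv t)"
    using zeq_append_right[OF zeq_winv_left[OF X p] zig_append[OF r z(2)]] by simp
  finally show ?thesis .
qed

lemma zeq_cancel_right:
  assumes X: "category X" and e: "zeq X V a c (u @ w) (v @ w)"
    and u: "zig X V a u b" and v: "zig X V a v b" and w: "zig X V b w c"
  shows "zeq X V a b u v"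
proof -
  note w' = zig_winv[OF X w]
  have "zeq X V a b (u @ (w @ winv w)) (v @ (w @ winv w))"
    using zeq_append_right[OF e w'] by simp
  moreover have "zeq X V a b (u @ (w @ winv w)) (u @ [])" "zeq X V a b (v @ (w @ winv w)) (v @ [])"
    using zeq_append_left[OF _ zeq_winv_right[OF X w]] u v by blast+
  ultimately show ?thesis by (metis append_Nil2 zeq_sym zeq_trans)
qed

text \<open>\<open>weq_functor X V Y V' ob \<phi>\<close>: \<open>ob\<close> and \<open>\<phi>\<close> are the object and arrow parts of a functor
  \<open>X \<rightarrow> Y\<close> that sends \<open>V\<close> into \<open>V'\<close>.\<close>

definition weq_functor where
  "weq_functor X V Y V' ob \<phi> \<longleftrightarrow>
     (\<forall>a \<in> Obj X. ob a \<in> Obj Y \<and> \<phi> (Ide X a) = Ide Y (ob a)) \<and>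
     (\<forall>a b. \<forall>f \<in> hom X a b. \<phi> f \<in> hom Y (ob a) (ob b)) \<and>
     (\<forall>a b c. \<forall>f \<in> hom X a b. \<forall>g \<in> hom X b c. \<phi> (g \<cdot>\<^bsub>X\<^esub> f) = \<phi> g \<cdot>\<^bsub>Y\<^esub> \<phi> f) \<and>
     (\<forall>f \<in> V. \<phi> f \<in> V')"

lemma weq_functor_path:
  assumes "weq_functor X V Y V' ob \<phi>"
  shows "path X V a u b \<Longrightarrow> path Y V' (ob a) (map (map_letter \<phi>) u) (ob b)"
proof (induction u arbitrary: a)
  case Nil
  then show ?case using assms by (auto simp: weq_functor_def)
next
  case (Cons l u)
  have "\<phi> f \<in> hom Y (ob (Dom X f)) (ob (Cod X f))" if "f \<in> Arr X" for f
    using assms Arr_hom[OF that] by (auto simp: weq_functor_def)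
  moreover have "\<phi> f \<in> V'" if "f \<in> V" for f using assms that by (auto simp: weq_functor_def)
  ultimately show ?case using Cons by (cases l) (auto simp: hom_def)
qed

lemma weq_functor_gz_eq:
  assumes w: "weq_functor X V Y V' ob \<phi>"
  shows "gz_eq X V a b u v \<Longrightarrow> gz_eq Y V' (ob a) (ob b) (map (map_letter \<phi>) u) (map (map_letter \<phi>) v)"
proof (induction rule: gz_eq.induct)
  case (refl a u b)
  then show ?case using weq_functor_path[OF w] gz_eq.refl by metis
next
  case (sym a b u v)
  then show ?case using gz_eq.sym by metis
next
  case (trans a b u v w)
  then show ?case using gz_eq.trans by metis
next
  case (append a b u u' c v v')
  then show ?case unfolding map_append by (intro gz_eq.append)
next
  case (ide a)
  then show ?case using w gz_eq.ide[of "ob a" Y V'] by (simp add: weq_functor_def)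
next
  case (comp f a b g c)
  then have "\<phi> f \<in> hom Y (ob a) (ob b)" "\<phi> g \<in> hom Y (ob b) (ob c)" "\<phi> (g \<cdot>\<^bsub>X\<^esub> f) = \<phi> g \<cdot>\<^bsub>Y\<^esub> \<phi> f"
    using w by (simp_all add: weq_functor_def)
  then show ?case using gz_eq.comp[of "\<phi> f" Y "ob a" "ob b" "\<phi> g" "ob c" V'] by simp
next
  case (inv_right f a b)
  then show ?case using w gz_eq.inv_right[of "\<phi> f" V' Y "ob a" "ob b"] by (simp add: weq_functor_def)
next
  case (inv_left f a b)
  then show ?case using w gz_eq.inv_left[of "\<phi> f" V' Y "ob a" "ob b"] by (simp add: weq_functor_def)
qed

lemma weq_functor_zig:
  assumes "weq_functor X V Y V' ob \<phi>" "zig X V a u b"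
  shows "zig Y V' (ob a) (map (map_letter \<phi>) u) (ob b)"
proof -
  have "\<phi> f \<in> V'" if "f \<in> V" for f using assms that by (auto simp: weq_functor_def)
  moreover have "arrow (map_letter \<phi> l) = \<phi> (arrow l)" for l by (cases l) auto
  then have "arrow ` set (map (map_letter \<phi>) u) = \<phi> ` arrow ` set u" by (simp add: image_image)
  ultimately show ?thesis using assms weq_functor_path[OF assms(1)] unfolding zig_def by auto
qed

lemma weq_functor_zeq:
  assumes "weq_functor X V Y V' ob \<phi>" "zeq X V a b u v"
  shows "zeq Y V' (ob a) (ob b) (map (map_letter \<phi>) u) (map (map_letter \<phi>) v)"
  using assms weq_functor_zig weq_functor_gz_eq unfolding zeq_def by metis

section \<open>Zigzags of natural weak equivalences\<close>

text \<open>Whiskering of words, letter by letter: \<open>wl K z\<close> is \<open>K z\<close>, \<open>wr z H\<close> is \<open>z H\<close>, and \<open>pn J z\<close> is the word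
  induced by \<open>z\<close> on diagrams of shape \<open>J\<close>. The predicates \<open>nzig\<close> and \<open>nzeq\<close> are \<open>zig\<close> and \<open>zeq\<close> for natural
  weak equivalences between functors \<open>A \<rightarrow> B\<close>.\<close>

abbreviation wl where "wl K z \<equiv> map (map_letter (whisker_left K)) z"
abbreviation wr where "wr z H \<equiv> map (map_letter (\<lambda>t. whisker_right t H)) z"
abbreviation pn where "pn J z \<equiv> map (map_letter (post_nt J)) z"

abbreviation nzig where "nzig A B E \<equiv> zig (FunCat A B) (objectwise A B E)"
abbreviation nzeq where "nzeq A B E \<equiv> zeq (FunCat A B) (objectwise A B E)"

lemma we_zigzag_zig: "we_zigzag A B E F G z \<longleftrightarrow> nzig A B E F z G"
  by (auto simp: we_zigzag_def zig_def)

lemma objectwiseD: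
  assumes "t \<in> objectwise A B E"
  shows "is_nattrans A B t" "\<And>a. a \<in> Obj A \<Longrightarrow> Cmp t a \<in> E"
  using assms by (auto simp: objectwise_def)

lemma nzig_functor:
  assumes "nzig A B E F z G"
  shows "is_functor A B F" "is_functor A B G" "category A" "category B"
proof -
  show 1: "is_functor A B G"
    using assms
  proof (induction z arbitrary: F)
    case (Cons l z)
    then show ?case by (cases l) (auto simp: zig_Fwd zig_Bwd)
  qed (auto simp: zig_Nil)
  show "is_functor A B F"
  proof (cases z)
    case Nil
    then show ?thesis using assms by (auto simp: zig_Nil)
  next
    case (Cons l z')
    then show ?thesis using assms
      by (cases l) (auto simp: zig_Fwd zig_Bwd nattransD(1,2))
  qed
  show "category A" "category B" using functor_cat[OF 1] by auto
qed

lemma nzig_nattrans: "nzig A B E F z G \<Longrightarrow> l \<in> set z \<Longrightarrow> is_nattrans A B (arrow l)"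
  by (auto simp: zig_def objectwise_def)

lemma wmap_cong: "(\<And>l. l \<in> set z \<Longrightarrow> \<phi> (arrow l) = \<psi> (arrow l)) \<Longrightarrow>
    map (map_letter \<phi>) z = map (map_letter \<psi>) z"
proof (rule map_cong[OF HOL.refl])
  fix l assume "\<And>l. l \<in> set z \<Longrightarrow> \<phi> (arrow l) = \<psi> (arrow l)" "l \<in> set z"
  then show "map_letter \<phi> l = map_letter \<psi> l" by (cases l) force+
qed

lemma wmap_comp: "map (map_letter \<phi>) (map (map_letter \<psi>) z) = map (map_letter (\<lambda>t. \<phi> (\<psi> t))) z"
  by (simp add: letter.map_comp comp_def)

lemma wl_wl: "nzig A B E F z G \<Longrightarrow> is_functor B B' L \<Longrightarrow> is_functor B' B'' K \<Longrightarrow> wl K (wl L z) = wl (K \<circ>\<^sub>F L) z"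
  unfolding wmap_comp by (rule wmap_cong) (rule whisker_left_comp[OF nzig_nattrans])

lemma wr_wr: "nzig A B E F z G \<Longrightarrow> is_functor A' A L \<Longrightarrow> is_functor A'' A' K \<Longrightarrow> wr (wr z L) K = wr z (L \<circ>\<^sub>F K)"
  unfolding wmap_comp by (rule wmap_cong) (rule whisker_right_comp[OF nzig_nattrans])

lemma wr_wl: "nzig A B E F z G \<Longrightarrow> is_functor A' A H \<Longrightarrow> is_functor B B' K \<Longrightarrow> wr (wl K z) H = wl K (wr z H)"
  unfolding wmap_comp by (rule wmap_cong) (rule whisker_left_right[OF nzig_nattrans])

lemma wmap_ident: "(\<And>l. l \<in> set z \<Longrightarrow> \<phi> (arrow l) = arrow l) \<Longrightarrow> map (map_letter \<phi>) z = z"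
  using wmap_cong[of z \<phi> id] by (simp add: letter.map_id0)

lemma wl_id: "nzig A B E F z G \<Longrightarrow> wl (id_func B) z = z"
  by (rule wmap_ident) (rule whisker_left_id[OF nzig_nattrans])

lemma wr_id: "nzig A B E F z G \<Longrightarrow> wr z (id_func A) = z"
  by (rule wmap_ident) (rule whisker_right_id[OF nzig_nattrans])

lemma pn_wl: "category J \<Longrightarrow> nzig A B E F z G \<Longrightarrow> is_functor B B' K \<Longrightarrow> pn J (wl K z) = wl (post J K) (pn J z)"
  unfolding wmap_comp by (rule wmap_cong) (rule post_nt_whisker_left[OF _ nzig_nattrans])

lemma pn_wr: "category J \<Longrightarrow> nzig A B E F z G \<Longrightarrow> is_functor A' A H \<Longrightarrow> pn J (wr z H) = wr (pn J z) (post J H)"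
  unfolding wmap_comp by (rule wmap_cong) (rule post_nt_whisker_right[OF _ nzig_nattrans])

lemma pn_const: "nzig A B E F z G \<Longrightarrow> wr (pn \<Delta>op z) (const_func A) = wl (const_func B) z"
  unfolding wmap_comp by (rule wmap_cong) (rule post_nt_const_func[OF nzig_nattrans])

lemma objectwise_whisker_left:
  assumes "t \<in> objectwise A B E" "is_functor B B' K" "AMap K ` E \<subseteq> E'"
  shows "whisker_left K t \<in> objectwise A B' E'"
  using assms nattrans_whisker_left[OF objectwiseD(1)[OF assms(1)] assms(2)] objectwiseD[OF assms(1)]
  by (auto simp: objectwise_def)

lemma objectwise_whisker_right:
  assumes "t \<in> objectwise A B E" "is_functor A' A H"
  shows "whisker_right t H \<in> objectwise A' B E"
  using assms nattrans_whisker_right[OF objectwiseD(1)[OF assms(1)] assms(2)] objectwiseD[OF assms(1)]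
    functor_ob[OF assms(2)] by (auto simp: objectwise_def)

lemma objectwise_post_nt:
  assumes "category J" "t \<in> objectwise A B E"
  shows "post_nt J t \<in> objectwise (FunCat J A) (FunCat J B) (objectwise J B E)"
  using nattrans_post_nt[OF assms(1) objectwiseD(1)[OF assms(2)]] objectwiseD[OF assms(2)]
    objectwise_whisker_right[OF assms(2)] by (auto simp: objectwise_def)

lemma weq_functor_wl:
  assumes K: "is_functor B B' K" "AMap K ` E \<subseteq> E'"
  shows "weq_functor (FunCat A B) (objectwise A B E) (FunCat A B') (objectwise A B' E') ((\<circ>\<^sub>F) K) (whisker_left K)"
  unfolding weq_functor_def
proof (intro conjI ballI allI)
  show "whisker_left K f \<in> hom (FunCat A B') (K \<circ>\<^sub>F P) (K \<circ>\<^sub>F Q)" if "f \<in> hom (FunCat A B) P Q" for f P Q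
    using that nattrans_whisker_left[OF _ K(1), of A f] by (auto simp: hom_FunCat)
qed (use whisker_left_ide[OF _ K(1)] whisker_left_comp_nt[OF _ _ K(1)] functor_comp_func[OF _ K(1)]
  objectwise_whisker_left[OF _ K] in auto)

lemma weq_functor_wr:
  assumes H: "is_functor A' A H"
  shows "weq_functor (FunCat A B) (objectwise A B E) (FunCat A' B) (objectwise A' B E)
    (\<lambda>F. F \<circ>\<^sub>F H) (\<lambda>t. whisker_right t H)"
  unfolding weq_functor_def
proof (intro conjI ballI allI)
  show "whisker_right f H \<in> hom (FunCat A' B) (P \<circ>\<^sub>F H) (Q \<circ>\<^sub>F H)" if "f \<in> hom (FunCat A B) P Q" for f P Q
    using that nattrans_whisker_right[OF _ H, of B f] by (auto simp: hom_FunCat)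
qed (use whisker_right_ide[OF _ H] whisker_right_comp_nt[OF _ _ H] functor_comp_func[OF H]
  objectwise_whisker_right[OF _ H] in auto)

lemma weq_functor_pn:
  assumes J: "category J"
  shows "weq_functor (FunCat A B) (objectwise A B E) (FunCat (FunCat J A) (FunCat J B))
    (objectwise (FunCat J A) (FunCat J B) (objectwise J B E)) (post J) (post_nt J)"
  unfolding weq_functor_def
proof (intro conjI ballI allI)
  show "post_nt J f \<in> hom (FunCat (FunCat J A) (FunCat J B)) (post J P) (post J Q)"
    if "f \<in> hom (FunCat A B) P Q" for f P Q
    using that nattrans_post_nt[OF J, of A B f] by (auto simp: hom_FunCat)
qed (use post_nt_ide[OF J] post_nt_comp[OF J] functor_post[OF J] objectwise_post_nt[OF J] in auto)

lemmas nzig_wl = weq_functor_zig[OF weq_functor_wl]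
lemmas nzig_wr = weq_functor_zig[OF weq_functor_wr]
lemmas nzig_pn = weq_functor_zig[OF weq_functor_pn]
lemmas nzeq_wl = weq_functor_zeq[OF weq_functor_wl]
lemmas nzeq_wr = weq_functor_zeq[OF weq_functor_wr]
lemmas nzeq_pn = weq_functor_zeq[OF weq_functor_pn]

lemma objectwise_reflect:
  assumes R: "relative_category B E" and t: "t \<in> objectwise A B E" and f: "f \<in> Arr A"
  shows "AMap (NDom t) f \<in> E \<longleftrightarrow> AMap (NCod t) f \<in> E"
proof -
  note tD = nattransD[OF objectwiseD(1)[OF t]] and tE = objectwiseD(2)[OF t]
  note f' = Arr_hom[OF f]
  have ab: "Dom A f \<in> Obj A" "Cod A f \<in> Obj A" using hom_Obj[OF tD(6) f'] by auto
  note h = tD(4)[OF ab(1)] tD(4)[OF ab(2)] functor_hom[OF tD(1) f'] functor_hom[OF tD(2) f']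
  have "AMap (NDom t) f \<in> E \<longleftrightarrow> Cmp t (Cod A f) \<cdot>\<^bsub>B\<^esub> AMap (NDom t) f \<in> E"
    using weq_comp[OF R h(3) _ h(2)] weq_cancel_left[OF R h(3) h(2)] tE[OF ab(2)] by blast
  also have "\<dots> \<longleftrightarrow> AMap (NCod t) f \<cdot>\<^bsub>B\<^esub> Cmp t (Dom A f) \<in> E" using tD(5)[OF f'] by simp
  also have "\<dots> \<longleftrightarrow> AMap (NCod t) f \<in> E"
    using weq_comp[OF R h(1) _ h(4)] weq_cancel_right[OF R h(1) h(4)] tE[OF ab(1)] by blast
  finally show ?thesis .
qed

text \<open>If a zigzag of natural weak equivalences connects \<open>K\<close> and \<open>L\<close>, then \<open>K\<close> and \<open>L\<close> send the same arrows
  to weak equivalences, by two-out-of-three in the naturality squares.\<close>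

lemma nzig_reflect:
  assumes R: "relative_category B E" and f: "f \<in> Arr A"
  shows "nzig A B E K z L \<Longrightarrow> AMap K f \<in> E \<longleftrightarrow> AMap L f \<in> E"
proof (induction z arbitrary: K)
  case Nil
  then show ?case by (auto simp: zig_Nil)
next
  case (Cons l z)
  then show ?case
    by (cases l) (use objectwise_reflect[OF R _ f] in \<open>auto simp: zig_Fwd zig_Bwd\<close>)
qed

lemma nzig_preserves:
  assumes R: "relative_category B E" and V: "V \<subseteq> Arr A" and z: "nzig A B E K z L"
  shows "AMap K ` V \<subseteq> E \<longleftrightarrow> AMap L ` V \<subseteq> E"
proof -
  have "AMap K f \<in> E \<longleftrightarrow> AMap L f \<in> E" if "f \<in> V" for f
    using nzig_reflect[OF R _ z] V that by blast
  then show ?thesis by (simp add: image_subset_iff)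
qed

text \<open>Naturality of a single natural weak equivalence \<open>t\<close> with respect to a zigzag \<open>y\<close>.\<close>

lemma interchange_single:
  assumes R: "relative_category B' E" and V: "V \<subseteq> Arr B"
    and t: "t \<in> objectwise B B' E" "NDom t = F" "NCod t = F'" and F: "AMap F ` V \<subseteq> E"
  shows "nzig A B V P y Q \<Longrightarrow>
    nzeq A B' E (F \<circ>\<^sub>F P) (F' \<circ>\<^sub>F Q) (wl F y @ [Fwd (whisker_right t Q)]) ([Fwd (whisker_right t P)] @ wl F' y)"
proof (induction y arbitrary: P)
  note tn = objectwiseD(1)[OF t(1)]
  have B': "category B'" and isF: "is_functor B B' F" and isF': "is_functor B B' F'"
    using nattransD[OF tn] t by auto
  have tz: "nzig A B' E (F \<circ>\<^sub>F X) [Fwd (whisker_right t X)] (F' \<circ>\<^sub>F X)" if X: "is_functor A B X" for X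
    using objectwise_whisker_right[OF t(1) X] nattrans_whisker_right[OF tn X] functor_comp_func[OF X isF'] t
    by (simp add: zig_Fwd zig_Nil)
  {
    case Nil
    then have "is_functor A B Q" "P = Q" by (auto simp: zig_Nil)
    then show ?case using zeq_refl[OF tz] by simp
  next
    case (Cons l y)
    have F': "AMap F' ` V \<subseteq> E" using F objectwise_reflect[OF R t(1)] t V by (force simp: image_subset_iff)
    note PQ = nzig_functor[OF Cons.prems]
    have X: "category (FunCat A B')" using category_FunCat PQ(3) B' by blast
    define N where "N = (case l of Fwd u \<Rightarrow> NCod u | Bwd u \<Rightarrow> NDom u)"
    have y: "nzig A B V N y Q" using Cons.prems by (cases l) (auto simp: N_def zig_Fwd zig_Bwd)
    note N = nzig_functor[OF y]
    have l: "nzig A B V P [l] N" using Cons.prems N by (cases l) (auto simp: N_def zig_Fwd zig_Bwd zig_Nil)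
    \<comment> \<open>For a forward letter this is the naturality square; a backward letter follows by rotating it.\<close>
    have sq: "nzeq A B' E (F \<circ>\<^sub>F P') (F' \<circ>\<^sub>F Q') (wl F [Fwd u] @ [Fwd (whisker_right t Q')])
        ([Fwd (whisker_right t P')] @ wl F' [Fwd u])" if u: "nzig A B V P' [Fwd u] Q'" for u P' Q'
    proof -
      have u': "is_nattrans A B u" "NDom u = P'" "NCod u = Q'" using u by (auto simp: zig_Fwd zig_Nil)
      note uD = nattransD[OF u'(1), unfolded u']
      note n = nattrans_whisker_left[OF u'(1) isF] nattrans_whisker_right[OF tn uD(2)]
        nattrans_whisker_right[OF tn uD(1)] nattrans_whisker_left[OF u'(1) isF']
      have h: "whisker_left F u \<in> hom (FunCat A B') (F \<circ>\<^sub>F P') (F \<circ>\<^sub>F Q')"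
        "whisker_right t Q' \<in> hom (FunCat A B') (F \<circ>\<^sub>F Q') (F' \<circ>\<^sub>F Q')"
        "whisker_right t P' \<in> hom (FunCat A B') (F \<circ>\<^sub>F P') (F' \<circ>\<^sub>F P')"
        "whisker_left F' u \<in> hom (FunCat A B') (F' \<circ>\<^sub>F P') (F' \<circ>\<^sub>F Q')"
        using n u' t by (auto simp: hom_FunCat)
      have e: "whisker_right t Q' \<cdot>\<^bsub>FunCat A B'\<^esub> whisker_left F u = whisker_left F' u \<cdot>\<^bsub>FunCat A B'\<^esub> whisker_right t P'"
      proof (rule nattrans_eqI[of A B'])
        show "Cmp (whisker_right t Q' \<cdot>\<^bsub>FunCat A B'\<^esub> whisker_left F u) a
            = Cmp (whisker_left F' u \<cdot>\<^bsub>FunCat A B'\<^esub> whisker_right t P') a" if "a \<in> Obj A" for a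
          using that nattransD(5)[OF tn uD(4)[OF that]] t u' uD(1,2) by simp
      qed (use category.comp_in_hom[OF X h(1,2)] category.comp_in_hom[OF X h(3,4)] in
          \<open>auto simp: hom_FunCat u' t\<close>)
      have "gz_eq (FunCat A B') (objectwise A B' E) (F \<circ>\<^sub>F P') (F' \<circ>\<^sub>F Q')
          [Fwd (whisker_left F u), Fwd (whisker_right t Q')] [Fwd (whisker_right t P'), Fwd (whisker_left F' u)]"
        by (rule gz_eq.trans[OF gz_eq.comp[OF h(1,2)] gz_eq.sym[OF gz_eq.comp[OF h(3,4), folded e]]])
      moreover have "nzig A B' E (F \<circ>\<^sub>F P') (wl F [Fwd u] @ [Fwd (whisker_right t Q')]) (F' \<circ>\<^sub>F Q')"
        by (rule zig_append[OF nzig_wl[OF isF F u] tz[OF uD(2)]])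
      moreover have "nzig A B' E (F \<circ>\<^sub>F P') ([Fwd (whisker_right t P')] @ wl F' [Fwd u]) (F' \<circ>\<^sub>F Q')"
        by (rule zig_append[OF tz[OF uD(1)] nzig_wl[OF isF' F' u]])
      ultimately show ?thesis by (simp add: zeq_def)
    qed
    have sq': "nzeq A B' E (F \<circ>\<^sub>F P) (F' \<circ>\<^sub>F N) (wl F [l] @ [Fwd (whisker_right t N)])
        ([Fwd (whisker_right t P)] @ wl F' [l])"
    proof (cases l)
      case (Fwd u)
      then show ?thesis using sq l by blast
    next
      case (Bwd u)
      then have u: "nzig A B V N [Fwd u] P" using zig_winv[OF category_FunCat[OF PQ(3,4)] l] by simp
      have "nzeq A B' E (F \<circ>\<^sub>F P) (F' \<circ>\<^sub>F N) (winv (wl F [Fwd u]) @ [Fwd (whisker_right t N)])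
          ([Fwd (whisker_right t P)] @ winv (wl F' [Fwd u]))"
        by (rule zeq_rotate[OF X sq[OF u] nzig_wl[OF isF F u] tz[OF PQ(1)] tz[OF N(1)] nzig_wl[OF isF' F' u]])
      then show ?thesis using Bwd by simp
    qed
    have "nzeq A B' E (F \<circ>\<^sub>F P) (F' \<circ>\<^sub>F Q) (wl F [l] @ (wl F y @ [Fwd (whisker_right t Q)]))
       (wl F [l] @ ([Fwd (whisker_right t N)] @ wl F' y))"
      by (rule zeq_append_left[OF nzig_wl[OF isF F l] Cons.IH[OF y]])
    also have "wl F [l] @ ([Fwd (whisker_right t N)] @ wl F' y)
        = (wl F [l] @ [Fwd (whisker_right t N)]) @ wl F' y" by simp
    also have "nzeq A B' E (F \<circ>\<^sub>F P) (F' \<circ>\<^sub>F Q) \<dots> (([Fwd (whisker_right t P)] @ wl F' [l]) @ wl F' y)"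
      by (rule zeq_append_right[OF sq' nzig_wl[OF isF' F' y]])
    finally show ?case by simp
  }
qed

text \<open>The interchange law for zigzags: both ways of composing \<open>y\<close> horizontally with \<open>z\<close> agree in the
  localization. The functors inside \<open>z\<close> preserve weak equivalences because the first one does.\<close>

lemma interchange:
  assumes R: "relative_category B' E" and V: "V \<subseteq> Arr B" and y: "nzig A B V P y Q"
  shows "nzig B B' E F z F' \<Longrightarrow> AMap F ` V \<subseteq> E \<Longrightarrow>
    nzeq A B' E (F \<circ>\<^sub>F P) (F' \<circ>\<^sub>F Q) (wl F y @ wr z Q) (wr z P @ wl F' y)"
proof (induction z arbitrary: F)
  case Nil
  then have F: "is_functor B B' F" "F = F'" by (auto simp: zig_Nil)
  show ?case using zeq_refl[OF nzig_wl[OF F(1) Nil(2) y]] F(2) by simp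
next
  case (Cons l z)
  note PQ = nzig_functor[OF y] and FF = nzig_functor[OF Cons.prems(1)]
  have X: "category (FunCat A B')" using category_FunCat PQ(3) FF(4) by blast
  define N where "N = (case l of Fwd u \<Rightarrow> NCod u | Bwd u \<Rightarrow> NDom u)"
  have z: "nzig B B' E N z F'" using Cons.prems by (cases l) (auto simp: N_def zig_Fwd zig_Bwd)
  note N = nzig_functor[OF z]
  have l: "nzig B B' E F [l] N" using Cons.prems N by (cases l) (auto simp: N_def zig_Fwd zig_Bwd zig_Nil)
  have NV: "AMap N ` V \<subseteq> E" and F'V: "AMap F' ` V \<subseteq> E"
    using nzig_preserves[OF R V l] nzig_preserves[OF R V Cons.prems(1)] Cons.prems(2) by auto
  have sq: "nzeq A B' E (F \<circ>\<^sub>F P) (N \<circ>\<^sub>F Q) (wl F y @ wr [l] Q) (wr [l] P @ wl N y)"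
  proof (cases l)
    case (Fwd t)
    then show ?thesis
      using interchange_single[OF R V _ _ _ Cons.prems(2) y, of t N] l by (auto simp: zig_Fwd zig_Nil)
  next
    case (Bwd t)
    then have t: "nzig B B' E N [Fwd t] F" using zig_winv[OF category_FunCat[OF FF(3,4)] l] by simp
    have e: "nzeq A B' E (N \<circ>\<^sub>F P) (F \<circ>\<^sub>F Q) (wr [Fwd t] P @ wl F y) (wl N y @ wr [Fwd t] Q)"
      using zeq_sym[OF interchange_single[OF R V _ _ _ NV y, of t F]] t by (auto simp: zig_Fwd zig_Nil)
    have "nzeq A B' E (F \<circ>\<^sub>F P) (N \<circ>\<^sub>F Q) (winv (wr [Fwd t] P) @ wl N y) (wl F y @ winv (wr [Fwd t] Q))"
      by (rule zeq_rotate[OF X e nzig_wr[OF PQ(1) t] nzig_wl[OF FF(1) Cons.prems(2) y]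
            nzig_wl[OF N(1) NV y] nzig_wr[OF PQ(2) t]])
    then show ?thesis using Bwd zeq_sym by fastforce
  qed
  have "nzeq A B' E (F \<circ>\<^sub>F P) (F' \<circ>\<^sub>F Q) ((wl F y @ wr [l] Q) @ wr z Q) ((wr [l] P @ wl N y) @ wr z Q)"
    by (rule zeq_append_right[OF sq nzig_wr[OF PQ(2) z]])
  also have "(wr [l] P @ wl N y) @ wr z Q = wr [l] P @ (wl N y @ wr z Q)" by simp
  also have "nzeq A B' E (F \<circ>\<^sub>F P) (F' \<circ>\<^sub>F Q) \<dots> (wr [l] P @ (wr z P @ wl F' y))"
    by (rule zeq_append_left[OF nzig_wr[OF PQ(1) l] Cons.IH[OF z NV]])
  finally show ?case by simp
qed

section \<open>Coproducts and weak equivalences\<close>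

lemma coproductD:
  assumes "is_coproduct D I X t \<iota>"
  shows "t \<in> Obj D" "i \<in> I \<Longrightarrow> \<iota> i \<in> hom D (X i) t"
  using assms by (auto simp: is_coproduct_def)

lemma coproduct_universal:
  assumes "is_coproduct D I X t \<iota>" "y \<in> Obj D" "\<forall>i \<in> I. \<phi> i \<in> hom D (X i) y"
  shows "\<exists>!h. h \<in> hom D t y \<and> (\<forall>i \<in> I. h \<cdot>\<^bsub>D\<^esub> \<iota> i = \<phi> i)"
proof -
  have "\<forall>y \<in> Obj D. \<forall>\<phi>. (\<forall>i \<in> I. \<phi> i \<in> hom D (X i) y) \<longrightarrow> (\<exists>!h. h \<in> hom D t y \<and> (\<forall>i \<in> I. h \<cdot>\<^bsub>D\<^esub> \<iota> i = \<phi> i))"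
    using assms(1) by (simp add: is_coproduct_def)
  from this[rule_format, OF assms(2), of \<phi>] show ?thesis using assms(3) by simp
qed

lemma coproduct_induced:
  assumes "is_coproduct D I X t \<iota>" "y \<in> Obj D" "\<And>i. i \<in> I \<Longrightarrow> \<phi> i \<in> hom D (X i) y"
  obtains h where "h \<in> hom D t y" "\<And>i. i \<in> I \<Longrightarrow> h \<cdot>\<^bsub>D\<^esub> \<iota> i = \<phi> i"
proof -
  have "\<exists>!h. h \<in> hom D t y \<and> (\<forall>i \<in> I. h \<cdot>\<^bsub>D\<^esub> \<iota> i = \<phi> i)"
    using coproduct_universal[OF assms(1,2)] assms(3) by blast
  then show ?thesis using that by blast
qed

lemma coproduct_ext:
  assumes D: "category D" and c: "is_coproduct D I X t \<iota>" and h: "h \<in> hom D t y" "h' \<in> hom D t y"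
    and e: "\<And>i. i \<in> I \<Longrightarrow> h \<cdot>\<^bsub>D\<^esub> \<iota> i = h' \<cdot>\<^bsub>D\<^esub> \<iota> i"
  shows "h = h'"
proof -
  have "\<forall>i \<in> I. h' \<cdot>\<^bsub>D\<^esub> \<iota> i \<in> hom D (X i) y"
    using category.comp_in_hom[OF D coproductD(2)[OF c] h(2)] by blast
  moreover have "y \<in> Obj D" using hom_Obj[OF D h(1)] by blast
  ultimately have "\<exists>!k. k \<in> hom D t y \<and> (\<forall>i \<in> I. k \<cdot>\<^bsub>D\<^esub> \<iota> i = h' \<cdot>\<^bsub>D\<^esub> \<iota> i)"
    by (intro coproduct_universal[OF c])
  then obtain k where k: "\<And>h. h \<in> hom D t y \<and> (\<forall>i \<in> I. h \<cdot>\<^bsub>D\<^esub> \<iota> i = h' \<cdot>\<^bsub>D\<^esub> \<iota> i) \<Longrightarrow> h = k" by (auto elim: ex1E)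
  show ?thesis using k[of h] k[of h'] h e by simp
qed

lemma coproductI:
  assumes "t \<in> Obj D" "\<And>i. i \<in> I \<Longrightarrow> \<iota> i \<in> hom D (X i) t"
    and "\<And>y \<phi>. y \<in> Obj D \<Longrightarrow> (\<And>i. i \<in> I \<Longrightarrow> \<phi> i \<in> hom D (X i) y) \<Longrightarrow>
      \<exists>h \<in> hom D t y. \<forall>i \<in> I. h \<cdot>\<^bsub>D\<^esub> \<iota> i = \<phi> i"
    and "\<And>y h h'. h \<in> hom D t y \<Longrightarrow> h' \<in> hom D t y \<Longrightarrow>
      (\<And>i. i \<in> I \<Longrightarrow> h \<cdot>\<^bsub>D\<^esub> \<iota> i = h' \<cdot>\<^bsub>D\<^esub> \<iota> i) \<Longrightarrow> h = h'"
  shows "is_coproduct D I X t \<iota>"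
  unfolding is_coproduct_def
proof (intro conjI allI ballI impI ex_ex1I)
  fix y \<phi> assume y: "y \<in> Obj D" and \<phi>: "\<forall>i\<in>I. \<phi> i \<in> hom D (X i) y"
  then show "\<exists>h. h \<in> hom D t y \<and> (\<forall>i\<in>I. h \<cdot>\<^bsub>D\<^esub> \<iota> i = \<phi> i)" using assms(3)[of y \<phi>] by blast
  fix h h' assume "h \<in> hom D t y \<and> (\<forall>i\<in>I. h \<cdot>\<^bsub>D\<^esub> \<iota> i = \<phi> i)" "h' \<in> hom D t y \<and> (\<forall>i\<in>I. h' \<cdot>\<^bsub>D\<^esub> \<iota> i = \<phi> i)"
  then show "h = h'" by (intro assms(4)[of h y h']) auto
qed (use assms(1,2) in auto)

lemma coproduct_cong:
  assumes "is_coproduct D I X t \<iota>" "\<And>i. i \<in> I \<Longrightarrow> X i = X' i" "\<And>i. i \<in> I \<Longrightarrow> \<iota> i = \<iota>' i"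
  shows "is_coproduct D I X' t \<iota>'"
proof -
  have "(\<forall>i \<in> I. P i (X i) (\<iota> i)) \<longleftrightarrow> (\<forall>i \<in> I. P i (X' i) (\<iota>' i))" for P using assms(2,3) by simp
  note e = this[of "\<lambda>i x j. j \<in> hom D x t"]
  have "(\<forall>i \<in> I. \<phi> i \<in> hom D (X i) y) \<longleftrightarrow> (\<forall>i \<in> I. \<phi> i \<in> hom D (X' i) y)" for \<phi> y using assms(2) by simp
  moreover have "(\<forall>i \<in> I. h \<cdot>\<^bsub>D\<^esub> \<iota> i = \<phi> i) \<longleftrightarrow> (\<forall>i \<in> I. h \<cdot>\<^bsub>D\<^esub> \<iota>' i = \<phi> i)" for \<phi> h using assms(3) by simp
  ultimately show ?thesis using assms(1) unfolding is_coproduct_def e by simp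
qed

lemma coproduct_exists:
  fixes I :: "'i set"
  assumes fc: "has_finite_coproducts D" and I: "finite I" and X: "\<And>i. i \<in> I \<Longrightarrow> X i \<in> Obj D"
  obtains t \<iota> where "is_coproduct D I X t \<iota>"
proof -
  obtain f :: "'i \<Rightarrow> nat" where f: "inj_on f I" using finite_imp_inj_to_nat_seg[OF I] by blast
  let ?g = "the_inv_into I f"
  have g: "i \<in> I \<Longrightarrow> ?g (f i) = i" for i using the_inv_into_f_f[OF f] .
  have "finite (f ` I)" "(\<lambda>n. X (?g n)) ` (f ` I) \<subseteq> Obj D" using I X g by auto
  then obtain t \<kappa> where c: "is_coproduct D (f ` I) (\<lambda>n. X (?g n)) t \<kappa>"
    using fc unfolding has_finite_coproducts_def by blast
  have "is_coproduct D I X t (\<lambda>i. \<kappa> (f i))"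
    unfolding is_coproduct_def
  proof (intro conjI ballI allI impI)
    show "t \<in> Obj D" "\<And>i. i \<in> I \<Longrightarrow> \<kappa> (f i) \<in> hom D (X i) t"
      using coproductD(1)[OF c] coproductD(2)[OF c, of "f _"] g by force+
    fix y \<phi> assume y: "y \<in> Obj D" and \<phi>: "\<forall>i\<in>I. \<phi> i \<in> hom D (X i) y"
    have "\<forall>n \<in> f ` I. \<phi> (?g n) \<in> hom D (X (?g n)) y" using \<phi> g by auto
    then have "\<exists>!h. h \<in> hom D t y \<and> (\<forall>n \<in> f ` I. h \<cdot>\<^bsub>D\<^esub> \<kappa> n = \<phi> (?g n))"
      by (rule coproduct_universal[OF c y])
    then show "\<exists>!h. h \<in> hom D t y \<and> (\<forall>i\<in>I. h \<cdot>\<^bsub>D\<^esub> \<kappa> (f i) = \<phi> i)" using g by simp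
  qed
  then show ?thesis using that by blast
qed

lemma coproduct_unique_weq:
  assumes R: "relative_category D E" and c: "is_coproduct D I X t \<iota>" and c': "is_coproduct D I X t' \<iota>'"
    and h: "h \<in> hom D t t'" "\<And>i. i \<in> I \<Longrightarrow> h \<cdot>\<^bsub>D\<^esub> \<iota> i = \<iota>' i"
  shows "h \<in> E"
proof -
  have D: "category D" using R by (auto simp: relative_category_def)
  obtain g where g: "g \<in> hom D t' t" "\<And>i. i \<in> I \<Longrightarrow> g \<cdot>\<^bsub>D\<^esub> \<iota>' i = \<iota> i"
    using coproduct_induced[OF c' coproductD(1)[OF c], of \<iota>] coproductD(2)[OF c] by blast
  note as = category.comp_assoc[OF D] and idl = category.comp_ide_left[OF D] and idh = category.ide_in_hom[OF D]
  have "g \<cdot>\<^bsub>D\<^esub> h = Ide D t"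
    by (rule coproduct_ext[OF D c category.comp_in_hom[OF D h(1) g(1)] idh[OF coproductD(1)[OF c]]])
      (simp add: as[OF coproductD(2)[OF c] h(1) g(1)] h(2) g(2) idl[OF coproductD(2)[OF c]])
  moreover have "h \<cdot>\<^bsub>D\<^esub> g = Ide D t'"
    by (rule coproduct_ext[OF D c' category.comp_in_hom[OF D g(1) h(1)] idh[OF coproductD(1)[OF c']]])
      (simp add: as[OF coproductD(2)[OF c'] g(1) h(1)] h(2) g(2) idl[OF coproductD(2)[OF c']])
  ultimately show ?thesis using weq_iso[OF R h(1) g(1)] by blast
qed

text \<open>Closure under binary coproducts extends to finite ones by induction: a coproduct over
  \<open>insert k I\<close> is a binary coproduct of the \<open>k\<close>-th object and a coproduct over \<open>I\<close>.\<close>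

lemma weq_finite_coproduct:
  assumes R: "relative_category D E" and cl: "closed_by_finite_coproducts D E" and I: "finite I"
  shows "is_coproduct D I X t \<iota> \<Longrightarrow> is_coproduct D I Y t' \<iota>' \<Longrightarrow> h \<in> hom D t t' \<Longrightarrow>
    (\<And>i. i \<in> I \<Longrightarrow> f i \<in> hom D (X i) (Y i) \<and> f i \<in> E \<and> h \<cdot>\<^bsub>D\<^esub> \<iota> i = \<iota>' i \<cdot>\<^bsub>D\<^esub> f i) \<Longrightarrow> h \<in> E"
  using I
proof (induction I arbitrary: t \<iota> t' \<iota>' h rule: finite_induct)
  case empty
  then show ?case
    by (intro coproduct_unique_weq[OF R, of "{}" X t \<iota> t' \<iota>' h]) (auto simp: is_coproduct_def)
next
  case (insert k I)
  have D: "category D" using R by (auto simp: relative_category_def)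
  have fc: "has_finite_coproducts D" using cl by (auto simp: closed_by_finite_coproducts_def)
  note as = category.comp_assoc[OF D] and cih = category.comp_in_hom[OF D]
  have split: "\<exists>u \<kappa> j. is_coproduct D I Z u \<kappa> \<and> j \<in> hom D u v \<and> (\<forall>i\<in>I. j \<cdot>\<^bsub>D\<^esub> \<kappa> i = \<nu> i) \<and>
      is_binary_coproduct D (Z k) u v (\<nu> k) j" if c: "is_coproduct D (insert k I) Z v \<nu>" for Z v \<nu>
  proof -
    note cD = coproductD[OF c]
    have ZO: "Z i \<in> Obj D" if "i \<in> I" for i using hom_Obj[OF D cD(2)] that by blast
    obtain u \<kappa> where u: "is_coproduct D I Z u \<kappa>" using coproduct_exists[OF fc insert.hyps(1)] ZO by blast
    obtain j where j: "j \<in> hom D u v" "\<And>i. i \<in> I \<Longrightarrow> j \<cdot>\<^bsub>D\<^esub> \<kappa> i = \<nu> i"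
      using coproduct_induced[OF u cD(1), of \<nu>] cD(2) by blast
    have "is_binary_coproduct D (Z k) u v (\<nu> k) j"
      unfolding is_binary_coproduct_def
    proof (rule coproductI)
      show "case_bool (\<nu> k) j b \<in> hom D (case_bool (Z k) u b) v" for b
        using cD(2)[of k] j by (cases b) auto
      fix y \<phi> assume y: "y \<in> Obj D" and \<phi>: "\<And>i. i \<in> UNIV \<Longrightarrow> \<phi> i \<in> hom D (case_bool (Z k) u i) y"
      have \<phi>': "\<phi> True \<in> hom D (Z k) y" "\<phi> False \<in> hom D u y" using \<phi>[of True] \<phi>[of False] by auto
      have "(if i = k then \<phi> True else \<phi> False \<cdot>\<^bsub>D\<^esub> \<kappa> i) \<in> hom D (Z i) y" if "i \<in> insert k I" for i
        using \<phi>' cih[OF coproductD(2)[OF u] \<phi>'(2)] that by auto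
      then obtain h where h: "h \<in> hom D v y"
        "\<And>i. i \<in> insert k I \<Longrightarrow> h \<cdot>\<^bsub>D\<^esub> \<nu> i = (if i = k then \<phi> True else \<phi> False \<cdot>\<^bsub>D\<^esub> \<kappa> i)"
        using coproduct_induced[OF c y, of "\<lambda>i. if i = k then \<phi> True else \<phi> False \<cdot>\<^bsub>D\<^esub> \<kappa> i"] by blast
      have "h \<cdot>\<^bsub>D\<^esub> j = \<phi> False"
      proof (rule coproduct_ext[OF D u cih[OF j(1) h(1)] \<phi>'(2)])
        fix i assume i: "i \<in> I"
        then show "(h \<cdot>\<^bsub>D\<^esub> j) \<cdot>\<^bsub>D\<^esub> \<kappa> i = \<phi> False \<cdot>\<^bsub>D\<^esub> \<kappa> i"
          using as[OF coproductD(2)[OF u i] j(1) h(1)] j(2)[OF i] h(2)[of i] insert.hyps(2) by auto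
      qed
      then have "h \<cdot>\<^bsub>D\<^esub> case_bool (\<nu> k) j b = \<phi> b" for b using h(2)[of k] by (cases b) auto
      then show "\<exists>h\<in>hom D v y. \<forall>b\<in>UNIV. h \<cdot>\<^bsub>D\<^esub> case_bool (\<nu> k) j b = \<phi> b" using h(1) by blast
    next
      fix y h h' assume hh: "h \<in> hom D v y" "h' \<in> hom D v y"
        and e: "\<And>b. b \<in> UNIV \<Longrightarrow> h \<cdot>\<^bsub>D\<^esub> case_bool (\<nu> k) j b = h' \<cdot>\<^bsub>D\<^esub> case_bool (\<nu> k) j b"
      show "h = h'"
      proof (rule coproduct_ext[OF D c hh])
        fix i assume i: "i \<in> insert k I"
        show "h \<cdot>\<^bsub>D\<^esub> \<nu> i = h' \<cdot>\<^bsub>D\<^esub> \<nu> i"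
        proof (cases "i = k")
          case True
          then show ?thesis using e[of True] by simp
        next
          case False
          then have "i \<in> I" using i by simp
          from as[OF coproductD(2)[OF u this] j(1) hh(1)] as[OF coproductD(2)[OF u this] j(1) hh(2)]
            e[of False] j(2)[OF this]
          show ?thesis by simp
        qed
      qed
    qed (rule cD(1))
    then show ?thesis using u j by blast
  qed
  obtain u \<kappa> j where u: "is_coproduct D I X u \<kappa>" "j \<in> hom D u t" "\<And>i. i \<in> I \<Longrightarrow> j \<cdot>\<^bsub>D\<^esub> \<kappa> i = \<iota> i"
    "is_binary_coproduct D (X k) u t (\<iota> k) j" using split[OF insert.prems(1)] by blast
  obtain u' \<kappa>' j' where u': "is_coproduct D I Y u' \<kappa>'" "j' \<in> hom D u' t'" "\<And>i. i \<in> I \<Longrightarrow> j' \<cdot>\<^bsub>D\<^esub> \<kappa>' i = \<iota>' i"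
    "is_binary_coproduct D (Y k) u' t' (\<iota>' k) j'" using split[OF insert.prems(2)] by blast
  have f: "f i \<in> hom D (X i) (Y i)" "f i \<in> E" "h \<cdot>\<^bsub>D\<^esub> \<iota> i = \<iota>' i \<cdot>\<^bsub>D\<^esub> f i" if "i \<in> insert k I" for i
    using insert.prems(4)[OF that] by auto
  have "\<kappa>' i \<cdot>\<^bsub>D\<^esub> f i \<in> hom D (X i) u'" if "i \<in> I" for i using cih[OF f(1) coproductD(2)[OF u'(1)]] that by blast
  then obtain g where g: "g \<in> hom D u u'" "\<And>i. i \<in> I \<Longrightarrow> g \<cdot>\<^bsub>D\<^esub> \<kappa> i = \<kappa>' i \<cdot>\<^bsub>D\<^esub> f i"
    using coproduct_induced[OF u(1) coproductD(1)[OF u'(1)], of "\<lambda>i. \<kappa>' i \<cdot>\<^bsub>D\<^esub> f i"] by blast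
  have gE: "g \<in> E" using insert.IH[OF u(1) u'(1) g(1)] g(2) f by blast
  have hj: "h \<cdot>\<^bsub>D\<^esub> j = j' \<cdot>\<^bsub>D\<^esub> g"
  proof (rule coproduct_ext[OF D u(1) cih[OF u(2) insert.prems(3)] cih[OF g(1) u'(2)]])
    fix i assume i: "i \<in> I"
    note k = coproductD(2)[OF u(1) i] and k' = coproductD(2)[OF u'(1) i]
    show "(h \<cdot>\<^bsub>D\<^esub> j) \<cdot>\<^bsub>D\<^esub> \<kappa> i = (j' \<cdot>\<^bsub>D\<^esub> g) \<cdot>\<^bsub>D\<^esub> \<kappa> i"
      using as[OF k u(2) insert.prems(3)] as[OF k g(1) u'(2)] as[OF f(1)[OF insertI2[OF i]] k' u'(2)]
        u(3)[OF i] u'(3)[OF i] g(2)[OF i] f(3)[of i] i by simp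
  qed
  show ?case
    using cl f[of k] homD[OF f(1)[of k]] homD[OF g(1)] gE hj insert.prems(3) u(4) u'(4)
    unfolding closed_by_finite_coproducts_def by (metis insertI1)
qed

section \<open>Equivalences preserve coproducts up to weak equivalence\<close>

text \<open>The canonical map from a coproduct of the \<open>F X\<^sub>i\<close> to the value of \<open>F\<close> at a coproduct of the
  \<open>X\<^sub>i\<close> is a weak equivalence, for coproducts indexed by \<open>I\<close>.\<close>

definition preserves_coproducts ::
  "('o1, 'm1) category \<Rightarrow> ('o2, 'm2) category \<Rightarrow> 'm2 set \<Rightarrow> 'i set \<Rightarrow> ('o1, 'm1, 'o2, 'm2) func \<Rightarrow> bool" where
  "preserves_coproducts C D E I F \<longleftrightarrow> (\<forall>X t \<iota> p \<kappa> k.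
     is_coproduct C I X t \<iota> \<and> is_coproduct D I (\<lambda>i. OMap F (X i)) p \<kappa> \<and>
     k \<in> hom D p (OMap F t) \<and> (\<forall>i \<in> I. k \<cdot>\<^bsub>D\<^esub> \<kappa> i = AMap F (\<iota> i)) \<longrightarrow> k \<in> E)"

lemma preserves_coproductsD:
  assumes "preserves_coproducts C D E I F" "is_coproduct C I X t \<iota>" "is_coproduct D I (\<lambda>i. OMap F (X i)) p \<kappa>"
    "k \<in> hom D p (OMap F t)" "\<And>i. i \<in> I \<Longrightarrow> k \<cdot>\<^bsub>D\<^esub> \<kappa> i = AMap F (\<iota> i)"
  shows "k \<in> E"
  using assms unfolding preserves_coproducts_def by blast

lemma comparison_exists:
  assumes F: "is_functor C D F" and fc: "has_finite_coproducts D" and I: "finite I"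
    and c: "is_coproduct C I X t \<iota>"
  obtains p \<kappa> k where "is_coproduct D I (\<lambda>i. OMap F (X i)) p \<kappa>" "k \<in> hom D p (OMap F t)"
    "\<And>i. i \<in> I \<Longrightarrow> k \<cdot>\<^bsub>D\<^esub> \<kappa> i = AMap F (\<iota> i)"
proof -
  have h: "AMap F (\<iota> i) \<in> hom D (OMap F (X i)) (OMap F t)" if "i \<in> I" for i
    using functor_hom[OF F coproductD(2)[OF c that]] .
  obtain p \<kappa> where p: "is_coproduct D I (\<lambda>i. OMap F (X i)) p \<kappa>"
    using coproduct_exists[OF fc I, of "\<lambda>i. OMap F (X i)"] hom_Obj[OF functor_cat(2)[OF F] h] by blast
  show ?thesis
    using coproduct_induced[OF p functor_ob[OF F coproductD(1)[OF c]] h] that[OF p] by metis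
qed

text \<open>The comparison maps of two functors connected by a natural weak equivalence \<open>u\<close> form a commutative
  square with \<open>u\<close> at the coproduct and the coproduct of the \<open>u\<close> at the summands.\<close>

lemma preserves_coproducts_step:
  assumes R: "relative_category D E" and cl: "closed_by_finite_coproducts D E" and I: "finite I"
    and u: "u \<in> objectwise C D E"
  shows "preserves_coproducts C D E I (NDom u) \<longleftrightarrow> preserves_coproducts C D E I (NCod u)"
proof -
  have D: "category D" using R by (auto simp: relative_category_def)
  have fc: "has_finite_coproducts D" using cl by (auto simp: closed_by_finite_coproducts_def)
  note un = objectwiseD(1)[OF u] and uE = objectwiseD(2)[OF u]
  note uD = nattransD[OF un]
  note cih = category.comp_in_hom[OF D] and as = category.comp_assoc[OF D]
  let ?F = "NDom u" and ?F' = "NCod u"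
  have key: "k \<in> E \<longleftrightarrow> k' \<in> E"
    if c: "is_coproduct C I X t \<iota>" and p: "is_coproduct D I (\<lambda>i. OMap ?F (X i)) p \<kappa>"
      and k: "k \<in> hom D p (OMap ?F t)" "\<And>i. i \<in> I \<Longrightarrow> k \<cdot>\<^bsub>D\<^esub> \<kappa> i = AMap ?F (\<iota> i)"
      and p': "is_coproduct D I (\<lambda>i. OMap ?F' (X i)) p' \<kappa>'"
      and k': "k' \<in> hom D p' (OMap ?F' t)" "\<And>i. i \<in> I \<Longrightarrow> k' \<cdot>\<^bsub>D\<^esub> \<kappa>' i = AMap ?F' (\<iota> i)"
    for X t \<iota> p \<kappa> k p' \<kappa>' k'
  proof -
    have X: "X i \<in> Obj C" if "i \<in> I" for i using hom_Obj[OF uD(6) coproductD(2)[OF c that]] by blast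
    note t = coproductD(1)[OF c]
    note uX = uD(4)[OF X] and ut = uD(4)[OF t]
    have ki: "\<kappa>' i \<cdot>\<^bsub>D\<^esub> Cmp u (X i) \<in> hom D (OMap ?F (X i)) p'" if "i \<in> I" for i
      using cih[OF uX coproductD(2)[OF p']] that by blast
    obtain g where g: "g \<in> hom D p p'" "\<And>i. i \<in> I \<Longrightarrow> g \<cdot>\<^bsub>D\<^esub> \<kappa> i = \<kappa>' i \<cdot>\<^bsub>D\<^esub> Cmp u (X i)"
      using coproduct_induced[OF p coproductD(1)[OF p'] ki] by blast
    have gE: "g \<in> E"
      by (rule weq_finite_coproduct[OF R cl I p p' g(1), of "\<lambda>i. Cmp u (X i)"]) (use g(2) uX uE X in blast)
    have e: "k' \<cdot>\<^bsub>D\<^esub> g = Cmp u t \<cdot>\<^bsub>D\<^esub> k"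
    proof (rule coproduct_ext[OF D p cih[OF g(1) k'(1)] cih[OF k(1) ut]])
      fix i assume i: "i \<in> I"
      show "(k' \<cdot>\<^bsub>D\<^esub> g) \<cdot>\<^bsub>D\<^esub> \<kappa> i = (Cmp u t \<cdot>\<^bsub>D\<^esub> k) \<cdot>\<^bsub>D\<^esub> \<kappa> i"
        using as[OF coproductD(2)[OF p i] g(1) k'(1)] as[OF coproductD(2)[OF p i] k(1) ut]
          as[OF uX[OF i] coproductD(2)[OF p' i] k'(1)] g(2)[OF i] k(2)[OF i] k'(2)[OF i]
          uD(5)[OF coproductD(2)[OF c i]] by simp
    qed
    have "k' \<in> E \<longleftrightarrow> k' \<cdot>\<^bsub>D\<^esub> g \<in> E"
      using weq_comp[OF R g(1) gE k'(1)] weq_cancel_right[OF R g(1) k'(1)] gE by blast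
    also have "\<dots> \<longleftrightarrow> k \<in> E"
      unfolding e using weq_comp[OF R k(1) _ ut] weq_cancel_left[OF R k(1) ut] uE[OF t] by blast
    finally show ?thesis by simp
  qed
  show ?thesis
  proof
    assume P: "preserves_coproducts C D E I ?F"
    show "preserves_coproducts C D E I ?F'"
      unfolding preserves_coproducts_def
    proof (intro allI impI, elim conjE)
      fix X t \<iota> p' \<kappa>' k'
      assume c: "is_coproduct C I X t \<iota>" and 1: "is_coproduct D I (\<lambda>i. OMap ?F' (X i)) p' \<kappa>'"
        "k' \<in> hom D p' (OMap ?F' t)" "\<forall>i\<in>I. k' \<cdot>\<^bsub>D\<^esub> \<kappa>' i = AMap ?F' (\<iota> i)"
      obtain p \<kappa> k where 2: "is_coproduct D I (\<lambda>i. OMap ?F (X i)) p \<kappa>" "k \<in> hom D p (OMap ?F t)"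
        "\<And>i. i \<in> I \<Longrightarrow> k \<cdot>\<^bsub>D\<^esub> \<kappa> i = AMap ?F (\<iota> i)" using comparison_exists[OF uD(1) fc I c] by blast
      show "k' \<in> E" using key[OF c 2 1(1,2)] 1(3) preserves_coproductsD[OF P c 2] by blast
    qed
  next
    assume P: "preserves_coproducts C D E I ?F'"
    show "preserves_coproducts C D E I ?F"
      unfolding preserves_coproducts_def
    proof (intro allI impI, elim conjE)
      fix X t \<iota> p \<kappa> k
      assume c: "is_coproduct C I X t \<iota>" and 1: "is_coproduct D I (\<lambda>i. OMap ?F (X i)) p \<kappa>"
        "k \<in> hom D p (OMap ?F t)" "\<forall>i\<in>I. k \<cdot>\<^bsub>D\<^esub> \<kappa> i = AMap ?F (\<iota> i)"
      obtain p' \<kappa>' k' where 2: "is_coproduct D I (\<lambda>i. OMap ?F' (X i)) p' \<kappa>'" "k' \<in> hom D p' (OMap ?F' t)"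
        "\<And>i. i \<in> I \<Longrightarrow> k' \<cdot>\<^bsub>D\<^esub> \<kappa>' i = AMap ?F' (\<iota> i)" using comparison_exists[OF uD(2) fc I c] by blast
      show "k \<in> E" using key[OF c 1(1,2) _ 2] 1(3) preserves_coproductsD[OF P c 2] by blast
    qed
  qed
qed

lemma preserves_coproducts_zigzag:
  assumes R: "relative_category D E" and cl: "closed_by_finite_coproducts D E" and I: "finite I"
  shows "nzig D D E K z (id_func D) \<Longrightarrow> preserves_coproducts D D E I K"
proof (induction z arbitrary: K)
  case Nil
  then have K: "K = id_func D" by (simp add: zig_Nil)
  have D: "category D" using R by (auto simp: relative_category_def)
  show ?case
    unfolding preserves_coproducts_def K
  proof (intro allI impI, elim conjE)
    fix X t \<iota> p \<kappa> k
    assume c: "is_coproduct D I X t \<iota>" and p: "is_coproduct D I (\<lambda>i. OMap (id_func D) (X i)) p \<kappa>"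
      and k: "k \<in> hom D p (OMap (id_func D) t)" "\<forall>i\<in>I. k \<cdot>\<^bsub>D\<^esub> \<kappa> i = AMap (id_func D) (\<iota> i)"
    have "X i \<in> Obj D \<and> \<iota> i \<in> Arr D" if "i \<in> I" for i
      using hom_Obj[OF D coproductD(2)[OF c that]] homD[OF coproductD(2)[OF c that]] by blast
    then show "k \<in> E"
      using coproduct_unique_weq[OF R coproduct_cong[OF p, of X \<kappa>] c, of k] k coproductD(1)[OF c] by simp
  qed
next
  case (Cons l z)
  then show ?case
    by (cases l) (auto simp: zig_Fwd zig_Bwd dest: preserves_coproducts_step[OF R cl I])
qed

text \<open>Write \<open>k\<close> and \<open>l\<close> for comparison maps of \<open>F\<close> and \<open>G\<close>. Comparison maps of \<open>GF\<close> and \<open>FG\<close> are weak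
  equivalences, so \<open>G(k) l\<close> and \<open>F(l) k'\<close> are. Two-out-of-six for \<open>k'\<close>, \<open>F(l)\<close>, \<open>FG(k)\<close>
  shows that \<open>F(l)\<close>, hence \<open>FG(k)\<close>, hence \<open>k\<close>, is a weak equivalence.\<close>

lemma equivalence_preserves_coproducts:
  assumes RC: "relative_category C W" and RD: "relative_category D E"
    and clC: "closed_by_finite_coproducts C W" and clD: "closed_by_finite_coproducts D E"
    and F: "is_functor C D F" and G: "is_functor D C G" and FW: "AMap F ` W \<subseteq> E"
    and a: "nzig C C W (G \<circ>\<^sub>F F) \<alpha> (id_func C)" and b: "nzig D D E (F \<circ>\<^sub>F G) \<beta> (id_func D)"
    and I: "finite I"
  shows "preserves_coproducts C D E I F"
  unfolding preserves_coproducts_def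
proof (intro allI impI, elim conjE)
  fix X t \<iota> p \<kappa> k
  assume c: "is_coproduct C I X t \<iota>" and p: "is_coproduct D I (\<lambda>i. OMap F (X i)) p \<kappa>"
    and k: "k \<in> hom D p (OMap F t)" "\<forall>i\<in>I. k \<cdot>\<^bsub>D\<^esub> \<kappa> i = AMap F (\<iota> i)"
  have C: "category C" and D: "category D" using functor_cat[OF F] by auto
  have fcC: "has_finite_coproducts C" and fcD: "has_finite_coproducts D"
    using clC clD by (auto simp: closed_by_finite_coproducts_def)
  have XO: "X i \<in> Obj C" "\<iota> i \<in> Arr C" if "i \<in> I" for i
    using hom_Obj[OF C coproductD(2)[OF c that]] homD[OF coproductD(2)[OF c that]] by auto
  note tO = coproductD(1)[OF c]
  obtain q \<nu> l where q: "is_coproduct C I (\<lambda>i. OMap G (OMap F (X i))) q \<nu>" "l \<in> hom C q (OMap G p)"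
    "\<And>i. i \<in> I \<Longrightarrow> l \<cdot>\<^bsub>C\<^esub> \<nu> i = AMap G (\<kappa> i)" using comparison_exists[OF G fcC I p] by blast
  obtain r \<rho> k' where r: "is_coproduct D I (\<lambda>i. OMap F (OMap G (OMap F (X i)))) r \<rho>" "k' \<in> hom D r (OMap F q)"
    "\<And>i. i \<in> I \<Longrightarrow> k' \<cdot>\<^bsub>D\<^esub> \<rho> i = AMap F (\<nu> i)" using comparison_exists[OF F fcD I q(1)] by blast
  have Gk: "AMap G k \<in> hom C (OMap G p) (OMap G (OMap F t))" using functor_hom[OF G k(1)] .
  have Fl: "AMap F l \<in> hom D (OMap F q) (OMap F (OMap G p))" using functor_hom[OF F q(2)] .
  have FGk: "AMap F (AMap G k) \<in> hom D (OMap F (OMap G p)) (OMap F (OMap G (OMap F t)))"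
    using functor_hom[OF F Gk] .
  have 1: "AMap G k \<cdot>\<^bsub>C\<^esub> l \<in> W"
  proof (rule preserves_coproductsD[OF preserves_coproducts_zigzag[OF RC clC I a] c])
    show "is_coproduct C I (\<lambda>i. OMap (G \<circ>\<^sub>F F) (X i)) q \<nu>"
      by (rule coproduct_cong[OF q(1)]) (use XO F in auto)
    show "AMap G k \<cdot>\<^bsub>C\<^esub> l \<in> hom C q (OMap (G \<circ>\<^sub>F F) t)"
      using category.comp_in_hom[OF C q(2) Gk] tO F by simp
    show "(AMap G k \<cdot>\<^bsub>C\<^esub> l) \<cdot>\<^bsub>C\<^esub> \<nu> i = AMap (G \<circ>\<^sub>F F) (\<iota> i)" if i: "i \<in> I" for i
      using category.comp_assoc[OF C coproductD(2)[OF q(1) i] q(2) Gk] q(3)[OF i]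
        functor_comp[OF G coproductD(2)[OF p i] k(1)] k(2) i XO F by simp
  qed
  have 2: "AMap F l \<cdot>\<^bsub>D\<^esub> k' \<in> E"
  proof (rule preserves_coproductsD[OF preserves_coproducts_zigzag[OF RD clD I b] p])
    have O: "OMap F (X i) \<in> Obj D" "\<kappa> i \<in> Arr D" if "i \<in> I" for i
      using functor_ob[OF F XO(1)] homD[OF coproductD(2)[OF p]] that by auto
    show "is_coproduct D I (\<lambda>i. OMap (F \<circ>\<^sub>F G) (OMap F (X i))) r \<rho>"
      by (rule coproduct_cong[OF r(1)]) (use O G in auto)
    show "AMap F l \<cdot>\<^bsub>D\<^esub> k' \<in> hom D r (OMap (F \<circ>\<^sub>F G) p)"
      using category.comp_in_hom[OF D r(2) Fl] coproductD(1)[OF p] G by simp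
    show "(AMap F l \<cdot>\<^bsub>D\<^esub> k') \<cdot>\<^bsub>D\<^esub> \<rho> i = AMap (F \<circ>\<^sub>F G) (\<kappa> i)" if i: "i \<in> I" for i
      using category.comp_assoc[OF D coproductD(2)[OF r(1) i] r(2) Fl] r(3)[OF i]
        functor_comp[OF F coproductD(2)[OF q(1) i] q(2)] q(3)[OF i] O[OF i] G by simp
  qed
  have 3: "AMap F (AMap G k) \<cdot>\<^bsub>D\<^esub> AMap F l \<in> E"
    using functor_comp[OF F q(2) Gk] 1 FW by (metis image_subset_iff)
  have Fl_E: "AMap F l \<in> E" by (rule two_out_of_six_middle[OF RD r(2) Fl FGk 2 3])
  have "AMap F (AMap G k) \<in> E" by (rule weq_cancel_right[OF RD Fl FGk 3 Fl_E])
  then show "k \<in> E"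
    using nzig_reflect[OF RD _ b, of k] homD[OF k(1)] G by simp
qed

section \<open>Levelwise coproducts of diagrams\<close>

text \<open>\<open>levelwise_coproduct J D I X r x T \<iota>\<close>: the functor \<open>T : J \<rightarrow> D\<close> has as its value at \<open>a\<close> a coproduct of the
  objects \<open>X a i\<close> with \<open>i \<in> I a\<close>, and an arrow \<open>f : a \<rightarrow> b\<close> maps the summand \<open>i\<close> to the summand
  \<open>r f i\<close> by \<open>x f i : X a i \<rightarrow> X b (r f i)\<close>.\<close>

definition levelwise_coproduct ::
  "('oj, 'mj) category \<Rightarrow> ('o, 'm) category \<Rightarrow> ('oj \<Rightarrow> 'i set) \<Rightarrow> ('oj \<Rightarrow> 'i \<Rightarrow> 'o) \<Rightarrow> ('mj \<Rightarrow> 'i \<Rightarrow> 'i) \<Rightarrow>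
    ('mj \<Rightarrow> 'i \<Rightarrow> 'm) \<Rightarrow> ('oj, 'mj, 'o, 'm) func \<Rightarrow> ('oj \<Rightarrow> 'i \<Rightarrow> 'm) \<Rightarrow> bool" where
  "levelwise_coproduct J D I X r x T \<iota> \<longleftrightarrow> is_functor J D T \<and>
     (\<forall>a \<in> Obj J. is_coproduct D (I a) (X a) (OMap T a) (\<iota> a)) \<and>
     (\<forall>a b. \<forall>f \<in> hom J a b. \<forall>i \<in> I a. r f i \<in> I b \<and> x f i \<in> hom D (X a i) (X b (r f i)) \<and>
        AMap T f \<cdot>\<^bsub>D\<^esub> \<iota> a i = \<iota> b (r f i) \<cdot>\<^bsub>D\<^esub> x f i)"

lemma levelwise_coproduct_exists:
  fixes I :: "'oj \<Rightarrow> 'i set" and J :: "('oj, 'mj) category"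
  assumes J: "category J" and D: "category D" and fc: "has_finite_coproducts D"
    and I: "\<And>a. a \<in> Obj J \<Longrightarrow> finite (I a)" and X: "\<And>a i. a \<in> Obj J \<Longrightarrow> i \<in> I a \<Longrightarrow> X a i \<in> Obj D"
    and r: "\<And>f a b i. f \<in> hom J a b \<Longrightarrow> i \<in> I a \<Longrightarrow> r f i \<in> I b"
    and x: "\<And>f a b i. f \<in> hom J a b \<Longrightarrow> i \<in> I a \<Longrightarrow> x f i \<in> hom D (X a i) (X b (r f i))"
    and ide: "\<And>a i. a \<in> Obj J \<Longrightarrow> i \<in> I a \<Longrightarrow> r (Ide J a) i = i \<and> x (Ide J a) i = Ide D (X a i)"
    and comp: "\<And>f g a b c i. f \<in> hom J a b \<Longrightarrow> g \<in> hom J b c \<Longrightarrow> i \<in> I a \<Longrightarrow>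
      r (g \<cdot>\<^bsub>J\<^esub> f) i = r g (r f i) \<and> x (g \<cdot>\<^bsub>J\<^esub> f) i = x g (r f i) \<cdot>\<^bsub>D\<^esub> x f i"
  obtains T \<iota> where "levelwise_coproduct J D I X r x T \<iota>"
proof -
  note cih = category.comp_in_hom[OF D] and as = category.comp_assoc[OF D]
  have "\<forall>a \<in> Obj J. \<exists>p. is_coproduct D (I a) (X a) (fst p) (snd p)"
  proof
    fix a assume a: "a \<in> Obj J"
    obtain t \<iota> where "is_coproduct D (I a) (X a) t \<iota>" using coproduct_exists[OF fc I[OF a], of "X a"] X[OF a] by blast
    then show "\<exists>p. is_coproduct D (I a) (X a) (fst p) (snd p)" by (intro exI[of _ "(t, \<iota>)"]) simp
  qed
  from bchoice[OF this] obtain p where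
    p: "\<And>a. a \<in> Obj J \<Longrightarrow> is_coproduct D (I a) (X a) (fst (p a)) (snd (p a))" by blast
  define t where "t a = fst (p a)" for a
  define \<iota> where "\<iota> a = snd (p a)" for a
  have t: "is_coproduct D (I a) (X a) (t a) (\<iota> a)" if "a \<in> Obj J" for a using p[OF that] by (simp add: t_def \<iota>_def)
  let ?P = "\<lambda>f h. h \<in> hom D (t (Dom J f)) (t (Cod J f)) \<and>
      (\<forall>i \<in> I (Dom J f). h \<cdot>\<^bsub>D\<^esub> \<iota> (Dom J f) i = \<iota> (Cod J f) (r f i) \<cdot>\<^bsub>D\<^esub> x f i)"
  have "\<forall>f \<in> Arr J. \<exists>h. ?P f h"
  proof
    fix f assume f: "f \<in> Arr J"
    note f' = Arr_hom[OF f]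
    have ab: "Dom J f \<in> Obj J" "Cod J f \<in> Obj J" using hom_Obj[OF J f'] by auto
    have "\<iota> (Cod J f) (r f i) \<cdot>\<^bsub>D\<^esub> x f i \<in> hom D (X (Dom J f) i) (t (Cod J f))" if "i \<in> I (Dom J f)" for i
      using cih[OF x[OF f' that] coproductD(2)[OF t[OF ab(2)] r[OF f' that]]] .
    then show "\<exists>h. ?P f h"
      using coproduct_induced[OF t[OF ab(1)] coproductD(1)[OF t[OF ab(2)]], of "\<lambda>i. \<iota> (Cod J f) (r f i) \<cdot>\<^bsub>D\<^esub> x f i"]
      by metis
  qed
  from bchoice[OF this] obtain m where m: "\<And>f. f \<in> Arr J \<Longrightarrow> ?P f (m f)" by blast
  have mh: "m f \<in> hom D (t a) (t b)" "i \<in> I a \<Longrightarrow> m f \<cdot>\<^bsub>D\<^esub> \<iota> a i = \<iota> b (r f i) \<cdot>\<^bsub>D\<^esub> x f i" if "f \<in> hom J a b" for f a b i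
    using m[of f] that by (auto simp: hom_def)
  define T where "T = \<lparr>Src = J, Tgt = D, OMap = (\<lambda>a\<in>Obj J. t a), AMap = (\<lambda>f\<in>Arr J. m f)\<rparr>"
  have To: "OMap T a = t a" if "a \<in> Obj J" for a using that by (simp add: T_def)
  have Ta: "AMap T f = m f" if "f \<in> hom J a b" for f a b using that by (simp add: T_def hom_def)
  have "is_functor J D T"
  proof (rule functorI)
    show "OMap T a \<in> Obj D" if "a \<in> Obj J" for a using coproductD(1)[OF t[OF that]] To[OF that] by simp
    show "AMap T f \<in> hom D (OMap T a) (OMap T b)" if "f \<in> hom J a b" for f a b
      using mh(1)[OF that] hom_Obj[OF J that] To Ta[OF that] by simp
    show "AMap T (Ide J a) = Ide D (OMap T a)" if a: "a \<in> Obj J" for a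
    proof -
      note i = category.ide_in_hom[OF J a]
      have "m (Ide J a) = Ide D (t a)"
      proof (rule coproduct_ext[OF D t[OF a] mh(1)[OF i] category.ide_in_hom[OF D coproductD(1)[OF t[OF a]]]])
        fix k assume k: "k \<in> I a"
        note \<iota> = coproductD(2)[OF t[OF a] k]
        show "m (Ide J a) \<cdot>\<^bsub>D\<^esub> \<iota> a k = Ide D (t a) \<cdot>\<^bsub>D\<^esub> \<iota> a k"
          using mh(2)[OF i k] ide[OF a k] category.comp_ide_left[OF D \<iota>] category.comp_ide_right[OF D \<iota>] by simp
      qed
      then show ?thesis using Ta[OF i] To[OF a] by simp
    qed
    show "AMap T (g \<cdot>\<^bsub>J\<^esub> f) = AMap T g \<cdot>\<^bsub>D\<^esub> AMap T f" if f: "f \<in> hom J a b" and g: "g \<in> hom J b c" for a b c f g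
    proof -
      note gf = category.comp_in_hom[OF J f g]
      have abc: "a \<in> Obj J" "b \<in> Obj J" "c \<in> Obj J" using hom_Obj[OF J f] hom_Obj[OF J g] by auto
      have "m (g \<cdot>\<^bsub>J\<^esub> f) = m g \<cdot>\<^bsub>D\<^esub> m f"
      proof (rule coproduct_ext[OF D t[OF abc(1)] mh(1)[OF gf] cih[OF mh(1)[OF f] mh(1)[OF g]]])
        fix k assume k: "k \<in> I a"
        note \<iota>a = coproductD(2)[OF t[OF abc(1)] k]
        note rk = r[OF f k]
        note \<iota>b = coproductD(2)[OF t[OF abc(2)] rk] and \<iota>c = coproductD(2)[OF t[OF abc(3)] r[OF g rk]]
        have "(m g \<cdot>\<^bsub>D\<^esub> m f) \<cdot>\<^bsub>D\<^esub> \<iota> a k = m g \<cdot>\<^bsub>D\<^esub> (\<iota> b (r f k) \<cdot>\<^bsub>D\<^esub> x f k)"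
          using as[OF \<iota>a mh(1)[OF f] mh(1)[OF g]] mh(2)[OF f k] by simp
        also have "\<dots> = (\<iota> c (r g (r f k)) \<cdot>\<^bsub>D\<^esub> x g (r f k)) \<cdot>\<^bsub>D\<^esub> x f k"
          using as[OF x[OF f k] \<iota>b mh(1)[OF g]] mh(2)[OF g rk] by simp
        also have "\<dots> = m (g \<cdot>\<^bsub>J\<^esub> f) \<cdot>\<^bsub>D\<^esub> \<iota> a k"
          using as[OF x[OF f k] x[OF g rk] \<iota>c] mh(2)[OF gf k] comp[OF f g k] by simp
        finally show "m (g \<cdot>\<^bsub>J\<^esub> f) \<cdot>\<^bsub>D\<^esub> \<iota> a k = (m g \<cdot>\<^bsub>D\<^esub> m f) \<cdot>\<^bsub>D\<^esub> \<iota> a k" by simp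
      qed
      then show ?thesis using Ta[OF f] Ta[OF g] Ta[OF gf] by simp
    qed
  qed (use J D in \<open>auto simp: T_def\<close>)
  then have "levelwise_coproduct J D I X r x T \<iota>"
    unfolding levelwise_coproduct_def using t To Ta mh(2) r x by simp
  then show ?thesis using that by blast
qed

lemma levelwise_coproduct_induced:
  assumes T: "levelwise_coproduct J D I X r x T \<iota>" and Y: "is_functor J D Y"
    and \<phi>: "\<And>a i. a \<in> Obj J \<Longrightarrow> i \<in> I a \<Longrightarrow> \<phi> a i \<in> hom D (X a i) (OMap Y a)"
    and nat: "\<And>f a b i. f \<in> hom J a b \<Longrightarrow> i \<in> I a \<Longrightarrow> AMap Y f \<cdot>\<^bsub>D\<^esub> \<phi> a i = \<phi> b (r f i) \<cdot>\<^bsub>D\<^esub> x f i"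
  obtains h where "h \<in> hom (FunCat J D) T Y" "\<And>a i. a \<in> Obj J \<Longrightarrow> i \<in> I a \<Longrightarrow> Cmp h a \<cdot>\<^bsub>D\<^esub> \<iota> a i = \<phi> a i"
proof -
  have J: "category J" and D: "category D" using functor_cat[OF Y] by auto
  note cih = category.comp_in_hom[OF D] and as = category.comp_assoc[OF D]
  have fT: "is_functor J D T" and c: "\<And>a. a \<in> Obj J \<Longrightarrow> is_coproduct D (I a) (X a) (OMap T a) (\<iota> a)"
    and T': "\<And>a b f i. f \<in> hom J a b \<Longrightarrow> i \<in> I a \<Longrightarrow> r f i \<in> I b \<and> x f i \<in> hom D (X a i) (X b (r f i)) \<and>
        AMap T f \<cdot>\<^bsub>D\<^esub> \<iota> a i = \<iota> b (r f i) \<cdot>\<^bsub>D\<^esub> x f i"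
    using T unfolding levelwise_coproduct_def by blast+
  let ?P = "\<lambda>a h. h \<in> hom D (OMap T a) (OMap Y a) \<and> (\<forall>i \<in> I a. h \<cdot>\<^bsub>D\<^esub> \<iota> a i = \<phi> a i)"
  have "\<forall>a \<in> Obj J. \<exists>h. ?P a h"
    using coproduct_induced[OF c functor_ob[OF Y] \<phi>] by metis
  from bchoice[OF this] obtain m where m: "\<And>a. a \<in> Obj J \<Longrightarrow> ?P a (m a)" by blast
  define h where "h = \<lparr>NDom = T, NCod = Y, Cmp = (\<lambda>a\<in>Obj J. m a)\<rparr>"
  have "is_nattrans J D h"
  proof (rule nattransI)
    show "Cmp h a \<in> hom D (OMap (NDom h) a) (OMap (NCod h) a)" if "a \<in> Obj J" for a
      using m[OF that] that by (simp add: h_def)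
    show "Cmp h b \<cdot>\<^bsub>D\<^esub> AMap (NDom h) f = AMap (NCod h) f \<cdot>\<^bsub>D\<^esub> Cmp h a" if f: "f \<in> hom J a b" for a b f
    proof -
      have ab: "a \<in> Obj J" "b \<in> Obj J" using hom_Obj[OF J f] by auto
      have ma: "m a \<in> hom D (OMap T a) (OMap Y a)" and mb: "m b \<in> hom D (OMap T b) (OMap Y b)"
        using m ab by auto
      note Tf = functor_hom[OF fT f] and Yf = functor_hom[OF Y f]
      have "m b \<cdot>\<^bsub>D\<^esub> AMap T f = AMap Y f \<cdot>\<^bsub>D\<^esub> m a"
      proof (rule coproduct_ext[OF D c[OF ab(1)] cih[OF Tf mb] cih[OF ma Yf]])
        fix i assume i: "i \<in> I a"
        note \<iota>a = coproductD(2)[OF c[OF ab(1)] i]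
        have ri: "r f i \<in> I b" and xi: "x f i \<in> hom D (X a i) (X b (r f i))" using T'[OF f i] by auto
        show "(m b \<cdot>\<^bsub>D\<^esub> AMap T f) \<cdot>\<^bsub>D\<^esub> \<iota> a i = (AMap Y f \<cdot>\<^bsub>D\<^esub> m a) \<cdot>\<^bsub>D\<^esub> \<iota> a i"
          using as[OF \<iota>a Tf mb] as[OF \<iota>a ma Yf] as[OF xi coproductD(2)[OF c[OF ab(2)] ri] mb] T'[OF f i]
            m[OF ab(1)] m[OF ab(2)] i ri nat[OF f i] by simp
      qed
      then show ?thesis using ab by (simp add: h_def)
    qed
  qed (use fT Y in \<open>auto simp: h_def\<close>)
  then have "h \<in> hom (FunCat J D) T Y" by (auto simp: hom_FunCat h_def)
  moreover have "Cmp h a \<cdot>\<^bsub>D\<^esub> \<iota> a i = \<phi> a i" if "a \<in> Obj J" "i \<in> I a" for a i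
    using m[OF that(1)] that by (simp add: h_def)
  ultimately show ?thesis using that by blast
qed

lemma binary_coproduct_FunCat_exists:
  assumes J: "category J" and fc: "has_finite_coproducts D"
    and X: "is_functor J D X" and Y: "is_functor J D Y"
  obtains T i j where "is_binary_coproduct (FunCat J D) X Y T i j"
    "\<And>a. a \<in> Obj J \<Longrightarrow> is_binary_coproduct D (OMap X a) (OMap Y a) (OMap T a) (Cmp i a) (Cmp j a)"
proof -
  have D: "category D" using functor_cat[OF X] by auto
  define Z where "Z = (\<lambda>b. case_bool X Y b)"
  have Z: "is_functor J D (Z b)" for b using X Y by (auto simp: Z_def split: bool.splits)
  obtain T \<iota> where T: "levelwise_coproduct J D (\<lambda>a. UNIV :: bool set) (\<lambda>a b. OMap (Z b) a) (\<lambda>f b. b)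
      (\<lambda>f b. AMap (Z b) f) T \<iota>"
    by (rule levelwise_coproduct_exists[OF J D fc, of "\<lambda>a. UNIV :: bool set" "\<lambda>a b. OMap (Z b) a" "\<lambda>f b. b"
          "\<lambda>f b. AMap (Z b) f"])
      (auto simp: functor_ob[OF Z] functor_hom[OF Z] functor_ide[OF Z] functor_comp[OF Z])
  have fT: "is_functor J D T" and c: "\<And>a. a \<in> Obj J \<Longrightarrow> is_coproduct D UNIV (\<lambda>b. OMap (Z b) a) (OMap T a) (\<iota> a)"
    and T': "\<And>a b f i. f \<in> hom J a b \<Longrightarrow> AMap T f \<cdot>\<^bsub>D\<^esub> \<iota> a i = \<iota> b i \<cdot>\<^bsub>D\<^esub> AMap (Z i) f"
    using T unfolding levelwise_coproduct_def by blast+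
  define k where "k b = \<lparr>NDom = Z b, NCod = T, Cmp = (\<lambda>a\<in>Obj J. \<iota> a b)\<rparr>" for b
  have kn: "is_nattrans J D (k b)" for b
  proof (rule nattransI)
    show "Cmp (k b) a \<in> hom D (OMap (NDom (k b)) a) (OMap (NCod (k b)) a)" if "a \<in> Obj J" for a
      using coproductD(2)[OF c[OF that], of b] that by (simp add: k_def)
    show "Cmp (k b) a' \<cdot>\<^bsub>D\<^esub> AMap (NDom (k b)) f = AMap (NCod (k b)) f \<cdot>\<^bsub>D\<^esub> Cmp (k b) a" if "f \<in> hom J a a'" for a a' f
      using T'[OF that, of b] hom_Obj[OF J that] by (simp add: k_def)
  qed (use Z fT in \<open>auto simp: k_def\<close>)
  have kh: "k b \<in> hom (FunCat J D) (Z b) T" for b using kn[of b] by (simp add: hom_FunCat k_def)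
  have kc: "Cmp (k b) a = \<iota> a b" if "a \<in> Obj J" for a b using that by (simp add: k_def)
  have e: "case_bool (k True) (k False) = k" "case_bool X Y = Z"
    by (auto simp: Z_def fun_eq_iff split: bool.splits)
  have cp: "is_coproduct (FunCat J D) UNIV Z T k"
  proof (rule coproductI)
    show "T \<in> Obj (FunCat J D)" using fT by simp
    show "k b \<in> hom (FunCat J D) (Z b) T" for b by (rule kh)
    fix V \<phi> assume V: "V \<in> Obj (FunCat J D)" and \<phi>: "\<And>b. b \<in> UNIV \<Longrightarrow> \<phi> b \<in> hom (FunCat J D) (Z b) V"
    have fV: "is_functor J D V" using V by simp
    have \<phi>n: "is_nattrans J D (\<phi> b)" "NDom (\<phi> b) = Z b" "NCod (\<phi> b) = V" for b using \<phi>[of b] by (auto simp: hom_FunCat)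
    obtain h where h: "h \<in> hom (FunCat J D) T V" "\<And>a b. a \<in> Obj J \<Longrightarrow> Cmp h a \<cdot>\<^bsub>D\<^esub> \<iota> a b = Cmp (\<phi> b) a"
    proof (rule levelwise_coproduct_induced[OF T fV, of "\<lambda>a b. Cmp (\<phi> b) a"])
      show "Cmp (\<phi> b) a \<in> hom D (OMap (Z b) a) (OMap V a)" if "a \<in> Obj J" for a b
        using nattransD(4)[OF \<phi>n(1) that] \<phi>n by simp
      show "AMap V f \<cdot>\<^bsub>D\<^esub> Cmp (\<phi> b) a = Cmp (\<phi> b) a' \<cdot>\<^bsub>D\<^esub> AMap (Z b) f" if "f \<in> hom J a a'" for f a a' b
        using nattransD(5)[OF \<phi>n(1) that] \<phi>n by simp
    qed (use that in simp)
    have "h \<cdot>\<^bsub>FunCat J D\<^esub> k b = \<phi> b" for b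
    proof (rule nattrans_eqI[OF _ \<phi>n(1)])
      show "is_nattrans J D (h \<cdot>\<^bsub>FunCat J D\<^esub> k b)"
        using category.comp_in_hom[OF category_FunCat[OF J D] kh h(1)] unfolding hom_FunCat by blast
    qed (use h kc \<phi>n in \<open>auto simp: hom_FunCat k_def\<close>)
    then show "\<exists>h\<in>hom (FunCat J D) T V. \<forall>b\<in>UNIV. h \<cdot>\<^bsub>FunCat J D\<^esub> k b = \<phi> b" using h(1) by blast
  next
    fix V h h' assume h: "h \<in> hom (FunCat J D) T V" and h': "h' \<in> hom (FunCat J D) T V"
      and e: "\<And>b. b \<in> UNIV \<Longrightarrow> h \<cdot>\<^bsub>FunCat J D\<^esub> k b = h' \<cdot>\<^bsub>FunCat J D\<^esub> k b"
    have n: "is_nattrans J D h" "NDom h = T" "NCod h = V" "is_nattrans J D h'" "NDom h' = T" "NCod h' = V"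
      using h h' by (auto simp: hom_FunCat)
    show "h = h'"
    proof (rule nattrans_eqI[OF n(1,4)])
      fix a assume a: "a \<in> Obj J"
      have ek: "Cmp h a \<cdot>\<^bsub>D\<^esub> \<iota> a b = Cmp h' a \<cdot>\<^bsub>D\<^esub> \<iota> a b" for b
        using arg_cong[OF e[of b], of "\<lambda>u. Cmp u a"] a kc[OF a] by simp
      show "Cmp h a = Cmp h' a"
        by (rule coproduct_ext[OF D c[OF a] nattransD(4)[OF n(1) a, unfolded n] nattransD(4)[OF n(4) a, unfolded n] ek])
    qed (use n in auto)
  qed
  show ?thesis
  proof (rule that)
    show "is_binary_coproduct (FunCat J D) X Y T (k True) (k False)"
      unfolding is_binary_coproduct_def e by (rule cp)
    show "is_binary_coproduct D (OMap X a) (OMap Y a) (OMap T a) (Cmp (k True) a) (Cmp (k False) a)" if "a \<in> Obj J" for a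
      unfolding is_binary_coproduct_def
      by (rule coproduct_cong[OF c[OF that]]) (auto simp: Z_def kc[OF that] split: bool.splits)
  qed
qed

lemma coproduct_iso:
  assumes D: "category D" and c: "is_coproduct D I X t \<iota>" and h: "h \<in> hom D t z" and g: "g \<in> hom D z t"
    and gh: "h \<cdot>\<^bsub>D\<^esub> g = Ide D z" and k: "\<And>i. i \<in> I \<Longrightarrow> \<kappa> i \<in> hom D (X i) z"
    and hk: "\<And>i. i \<in> I \<Longrightarrow> h \<cdot>\<^bsub>D\<^esub> \<iota> i = \<kappa> i" and gk: "\<And>i. i \<in> I \<Longrightarrow> g \<cdot>\<^bsub>D\<^esub> \<kappa> i = \<iota> i"
  shows "is_coproduct D I X z \<kappa>"
proof (rule coproductI)
  note as = category.comp_assoc[OF D] and cih = category.comp_in_hom[OF D]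
  show "z \<in> Obj D" using hom_Obj[OF D h] by auto
  show "\<kappa> i \<in> hom D (X i) z" if "i \<in> I" for i by (rule k[OF that])
  fix y \<phi> assume y: "y \<in> Obj D" and \<phi>: "\<And>i. i \<in> I \<Longrightarrow> \<phi> i \<in> hom D (X i) y"
  obtain u where u: "u \<in> hom D t y" "\<And>i. i \<in> I \<Longrightarrow> u \<cdot>\<^bsub>D\<^esub> \<iota> i = \<phi> i"
    using coproduct_induced[OF c y \<phi>] by blast
  have "(u \<cdot>\<^bsub>D\<^esub> g) \<cdot>\<^bsub>D\<^esub> \<kappa> i = \<phi> i" if "i \<in> I" for i using as[OF k[OF that] g u(1)] gk[OF that] u(2)[OF that] by simp
  then show "\<exists>u\<in>hom D z y. \<forall>i\<in>I. u \<cdot>\<^bsub>D\<^esub> \<kappa> i = \<phi> i" using cih[OF g u(1)] by blast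
next
  note as = category.comp_assoc[OF D] and cih = category.comp_in_hom[OF D]
  fix y u v assume u: "u \<in> hom D z y" and v: "v \<in> hom D z y" and e: "\<And>i. i \<in> I \<Longrightarrow> u \<cdot>\<^bsub>D\<^esub> \<kappa> i = v \<cdot>\<^bsub>D\<^esub> \<kappa> i"
  have "u \<cdot>\<^bsub>D\<^esub> h = v \<cdot>\<^bsub>D\<^esub> h"
    by (rule coproduct_ext[OF D c cih[OF h u] cih[OF h v]])
      (simp add: as[OF coproductD(2)[OF c] h u] as[OF coproductD(2)[OF c] h v] hk e)
  then have "(u \<cdot>\<^bsub>D\<^esub> h) \<cdot>\<^bsub>D\<^esub> g = (v \<cdot>\<^bsub>D\<^esub> h) \<cdot>\<^bsub>D\<^esub> g" by simp
  then show "u = v" using as[OF g h u] as[OF g h v] gh category.comp_ide_right[OF D u]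
    category.comp_ide_right[OF D v] by simp
qed

text \<open>Binary coproducts of functors are computed objectwise when the target has finite coproducts: the
  objectwise coproduct is a coproduct, hence isomorphic to any other one.\<close>

lemma binary_coproduct_FunCat_levelwise:
  assumes J: "category J" and D: "category D" and fc: "has_finite_coproducts D"
    and c: "is_binary_coproduct (FunCat J D) X Y Z i j" and a: "a \<in> Obj J"
  shows "is_binary_coproduct D (OMap X a) (OMap Y a) (OMap Z a) (Cmp i a) (Cmp j a)"
proof -
  note FJ = category_FunCat[OF J D]
  note as = category.comp_assoc[OF FJ] and cih = category.comp_in_hom[OF FJ] and cil = category.comp_ide_left[OF FJ]
  note c' = c[unfolded is_binary_coproduct_def]
  have i: "i \<in> hom (FunCat J D) X Z" and j: "j \<in> hom (FunCat J D) Y Z"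
    using coproductD(2)[OF c', of True] coproductD(2)[OF c', of False] by auto
  have X: "is_functor J D X" "is_functor J D Y" "is_functor J D Z"
    using hom_Obj[OF FJ i] hom_Obj[OF FJ j] by auto
  obtain T k l where T: "is_binary_coproduct (FunCat J D) X Y T k l"
    "\<And>a. a \<in> Obj J \<Longrightarrow> is_binary_coproduct D (OMap X a) (OMap Y a) (OMap T a) (Cmp k a) (Cmp l a)"
    using binary_coproduct_FunCat_exists[OF J fc X(1,2)] by blast
  note T' = T(1)[unfolded is_binary_coproduct_def]
  have k: "k \<in> hom (FunCat J D) X T" and l: "l \<in> hom (FunCat J D) Y T"
    using coproductD(2)[OF T', of True] coproductD(2)[OF T', of False] by auto
  have ij: "case_bool i j b \<in> hom (FunCat J D) (case_bool X Y b) Z" for b using i j by (cases b) auto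
  have kl: "case_bool k l b \<in> hom (FunCat J D) (case_bool X Y b) T" for b using k l by (cases b) auto
  obtain h where h: "h \<in> hom (FunCat J D) T Z" "\<And>b. h \<cdot>\<^bsub>FunCat J D\<^esub> case_bool k l b = case_bool i j b"
    using coproduct_universal[OF T' coproductD(1)[OF c'] ballI[OF ij], THEN ex1_implies_ex] by auto
  obtain g where g: "g \<in> hom (FunCat J D) Z T" "\<And>b. g \<cdot>\<^bsub>FunCat J D\<^esub> case_bool i j b = case_bool k l b"
    using coproduct_universal[OF c' coproductD(1)[OF T'] ballI[OF kl], THEN ex1_implies_ex] by auto
  have gh: "h \<cdot>\<^bsub>FunCat J D\<^esub> g = Ide (FunCat J D) Z"
  proof (rule coproduct_ext[OF FJ c' cih[OF g(1) h(1)] category.ide_in_hom[OF FJ coproductD(1)[OF c']]])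
    show "(h \<cdot>\<^bsub>FunCat J D\<^esub> g) \<cdot>\<^bsub>FunCat J D\<^esub> case_bool i j b = Ide (FunCat J D) Z \<cdot>\<^bsub>FunCat J D\<^esub> case_bool i j b" for b
      by (simp only: as[OF ij g(1) h(1)] g(2) h(2) cil[OF ij])
  qed
  have hn: "is_nattrans J D h" "NDom h = T" "NCod h = Z" and gn: "is_nattrans J D g" "NDom g = Z" "NCod g = T"
    using h g by (auto simp: hom_FunCat)
  have cmp: "Cmp (case_bool u v b) a = case_bool (Cmp u a) (Cmp v a) b"
    "OMap (case_bool P Q b) a = case_bool (OMap P a) (OMap Q a) b" for u v b P Q by (cases b; simp)+
  show ?thesis
    unfolding is_binary_coproduct_def
  proof (rule coproduct_iso[OF D T(2)[OF a, unfolded is_binary_coproduct_def]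
        nattransD(4)[OF hn(1) a, unfolded hn] nattransD(4)[OF gn(1) a, unfolded gn]])
    show "Cmp h a \<cdot>\<^bsub>D\<^esub> Cmp g a = Ide D (OMap Z a)"
      using arg_cong[OF gh, of "\<lambda>u. Cmp u a"] a by simp
    show "case_bool (Cmp i a) (Cmp j a) b \<in> hom D (case_bool (OMap X a) (OMap Y a) b) (OMap Z a)" for b
      using nattransD(4)[of J D i a] nattransD(4)[of J D j a] i j a by (cases b) (auto simp: hom_FunCat)
    show "Cmp h a \<cdot>\<^bsub>D\<^esub> case_bool (Cmp k a) (Cmp l a) b = case_bool (Cmp i a) (Cmp j a) b" for b
      using arg_cong[OF h(2)[of b], of "\<lambda>u. Cmp u a"] a by (simp add: cmp)
    show "Cmp g a \<cdot>\<^bsub>D\<^esub> case_bool (Cmp i a) (Cmp j a) b = case_bool (Cmp k a) (Cmp l a) b" for b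
      using arg_cong[OF g(2)[of b], of "\<lambda>u. Cmp u a"] a by (simp add: cmp)
  qed
qed

section \<open>Transport of the conditions on coproducts and weak equivalences\<close>

lemma binary_comparison:
  assumes P: "preserves_coproducts C D E (UNIV :: bool set) F"
    and c: "is_binary_coproduct C a b t i j" and p: "is_binary_coproduct D (OMap F a) (OMap F b) p i' j'"
    and k: "k \<in> hom D p (OMap F t)" "k \<cdot>\<^bsub>D\<^esub> i' = AMap F i" "k \<cdot>\<^bsub>D\<^esub> j' = AMap F j"
  shows "k \<in> E"
proof (rule preserves_coproductsD[OF P c[unfolded is_binary_coproduct_def] _ k(1)])
  show "is_coproduct D UNIV (\<lambda>x. OMap F (case_bool a b x)) p (case_bool i' j')"
    by (rule coproduct_cong[OF p[unfolded is_binary_coproduct_def]]) (auto split: bool.splits)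
  show "k \<cdot>\<^bsub>D\<^esub> case_bool i' j' x = AMap F (case_bool i j x)" for x using k by (cases x) auto
qed

lemma binary_coproductD:
  assumes "is_binary_coproduct D a b t i j"
  shows "t \<in> Obj D" "i \<in> hom D a t" "j \<in> hom D b t"
  using coproductD(1)[OF assms[unfolded is_binary_coproduct_def]]
    coproductD(2)[OF assms[unfolded is_binary_coproduct_def], of True]
    coproductD(2)[OF assms[unfolded is_binary_coproduct_def], of False] by auto

lemma binary_coproduct_induced:
  assumes "is_binary_coproduct D a b t i j" "category D" "f \<in> hom D a y" "g \<in> hom D b y"
  obtains h where "h \<in> hom D t y" "h \<cdot>\<^bsub>D\<^esub> i = f" "h \<cdot>\<^bsub>D\<^esub> j = g"
proof -
  have fg: "case_bool f g x \<in> hom D (case_bool a b x) y" for x using assms by (cases x) auto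
  have y: "y \<in> Obj D" using hom_Obj[OF assms(2,3)] by blast
  obtain h where h: "h \<in> hom D t y" "\<And>x. h \<cdot>\<^bsub>D\<^esub> case_bool i j x = case_bool f g x"
    using coproduct_universal[OF assms(1)[unfolded is_binary_coproduct_def] y ballI[OF fg], THEN ex1_implies_ex]
    by auto
  show ?thesis using that[OF h(1)] h(2)[of True] h(2)[of False] by simp
qed

lemma binary_coproduct_ext:
  assumes "is_binary_coproduct D a b t i j" "category D" "h \<in> hom D t y" "h' \<in> hom D t y"
    "h \<cdot>\<^bsub>D\<^esub> i = h' \<cdot>\<^bsub>D\<^esub> i" "h \<cdot>\<^bsub>D\<^esub> j = h' \<cdot>\<^bsub>D\<^esub> j"
  shows "h = h'"
  by (rule coproduct_ext[OF assms(2) assms(1)[unfolded is_binary_coproduct_def] assms(3,4)])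
    (use assms in \<open>auto split: bool.splits\<close>)

lemma binary_coproduct_exists:
  assumes "has_finite_coproducts D" "a \<in> Obj D" "b \<in> Obj D"
  obtains t i j where "is_binary_coproduct D a b t i j"
proof -
  have "case_bool a b x \<in> Obj D" for x using assms by (cases x) auto
  then obtain t \<iota> where "is_coproduct D (UNIV :: bool set) (case_bool a b) t \<iota>"
    using coproduct_exists[OF assms(1), of "UNIV :: bool set" "case_bool a b"] by auto
  moreover have "case_bool (\<iota> True) (\<iota> False) = \<iota>" by (auto simp: fun_eq_iff split: bool.splits)
  ultimately show ?thesis using that[of t "\<iota> True" "\<iota> False"] by (simp add: is_binary_coproduct_def)
qed

lemma simple_levelwise_weq:
  "S4 D E s \<Longrightarrow> h \<in> hom (Simp D) X Y \<Longrightarrow> (\<And>n. Cmp h n \<in> E) \<Longrightarrow> AMap s h \<in> E"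
  unfolding S4_def using homD[of h "Simp D" X Y] by blast

lemma transport_S4:
  assumes F: "is_functor C D F" and G: "is_functor D C G" and FW: "AMap F ` W \<subseteq> E" and GE: "AMap G ` E \<subseteq> W"
    and s: "is_functor (Simp D) D s" and S4: "S4 D E s"
  shows "S4 C W (G \<circ>\<^sub>F s \<circ>\<^sub>F post \<Delta>op F)"
  unfolding S4_def
proof (intro ballI impI)
  fix f assume f: "f \<in> Arr (Simp C)" and fW: "\<forall>n. Cmp f n \<in> W"
  have n: "is_nattrans \<Delta>op C f" using f by simp
  have "Cmp (whisker_left F f) k \<in> E" for k using fW FW n by auto
  then have "AMap s (whisker_left F f) \<in> E"
    using S4 nattrans_whisker_left[OF n F] unfolding S4_def by simp
  then show "AMap (G \<circ>\<^sub>F s \<circ>\<^sub>F post \<Delta>op F) f \<in> W"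
    using GE n F s functor_post[OF category_Dop F] nattrans_whisker_left[OF n F] by (auto simp: image_subset_iff)
qed

lemma transport_S1:
  assumes RC: "relative_category C W" and RD: "relative_category D E"
    and fcC: "has_finite_coproducts C" and fcD: "has_finite_coproducts D"
    and F: "is_functor C D F" and G: "is_functor D C G" and GE: "AMap G ` E \<subseteq> W"
    and PF: "preserves_coproducts C D E (UNIV :: bool set) F"
    and PG: "preserves_coproducts D C W (UNIV :: bool set) G"
    and S1: "S1 D E s" and S4: "S4 D E s"
  shows "S1 C W (G \<circ>\<^sub>F s \<circ>\<^sub>F post \<Delta>op F)"
  unfolding S1_def
proof (intro conjI ballI allI impI, goal_cases)
  have s: "is_functor (Simp D) D s" using S1 by (simp add: S1_def)
  have C: "category C" and D: "category D" using functor_cat[OF F] by auto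
  note P = functor_post[OF category_Dop F]
  note SD = category_FunCat[OF category_Dop D] and SC = category_FunCat[OF category_Dop C]
  {
    case 1
    show ?case by (rule functor_comp_func[OF functor_comp_func[OF P s] G])
  next
    case (2 X Y Z i j p i' j' h)
    have XY: "is_functor \<Delta>op C X" "is_functor \<Delta>op C Y" using 2(1,2) by auto
    have Z: "is_binary_coproduct (Simp C) X Y Z i j" using 2(3) by blast
    note ZD = binary_coproductD[OF Z]
    have fZ: "is_functor \<Delta>op C Z" using ZD(1) by simp
    have ij: "is_nattrans \<Delta>op C i" "is_nattrans \<Delta>op C j" using ZD by (auto simp: hom_FunCat)
    let ?FX = "F \<circ>\<^sub>F X" and ?FY = "F \<circ>\<^sub>F Y" and ?FZ = "F \<circ>\<^sub>F Z"
    let ?Fi = "whisker_left F i" and ?Fj = "whisker_left F j"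
    have Fij: "?Fi \<in> hom (Simp D) ?FX ?FZ" "?Fj \<in> hom (Simp D) ?FY ?FZ"
      using ZD nattrans_whisker_left[OF ij(1) F] nattrans_whisker_left[OF ij(2) F] by (auto simp: hom_FunCat)
    note FXY = functor_comp_func[OF XY(1) F] functor_comp_func[OF XY(2) F] functor_comp_func[OF fZ F]
    have ev: "OMap (G \<circ>\<^sub>F s \<circ>\<^sub>F post \<Delta>op F) V = OMap G (OMap s (F \<circ>\<^sub>F V))" if "is_functor \<Delta>op C V" for V
      using that F s functor_comp_func[OF that F] by simp
    have p: "is_binary_coproduct C (OMap G (OMap s ?FX)) (OMap G (OMap s ?FY)) p i' j'"
      and h: "h \<in> hom C p (OMap G (OMap s ?FZ))" and hi: "h \<cdot>\<^bsub>C\<^esub> i' = AMap G (AMap s ?Fi)"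
      and hj: "h \<cdot>\<^bsub>C\<^esub> j' = AMap G (AMap s ?Fj)"
      using 2(3) ev[OF XY(1)] ev[OF XY(2)] ev[OF fZ] ij F s
        nattrans_whisker_left[OF ij(1) F] nattrans_whisker_left[OF ij(2) F] by auto
    obtain T k l where T: "is_binary_coproduct (Simp D) ?FX ?FY T k l"
      "\<And>n. is_binary_coproduct D (OMap ?FX n) (OMap ?FY n) (OMap T n) (Cmp k n) (Cmp l n)"
      using binary_coproduct_FunCat_exists[OF category_Dop fcD FXY(1,2)] by auto
    note TD = binary_coproductD[OF T(1)]
    \<comment> \<open>The comparison of \<open>FX \<squnion> FY\<close> with \<open>F(X \<squnion> Y)\<close>, a levelwise weak equivalence.\<close>
    obtain e where e: "e \<in> hom (Simp D) T ?FZ" "e \<cdot>\<^bsub>Simp D\<^esub> k = ?Fi" "e \<cdot>\<^bsub>Simp D\<^esub> l = ?Fj"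
      using binary_coproduct_induced[OF T(1) SD Fij] by blast
    have en: "is_nattrans \<Delta>op D e" "NDom e = T" "NCod e = ?FZ" using e(1) by (auto simp: hom_FunCat)
    have "Cmp e n \<in> E" for n
    proof (rule binary_comparison[OF PF binary_coproduct_FunCat_levelwise[OF category_Dop C fcC Z, of n]])
      show "is_binary_coproduct D (OMap F (OMap X n)) (OMap F (OMap Y n)) (OMap T n) (Cmp k n) (Cmp l n)"
        using T(2)[of n] XY by simp
      show "Cmp e n \<in> hom D (OMap T n) (OMap F (OMap Z n))"
        using nattransD(4)[OF en(1), of n] en fZ by simp
      show "Cmp e n \<cdot>\<^bsub>D\<^esub> Cmp k n = AMap F (Cmp i n)" "Cmp e n \<cdot>\<^bsub>D\<^esub> Cmp l n = AMap F (Cmp j n)"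
        using arg_cong[OF e(2), of "\<lambda>u. Cmp u n"] arg_cong[OF e(3), of "\<lambda>u. Cmp u n"] ij by simp_all
    qed simp
    then have seE: "AMap s e \<in> E" using simple_levelwise_weq[OF S4 e(1)] by blast
    note sX = functor_ob[OF s, of ?FX] functor_ob[OF s, of ?FY]
    obtain q i1 j1 where q: "is_binary_coproduct D (OMap s ?FX) (OMap s ?FY) q i1 j1"
      using binary_coproduct_exists[OF fcD sX] FXY by auto
    note sk = functor_hom[OF s TD(2)] and sl = functor_hom[OF s TD(3)] and se = functor_hom[OF s e(1)]
    obtain c where c: "c \<in> hom D q (OMap s T)" "c \<cdot>\<^bsub>D\<^esub> i1 = AMap s k" "c \<cdot>\<^bsub>D\<^esub> j1 = AMap s l"
      using binary_coproduct_induced[OF q D sk sl] by blast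
    have cE: "c \<in> E" using S1 FXY T(1) q c unfolding S1_def by auto
    let ?m = "AMap s e \<cdot>\<^bsub>D\<^esub> c"
    note m = category.comp_in_hom[OF D c(1) se]
    have mE: "?m \<in> E" by (rule weq_comp[OF RD c(1) cE se seE])
    note qD = binary_coproductD[OF q]
    have mi: "?m \<cdot>\<^bsub>D\<^esub> i1 = AMap s ?Fi"
      using category.comp_assoc[OF D qD(2) c(1) se] c(2) functor_comp[OF s TD(2) e(1)] e(2) by simp
    have mj: "?m \<cdot>\<^bsub>D\<^esub> j1 = AMap s ?Fj"
      using category.comp_assoc[OF D qD(3) c(1) se] c(3) functor_comp[OF s TD(3) e(1)] e(3) by simp
    note Gi = functor_hom[OF G qD(2)] and Gj = functor_hom[OF G qD(3)] and Gm = functor_hom[OF G m]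
    note pD = binary_coproductD[OF p]
    obtain d where d: "d \<in> hom C p (OMap G q)" "d \<cdot>\<^bsub>C\<^esub> i' = AMap G i1" "d \<cdot>\<^bsub>C\<^esub> j' = AMap G j1"
      using binary_coproduct_induced[OF p C Gi Gj] by blast
    have dW: "d \<in> W" by (rule binary_comparison[OF PG q p d])
    \<comment> \<open>\<open>h\<close> is \<open>GsFX \<squnion> GsFY \<rightarrow> G(sFX \<squnion> sFY) \<rightarrow> G(s(FX \<squnion> FY)) \<rightarrow> GsF(X \<squnion> Y)\<close>.\<close>
    have "h = AMap G ?m \<cdot>\<^bsub>C\<^esub> d"
      by (rule binary_coproduct_ext[OF p C h category.comp_in_hom[OF C d(1) Gm]])
        (simp_all add: category.comp_assoc[OF C pD(2) d(1) Gm] category.comp_assoc[OF C pD(3) d(1) Gm] d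
          functor_comp[OF G qD(2) m, symmetric] functor_comp[OF G qD(3) m, symmetric] mi mj hi hj)
    moreover have "AMap G ?m \<in> W" using GE mE by blast
    ultimately show ?case using weq_comp[OF RC d(1) dW Gm] by simp
  }
qed

lemma std_simplex_sel [simp]:
  "OMap (std_simplex k) n = hom Delta n k"
  "x \<in> Arr Delta \<Longrightarrow> y \<in> hom Delta (Cod Delta x) k \<Longrightarrow> map_of_arr (AMap (std_simplex k) x) y = y \<cdot>\<^bsub>Delta\<^esub> x"
  by (simp_all add: std_simplex_def map_of_arr_def)

text \<open>The object \<open>[0]\<close> is terminal in \<open>\<Delta>\<close>, so that \<open>X\<close> is a tensor of \<open>X\<close> with \<open>\<Delta>[0]\<close>.\<close>

lemma hom_Delta_0: "hom Delta n 0 = {(n, 0, \<lambda>i\<in>{..n}. 0)}"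
proof (intro equalityI subsetI)
  fix x assume "x \<in> hom Delta n 0"
  then obtain f where f: "x = (n, 0, f)" "f \<in> {..n} \<rightarrow>\<^sub>E {..0}" by (auto simp: hom_Delta)
  have "f = (\<lambda>i\<in>{..n}. 0)"
    by (rule extensionalityI[of _ "{..n}"]) (use f(2) in \<open>auto simp: PiE_def Pi_def\<close>)
  then show "x \<in> {(n, 0, \<lambda>i\<in>{..n}. 0)}" using f(1) by simp
next
  fix x :: delta_arr assume "x \<in> {(n, 0, \<lambda>i\<in>{..n}. 0)}"
  then show "x \<in> hom Delta n 0" by (auto simp: hom_Delta mono_on_def)
qed

lemma singleton_coproduct:
  assumes D: "category D" and A: "A \<in> Obj D"
  shows "is_coproduct D {z} (\<lambda>_. A) A (\<lambda>_. Ide D A)"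
proof (rule coproductI)
  show "\<exists>h\<in>hom D A y. \<forall>i\<in>{z}. h \<cdot>\<^bsub>D\<^esub> Ide D A = \<phi> i" if "\<And>i. i \<in> {z} \<Longrightarrow> \<phi> i \<in> hom D A y" for y \<phi>
    using that[of z] category.comp_ide_right[OF D] by (intro bexI[of _ "\<phi> z"]) auto
  show "h = h'" if "h \<in> hom D A y" "h' \<in> hom D A y" "\<And>i. i \<in> {z} \<Longrightarrow> h \<cdot>\<^bsub>D\<^esub> Ide D A = h' \<cdot>\<^bsub>D\<^esub> Ide D A" for y h h'
    using that category.comp_ide_right[OF D] by auto
qed (use A category.ide_in_hom[OF D A] in auto)

lemma coface_hom: "coface 0 0 \<in> hom Delta 0 (Suc 0)"
  by (auto simp: coface_def hom_Delta mono_on_def)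

lemma transport_S5:
  fixes C :: "('o1, 'm1) category" and D :: "('o2, 'm2) category"
  assumes RD: "relative_category D E" and fcD: "has_finite_coproducts D"
    and F: "is_functor C D F" and G: "is_functor D C G" and GE: "AMap G ` E \<subseteq> W"
    and PF: "\<And>I :: delta_arr set. finite I \<Longrightarrow> preserves_coproducts C D E I F"
    and s: "is_functor (Simp D) D s" and S4: "S4 D E s" and S5: "S5 D E s"
  shows "S5 C W (G \<circ>\<^sub>F s \<circ>\<^sub>F post \<Delta>op F)"
  unfolding S5_def
proof (intro ballI allI impI)
  fix A T \<iota> d assume A: "A \<in> Obj C" and d0: "is_d0 C (const_obj C A) T \<iota> d"
  have C: "category C" and D: "category D" using functor_cat[OF F] by auto
  note FA = functor_ob[OF F A]
  note cA = functor_const_obj[OF C A] and cFA = functor_const_obj[OF D FA]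
  let ?c = "coface 0 0" and ?z = "\<lambda>n. (n, 0, \<lambda>i\<in>{..n}. 0) :: delta_arr"
  have z: "?z n \<in> hom Delta n 0" for n using hom_Delta_0[of n] by blast
  have cz: "?c \<cdot>\<^bsub>Delta\<^esub> ?z n \<in> hom Delta n (Suc 0)" for n
    by (rule category.comp_in_hom[OF category_Delta z coface_hom])
  have N: "NDom (std_simplex_map ?c) = std_simplex 0" "NCod (std_simplex_map ?c) = std_simplex (Suc 0)"
    using homD[OF coface_hom] by (simp_all add: std_simplex_map_def)
  have Nc: "map_of_arr (Cmp (std_simplex_map ?c) n) y = ?c \<cdot>\<^bsub>Delta\<^esub> y" if "y \<in> hom Delta n 0" for n y
    using that homD[OF coface_hom] by (simp add: std_simplex_map_def map_of_arr_def)
  have K0: "std_simplex 0 \<in> Obj (Simp FinSet)" and tT: "is_tensor C (const_obj C A) (std_simplex (Suc 0)) T \<iota>"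
    and dh: "d \<in> hom (Simp C) (const_obj C A) T"
    and dc: "\<And>n k. k \<in> hom Delta n 0 \<Longrightarrow> Cmp d n \<cdot>\<^bsub>C\<^esub> Ide C A = \<iota> n (?c \<cdot>\<^bsub>Delta\<^esub> k)"
    using d0 Nc unfolding is_d0_def is_tensor_map_def N is_tensor_def by auto
  have K1: "std_simplex (Suc 0) \<in> Obj (Simp FinSet)" and fT: "is_functor \<Delta>op C T"
    and cT: "\<And>n. is_coproduct C (hom Delta n (Suc 0)) (\<lambda>_. A) (OMap T n) (\<iota> n)"
    and nT: "\<And>x k. x \<in> Arr Delta \<Longrightarrow> k \<in> hom Delta (Cod Delta x) (Suc 0) \<Longrightarrow>
        AMap T x \<cdot>\<^bsub>C\<^esub> \<iota> (Cod Delta x) k = \<iota> (Dom Delta x) (k \<cdot>\<^bsub>Delta\<^esub> x) \<cdot>\<^bsub>C\<^esub> Ide C A"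
    using tT unfolding is_tensor_def by auto
  have fin: "finite (hom Delta n (Suc 0))" for n
    using functor_ob[of \<Delta>op FinSet "std_simplex (Suc 0)" n] K1 by (simp add: FinSet_def)
  note Dc = category.comp_in_hom[OF category_Delta] and Das = category.comp_assoc[OF category_Delta]
  have FAi: "Ide D (OMap F A) \<in> hom D (OMap F A) (OMap F A)" using category.ide_in_hom[OF D FA] .
  \<comment> \<open>\<open>T'\<close> is the tensor of \<open>F(A)\<close> with \<open>\<Delta>[1]\<close>, and \<open>d'\<close> is its map \<open>d\<^sub>0\<close>.\<close>
  obtain T' \<iota>' where T': "levelwise_coproduct \<Delta>op D (\<lambda>n. hom Delta n (Suc 0)) (\<lambda>_ _. OMap F A)
      (\<lambda>x k. k \<cdot>\<^bsub>Delta\<^esub> x) (\<lambda>_ _. Ide D (OMap F A)) T' \<iota>'"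
    by (rule levelwise_coproduct_exists[OF category_Dop D fcD, of "\<lambda>n. hom Delta n (Suc 0)" "\<lambda>_ _. OMap F A"
          "\<lambda>x k. k \<cdot>\<^bsub>Delta\<^esub> x" "\<lambda>_ _. Ide D (OMap F A)"])
      (use fin FA FAi Dc Das category.comp_ide_right[OF category_Delta] category.comp_ide_left[OF D FAi] in
        \<open>simp_all add: hom_opp del: Delta_sel\<close>)
  have fT': "is_functor \<Delta>op D T'"
    and cT': "\<And>n. is_coproduct D (hom Delta n (Suc 0)) (\<lambda>_. OMap F A) (OMap T' n) (\<iota>' n)"
    and nT': "\<And>m n x k. x \<in> hom Delta m n \<Longrightarrow> k \<in> hom Delta n (Suc 0) \<Longrightarrow>
        AMap T' x \<cdot>\<^bsub>D\<^esub> \<iota>' n k = \<iota>' m (k \<cdot>\<^bsub>Delta\<^esub> x) \<cdot>\<^bsub>D\<^esub> Ide D (OMap F A)"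
    using T' unfolding levelwise_coproduct_def hom_opp by auto
  define d' where "d' = \<lparr>NDom = const_obj D (OMap F A), NCod = T', Cmp = (\<lambda>n\<in>UNIV. \<iota>' n (?c \<cdot>\<^bsub>Delta\<^esub> ?z n))\<rparr>"
  have d'n: "is_nattrans \<Delta>op D d'"
  proof (rule nattransI)
    show "Cmp d' n \<in> hom D (OMap (NDom d') n) (OMap (NCod d') n)" for n
      using coproductD(2)[OF cT' cz] by (simp add: d'_def del: Delta_sel(5))
    show "Cmp d' m \<cdot>\<^bsub>D\<^esub> AMap (NDom d') x = AMap (NCod d') x \<cdot>\<^bsub>D\<^esub> Cmp d' n" if "x \<in> hom \<Delta>op n m" for m n x
    proof -
      have x: "x \<in> hom Delta m n" using that by (simp add: hom_opp)
      have "?z n \<cdot>\<^bsub>Delta\<^esub> x = ?z m" using Dc[OF x z] hom_Delta_0[of m] by blast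
      then have "(?c \<cdot>\<^bsub>Delta\<^esub> ?z n) \<cdot>\<^bsub>Delta\<^esub> x = ?c \<cdot>\<^bsub>Delta\<^esub> ?z m" using Das[OF x z coface_hom] by simp
      then show ?thesis using nT'[OF x cz] homD[OF x] by (simp add: d'_def del: Delta_sel(5))
    qed
  qed (use cFA fT' in \<open>auto simp: d'_def\<close>)
  have d'h: "d' \<in> hom (Simp D) (const_obj D (OMap F A)) T'" using d'n by (simp add: hom_FunCat d'_def)
  have ide_r: "\<iota>' n k \<cdot>\<^bsub>D\<^esub> Ide D (OMap F A) = \<iota>' n k" if "k \<in> hom Delta n (Suc 0)" for n k
    using category.comp_ide_right[OF D coproductD(2)[OF cT' that]] .
  have "is_d0 D (const_obj D (OMap F A)) T' \<iota>' d'"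
    unfolding is_d0_def is_tensor_map_def N is_tensor_def
  proof (intro conjI ballI allI)
    show "is_coproduct D (OMap (std_simplex 0) n) (\<lambda>_. OMap (const_obj D (OMap F A)) n)
        (OMap (const_obj D (OMap F A)) n) (\<lambda>k. Ide D (OMap (const_obj D (OMap F A)) n))" for n
      using singleton_coproduct[OF D FA] by (simp add: hom_Delta_0)
    show "Cmp d' n \<cdot>\<^bsub>D\<^esub> Ide D (OMap (const_obj D (OMap F A)) n) = \<iota>' n (map_of_arr (Cmp (std_simplex_map ?c) n) k)"
      if "k \<in> OMap (std_simplex 0) n" for n k
      using that Nc[of k n] ide_r[OF cz, of n] hom_Delta_0[of n] by (simp add: d'_def del: Delta_sel(5))
    show "AMap T' x \<cdot>\<^bsub>D\<^esub> \<iota>' (Cod Delta x) k = \<iota>' (Dom Delta x) (map_of_arr (AMap (std_simplex (Suc 0)) x) k) \<cdot>\<^bsub>D\<^esub>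
        AMap (const_obj D (OMap F A)) x" if "x \<in> Arr Delta" "k \<in> OMap (std_simplex (Suc 0)) (Cod Delta x)" for x k
      using that nT'[OF Arr_hom[OF that(1)]] by simp
  qed (use cFA fT' K0 K1 cT' d'h in auto)
  then have sd': "AMap s d' \<in> E" using S5 FA unfolding S5_def by blast
  let ?FT = "F \<circ>\<^sub>F T"
  have \<iota>: "AMap F (\<iota> n k) \<in> hom D (OMap F A) (OMap F (OMap T n))" if "k \<in> hom Delta n (Suc 0)" for n k
    using functor_hom[OF F coproductD(2)[OF cT that]] .
  \<comment> \<open>The comparison \<open>e\<close> from \<open>F(A) \<boxtimes> \<Delta>[1]\<close> to \<open>F(A \<boxtimes> \<Delta>[1])\<close> satisfies \<open>F(d) = e d'\<close>.\<close>
  have "\<exists>e. e \<in> hom (Simp D) T' ?FT \<and> (\<forall>n. \<forall>k \<in> hom Delta n (Suc 0). Cmp e n \<cdot>\<^bsub>D\<^esub> \<iota>' n k = AMap F (\<iota> n k))"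
  proof (rule levelwise_coproduct_induced[OF T' functor_comp_func[OF fT F], of "\<lambda>n k. AMap F (\<iota> n k)"])
    show "AMap F (\<iota> n k) \<in> hom D (OMap F A) (OMap ?FT n)" if "k \<in> hom Delta n (Suc 0)" for n k
      using \<iota>[OF that] fT by simp
    show "AMap ?FT x \<cdot>\<^bsub>D\<^esub> AMap F (\<iota> n k) = AMap F (\<iota> m (k \<cdot>\<^bsub>Delta\<^esub> x)) \<cdot>\<^bsub>D\<^esub> Ide D (OMap F A)"
      if "x \<in> hom \<Delta>op n m" and k: "k \<in> hom Delta n (Suc 0)" for x m n k
    proof -
      have x: "x \<in> hom Delta m n" using that by (simp add: hom_opp)
      have Tx: "AMap T x \<in> hom C (OMap T n) (OMap T m)" using functor_hom[OF fT that(1)] .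
      note i = coproductD(2)[OF cT k] and i' = coproductD(2)[OF cT Dc[OF x k]]
      have "AMap F (AMap T x) \<cdot>\<^bsub>D\<^esub> AMap F (\<iota> n k) = AMap F (\<iota> m (k \<cdot>\<^bsub>Delta\<^esub> x))"
        using functor_comp[OF F i Tx] nT[of x k] homD[OF x] k category.comp_ide_right[OF C i'] by simp
      then show ?thesis using category.comp_ide_right[OF D functor_hom[OF F i']] homD[OF x] fT by simp
    qed
  qed auto
  then obtain e where e: "e \<in> hom (Simp D) T' ?FT"
    "\<And>n k. k \<in> hom Delta n (Suc 0) \<Longrightarrow> Cmp e n \<cdot>\<^bsub>D\<^esub> \<iota>' n k = AMap F (\<iota> n k)" by blast
  have en: "is_nattrans \<Delta>op D e" "NDom e = T'" "NCod e = ?FT" using e(1) by (auto simp: hom_FunCat)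
  have "Cmp e n \<in> E" for n
    by (rule preserves_coproductsD[OF PF[OF fin] cT cT' _ e(2)])
      (use nattransD(4)[OF en(1), of n] en fT in simp)
  then have se: "AMap s e \<in> E" using simple_levelwise_weq[OF S4 e(1)] by blast
  have dn: "is_nattrans \<Delta>op C d" "NDom d = const_obj C A" "NCod d = T" using dh by (auto simp: hom_FunCat)
  have "whisker_left F d = e \<cdot>\<^bsub>Simp D\<^esub> d'"
  proof (rule nattrans_eqI[OF nattrans_whisker_left[OF dn(1) F]])
    show "is_nattrans \<Delta>op D (e \<cdot>\<^bsub>Simp D\<^esub> d')"
      using category.comp_in_hom[OF category_FunCat[OF category_Dop D] d'h e(1)] unfolding hom_FunCat by blast
    fix n
    have "Cmp d n = \<iota> n (?c \<cdot>\<^bsub>Delta\<^esub> ?z n)"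
      using dc[OF z, of n] category.comp_ide_right[OF C nattransD(4)[OF dn(1), of n, unfolded dn]] by simp
    then show "Cmp (whisker_left F d) n = Cmp (e \<cdot>\<^bsub>Simp D\<^esub> d') n"
      using e(2)[OF cz, of n] dn by (simp add: d'_def del: Delta_sel(5))
  qed (use dn en d'h comp_const_obj[OF F A] in \<open>auto simp: hom_FunCat\<close>)
  then have "AMap s (whisker_left F d) = AMap s e \<cdot>\<^bsub>D\<^esub> AMap s d'" using functor_comp[OF s d'h e(1)] by simp
  then have "AMap s (whisker_left F d) \<in> E"
    using weq_comp[OF RD functor_hom[OF s d'h] sd' functor_hom[OF s e(1)] se] by simp
  then show "AMap (G \<circ>\<^sub>F s \<circ>\<^sub>F post \<Delta>op F) d \<in> W"
    using GE dn F s nattrans_whisker_left[OF dn(1) F] by (auto simp: image_subset_iff)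
qed

section \<open>Equivalences are adjoint equivalences\<close>

(* The condition of functor_sel would loop with isf_iff below. Words stay in the form wl, wr, pn only if
   nested maps are not merged. *)
declare functor_sel [simp del] nattrans_Src [simp del] map_map [simp del] map_eq_conv [simp del]

text \<open>The predicate \<open>isf\<close> takes source and target from the functor itself, so that the simplifier can
  check that functors are composable and bring composites into right-nested form.\<close>

definition isf where "isf F \<longleftrightarrow> is_functor (Src F) (Tgt F) F"

lemma isf_iff: "is_functor A B F \<longleftrightarrow> isf F \<and> Src F = A \<and> Tgt F = B"
  unfolding isf_def using functor_sel by blast

lemma isf_rules:
  "isf F \<Longrightarrow> isf G \<Longrightarrow> Tgt F = Src G \<Longrightarrow> isf (G \<circ>\<^sub>F F)"
  "isf F \<Longrightarrow> isf G \<Longrightarrow> Tgt F = Src G \<Longrightarrow> (H \<circ>\<^sub>F G) \<circ>\<^sub>F F = H \<circ>\<^sub>F (G \<circ>\<^sub>F F)"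
  "isf F \<Longrightarrow> Src F = A \<Longrightarrow> F \<circ>\<^sub>F id_func A = F"
  "isf F \<Longrightarrow> Tgt F = B \<Longrightarrow> id_func B \<circ>\<^sub>F F = F"
proof -
  assume F: "isf F"
  show "F \<circ>\<^sub>F id_func A = F" if "Src F = A"
    using F comp_id_func_right[of "Src F" "Tgt F" F] that by (simp add: isf_def)
  show "id_func B \<circ>\<^sub>F F = F" if "Tgt F = B"
    using F comp_id_func_left[of "Src F" "Tgt F" F] that by (simp add: isf_def)
  assume G: "isf G" and FG: "Tgt F = Src G"
  have G': "is_functor (Tgt F) (Tgt G) G" using G FG by (simp add: isf_def)
  show "isf (G \<circ>\<^sub>F F)" using functor_comp_func[OF F[unfolded isf_def] G'] by (simp add: isf_def)
  show "(H \<circ>\<^sub>F G) \<circ>\<^sub>F F = H \<circ>\<^sub>F (G \<circ>\<^sub>F F)" by (rule comp_func_assoc[OF F[unfolded isf_def] G'])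
qed

text \<open>As for equivalences of categories, one of the two zigzags can be corrected so that both
  triangle identities hold in the localization. The correction is
  \<open>FG \<leftarrow> FGFG \<rightarrow> FG \<rightarrow> 1\<close>, with arrows \<open>\<beta>FG\<close>, \<open>F\<alpha>G\<close> and \<open>\<beta>\<close>.\<close>

lemma adjoint_zigzags:
  assumes RC: "relative_category C W" and RD: "relative_category D E"
    and F: "is_functor C D F" and G: "is_functor D C G"
    and FW: "AMap F ` W \<subseteq> E" and GE: "AMap G ` E \<subseteq> W"
    and a: "nzig C C W (G \<circ>\<^sub>F F) \<alpha> (id_func C)" and b: "nzig D D E (F \<circ>\<^sub>F G) \<beta> (id_func D)"
  obtains \<beta>' where "nzig D D E (F \<circ>\<^sub>F G) \<beta>' (id_func D)"
    "nzeq D C W (G \<circ>\<^sub>F F \<circ>\<^sub>F G) G (wl G \<beta>') (wr \<alpha> G)"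
    "nzeq C D E (F \<circ>\<^sub>F G \<circ>\<^sub>F F) F (wr \<beta>' F) (wl F \<alpha>)"
proof -
  have CD: "category C" "category D" using functor_cat[OF F] by auto
  have WA: "W \<subseteq> Arr C" and EA: "E \<subseteq> Arr D" using weq_Arr RC RD by auto
  note GF = functor_comp_func[OF F G] and FG = functor_comp_func[OF G F]
  note GFG = functor_comp_func[OF FG G] and FGF = functor_comp_func[OF GF F]
  note S = F[unfolded isf_iff] G[unfolded isf_iff] isf_rules
  have GFW: "AMap (G \<circ>\<^sub>F F) ` W \<subseteq> W" and FGE: "AMap (F \<circ>\<^sub>F G) ` E \<subseteq> E"
    using FW GE WA EA S by (auto simp: subset_eq)
  note XCC = category_FunCat[OF CD(1) CD(1)] and XDD = category_FunCat[OF CD(2) CD(2)]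
  note XCD = category_FunCat[OF CD(1) CD(2)] and XDC = category_FunCat[OF CD(2) CD(1)]
  have aG: "nzig D C W (G \<circ>\<^sub>F F \<circ>\<^sub>F G) (wr \<alpha> G) G" using nzig_wr[OF G a] by (simp add: S)
  have aGF: "nzig C C W (G \<circ>\<^sub>F F \<circ>\<^sub>F G \<circ>\<^sub>F F) (wr \<alpha> (G \<circ>\<^sub>F F)) (G \<circ>\<^sub>F F)"
    using nzig_wr[OF GF a] by (simp add: S)
  have GFa: "nzig C C W (G \<circ>\<^sub>F F \<circ>\<^sub>F G \<circ>\<^sub>F F) (wl (G \<circ>\<^sub>F F) \<alpha>) (G \<circ>\<^sub>F F)"
    using nzig_wl[OF GF GFW a] by (simp add: S)
  have Fa: "nzig C D E (F \<circ>\<^sub>F G \<circ>\<^sub>F F) (wl F \<alpha>) F" using nzig_wl[OF F FW a] by (simp add: S)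
  have bF: "nzig C D E (F \<circ>\<^sub>F G \<circ>\<^sub>F F) (wr \<beta> F) F" using nzig_wr[OF F b] by (simp add: S)
  have bFG: "nzig D D E (F \<circ>\<^sub>F G \<circ>\<^sub>F F \<circ>\<^sub>F G) (wr \<beta> (F \<circ>\<^sub>F G)) (F \<circ>\<^sub>F G)"
    using nzig_wr[OF FG b] by (simp add: S)
  have FGb: "nzig D D E (F \<circ>\<^sub>F G \<circ>\<^sub>F F \<circ>\<^sub>F G) (wl (F \<circ>\<^sub>F G) \<beta>) (F \<circ>\<^sub>F G)"
    using nzig_wl[OF FG FGE b] by (simp add: S)
  have Gb: "nzig D C W (G \<circ>\<^sub>F F \<circ>\<^sub>F G) (wl G \<beta>) G" using nzig_wl[OF G GE b] by (simp add: S)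
  have FaG: "nzig D D E (F \<circ>\<^sub>F G \<circ>\<^sub>F F \<circ>\<^sub>F G) (wl F (wr \<alpha> G)) (F \<circ>\<^sub>F G)" using nzig_wl[OF F FW aG] .
  \<comment> \<open>\<open>GF\<alpha> = \<alpha>GF\<close> and \<open>FG\<beta> = \<beta>FG\<close>, by interchanging \<open>\<alpha>\<close>, respectively \<open>\<beta>\<close>, with itself.\<close>
  have e1: "nzeq C C W (G \<circ>\<^sub>F F \<circ>\<^sub>F G \<circ>\<^sub>F F) (G \<circ>\<^sub>F F) (wl (G \<circ>\<^sub>F F) \<alpha>) (wr \<alpha> (G \<circ>\<^sub>F F))"
    by (rule zeq_cancel_right[OF XCC _ GFa aGF a])
      (use interchange[OF RC WA a a GFW] in
        \<open>simp add: S wl_id[OF a] wr_id[OF a] functor_id_func[OF CD(1), unfolded isf_iff]\<close>)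
  have e2: "nzeq D D E (F \<circ>\<^sub>F G \<circ>\<^sub>F F \<circ>\<^sub>F G) (F \<circ>\<^sub>F G) (wl (F \<circ>\<^sub>F G) \<beta>) (wr \<beta> (F \<circ>\<^sub>F G))"
    by (rule zeq_cancel_right[OF XDD _ FGb bFG b])
      (use interchange[OF RD EA b b FGE] in
        \<open>simp add: S wl_id[OF b] wr_id[OF b] functor_id_func[OF CD(2), unfolded isf_iff]\<close>)
  define \<beta>' where "\<beta>' = winv (wr \<beta> (F \<circ>\<^sub>F G)) @ wl F (wr \<alpha> G) @ \<beta>"
  show ?thesis
  proof (rule that[of \<beta>'])
    show "nzig D D E (F \<circ>\<^sub>F G) \<beta>' (id_func D)"
      unfolding \<beta>'_def by (rule zig_append[OF zig_winv[OF XDD bFG] zig_append[OF FaG b]])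
  next
    let ?P = "wr \<beta> (F \<circ>\<^sub>F G \<circ>\<^sub>F F)"
    have P: "nzig C D E (F \<circ>\<^sub>F G \<circ>\<^sub>F F \<circ>\<^sub>F G \<circ>\<^sub>F F) ?P (F \<circ>\<^sub>F G \<circ>\<^sub>F F)"
      using nzig_wr[OF FGF b] by (simp add: S)
    have eq: "wr \<beta>' F = winv ?P @ (wl F (wr \<alpha> (G \<circ>\<^sub>F F)) @ wr \<beta> F)"
      by (simp only: \<beta>'_def map_append wmap_winv wr_wr[OF b FG F] wr_wl[OF aG F F] wr_wr[OF a G F])
        (simp add: S)
    have 1: "nzeq C D E (F \<circ>\<^sub>F G \<circ>\<^sub>F F \<circ>\<^sub>F G \<circ>\<^sub>F F) (F \<circ>\<^sub>F G \<circ>\<^sub>F F) (wl F (wr \<alpha> (G \<circ>\<^sub>F F))) (wl F (wl (G \<circ>\<^sub>F F) \<alpha>))"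
      by (rule zeq_sym[OF nzeq_wl[OF F FW e1]])
    have "wl F (wl (G \<circ>\<^sub>F F) \<alpha>) = wl (F \<circ>\<^sub>F G) (wl F \<alpha>)"
      by (simp only: wl_wl[OF a GF F] wl_wl[OF a F FG]) (simp add: S)
    then have 2: "nzeq C D E (F \<circ>\<^sub>F G \<circ>\<^sub>F F \<circ>\<^sub>F G \<circ>\<^sub>F F) F (wl F (wl (G \<circ>\<^sub>F F) \<alpha>) @ wr \<beta> F) (?P @ wl F \<alpha>)"
      using interchange[OF RD EA Fa b FGE] by (simp add: S wl_id[OF Fa])
    note P' = zig_winv[OF XCD P]
    have "nzeq C D E (F \<circ>\<^sub>F G \<circ>\<^sub>F F) F (wr \<beta>' F) (winv ?P @ (wl F (wl (G \<circ>\<^sub>F F) \<alpha>) @ wr \<beta> F))"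
      unfolding eq by (rule zeq_append_left[OF P' zeq_append_right[OF 1 bF]])
    also have "nzeq C D E (F \<circ>\<^sub>F G \<circ>\<^sub>F F) F (winv ?P @ (wl F (wl (G \<circ>\<^sub>F F) \<alpha>) @ wr \<beta> F)) (winv ?P @ (?P @ wl F \<alpha>))"
      by (rule zeq_append_left[OF P' 2])
    also have "nzeq C D E (F \<circ>\<^sub>F G \<circ>\<^sub>F F) F (winv ?P @ (?P @ wl F \<alpha>)) (wl F \<alpha>)"
      using zeq_append_right[OF zeq_winv_left[OF XCD P] Fa] by simp
    finally show "nzeq C D E (F \<circ>\<^sub>F G \<circ>\<^sub>F F) F (wr \<beta>' F) (wl F \<alpha>)" .
  next
    let ?P = "wl G (wr \<beta> (F \<circ>\<^sub>F G))"
    have P: "nzig D C W (G \<circ>\<^sub>F F \<circ>\<^sub>F G \<circ>\<^sub>F F \<circ>\<^sub>F G) ?P (G \<circ>\<^sub>F F \<circ>\<^sub>F G)" by (rule nzig_wl[OF G GE bFG])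
    note P' = zig_winv[OF XDC P]
    have "wl G (wl F (wr \<alpha> G)) = wr (wl (G \<circ>\<^sub>F F) \<alpha>) G"
      by (simp add: wl_wl[OF aG F G] wr_wl[OF a G GF])
    then have eq: "wl G \<beta>' = winv ?P @ (wr (wl (G \<circ>\<^sub>F F) \<alpha>) G @ wl G \<beta>)"
      by (simp only: \<beta>'_def map_append wmap_winv)
    have 1: "nzeq D C W (G \<circ>\<^sub>F F \<circ>\<^sub>F G \<circ>\<^sub>F F \<circ>\<^sub>F G) (G \<circ>\<^sub>F F \<circ>\<^sub>F G) (wr (wl (G \<circ>\<^sub>F F) \<alpha>) G) (wr \<alpha> (G \<circ>\<^sub>F F \<circ>\<^sub>F G))"
      using nzeq_wr[OF G e1] by (simp add: S wr_wr[OF a GF G])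
    have 2: "nzeq D C W (G \<circ>\<^sub>F F \<circ>\<^sub>F G \<circ>\<^sub>F F \<circ>\<^sub>F G) G (wr \<alpha> (G \<circ>\<^sub>F F \<circ>\<^sub>F G) @ wl G \<beta>) (wl G (wl (F \<circ>\<^sub>F G) \<beta>) @ wr \<alpha> G)"
      using zeq_sym[OF interchange[OF RC WA Gb a GFW]]
      by (simp add: S wl_id[OF Gb] wl_wl[OF b G GF] wl_wl[OF b FG G])
    have 3: "nzeq D C W (G \<circ>\<^sub>F F \<circ>\<^sub>F G \<circ>\<^sub>F F \<circ>\<^sub>F G) (G \<circ>\<^sub>F F \<circ>\<^sub>F G) (wl G (wl (F \<circ>\<^sub>F G) \<beta>)) ?P"
      by (rule nzeq_wl[OF G GE e2])
    have "nzeq D C W (G \<circ>\<^sub>F F \<circ>\<^sub>F G) G (wl G \<beta>') (winv ?P @ (wr \<alpha> (G \<circ>\<^sub>F F \<circ>\<^sub>F G) @ wl G \<beta>))"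
      unfolding eq by (rule zeq_append_left[OF P' zeq_append_right[OF 1 Gb]])
    also have "nzeq D C W (G \<circ>\<^sub>F F \<circ>\<^sub>F G) G \<dots> (winv ?P @ (wl G (wl (F \<circ>\<^sub>F G) \<beta>) @ wr \<alpha> G))"
      by (rule zeq_append_left[OF P' 2])
    also have "nzeq D C W (G \<circ>\<^sub>F F \<circ>\<^sub>F G) G \<dots> (winv ?P @ (?P @ wr \<alpha> G))"
      by (rule zeq_append_left[OF P' zeq_append_right[OF 3 aG]])
    also have "nzeq D C W (G \<circ>\<^sub>F F \<circ>\<^sub>F G) G \<dots> (wr \<alpha> G)"
      using zeq_append_right[OF zeq_winv_left[OF XDC P] aG] by simp
    finally show "nzeq D C W (G \<circ>\<^sub>F F \<circ>\<^sub>F G) G (wl G \<beta>') (wr \<alpha> G)" .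
  qed
qed

section \<open>Transport of the simple functor and its comparison zigzags\<close>

lemma is_identity_of_iff:
  assumes s: "is_functor (Simp D) D s"
  shows "is_identity_of D E s u \<longleftrightarrow> gz_eq (FunCat (Simp D) D) (objectwise (Simp D) D E) s s u []"
proof -
  let ?X = "FunCat (Simp D) D" and ?V = "objectwise (Simp D) D E"
  have X: "category ?X" using category_FunCat functor_cat[OF s] by blast
  have n: "gz_eq ?X ?V s s [] []" using s by (intro gz_eq.refl) simp
  have "gz_class ?X ?V s s u = Ide (localization ?X ?V) s \<longleftrightarrow> (\<forall>v. gz_eq ?X ?V s s u v \<longleftrightarrow> gz_eq ?X ?V s s [] v)"
    by (auto simp: gz_class_def localization_def)
  also have "\<dots> \<longleftrightarrow> gz_eq ?X ?V s s u []"   proof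
    assume "\<forall>v. gz_eq ?X ?V s s u v \<longleftrightarrow> gz_eq ?X ?V s s [] v"
    then show "gz_eq ?X ?V s s u []" using n by blast
  next
    assume u: "gz_eq ?X ?V s s u []"
    show "\<forall>v. gz_eq ?X ?V s s u v \<longleftrightarrow> gz_eq ?X ?V s s [] v"
      using gz_eq.trans[OF u] gz_eq.trans[OF gz_eq.sym[OF u]] by blast
  qed
  finally show ?thesis using gz_path[OF X] unfolding is_identity_of_def by blast
qed

(* Sources and targets are given below by facts in which Simp C and Simp D are folded. *)
declare post_sel(1,2) [simp del] diag_func_sel(1,2) [simp del]

text \<open>Functors are denoted as follows: \<open>F1\<close>, \<open>G1\<close>, \<open>s1\<close> are \<open>F\<close>, \<open>G\<close>, \<open>s\<close> applied levelwise, \<open>F2\<close> is \<open>F1\<close> applied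
  levelwise, and \<open>c\<close> with an index is a constant diagram functor.\<close>

lemma transport_S2_S3:
  fixes C :: "('o1, 'm1) category" and D :: "('o2, 'm2) category"
    and s :: "('o2, 'm2) simple_func" and \<mu> :: "('o2, 'm2) mu_zigzag"
  assumes RC: "relative_category C W" and RD: "relative_category D E"
    and F: "is_functor C D F" and G: "is_functor D C G"
    and FW: "AMap F ` W \<subseteq> E" and GE: "AMap G ` E \<subseteq> W"
    and a: "nzig C C W (G \<circ>\<^sub>F F) \<alpha> (id_func C)" and b: "nzig D D E (F \<circ>\<^sub>F G) \<beta> (id_func D)"
    and tri1: "nzeq D C W (G \<circ>\<^sub>F F \<circ>\<^sub>F G) G (wl G \<beta>) (wr \<alpha> G)"
    and tri2: "nzeq C D E (F \<circ>\<^sub>F G \<circ>\<^sub>F F) F (wr \<beta> F) (wl F \<alpha>)"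
    and s: "is_functor (Simp D) D s" and S2: "S2 D E s \<mu>" and S3: "S3 D E s \<mu> lam" and S4: "S4 D E s"
  shows "\<exists>\<mu>' lam'. S2 C W (G \<circ>\<^sub>F s \<circ>\<^sub>F post \<Delta>op F) \<mu>' \<and> S3 C W (G \<circ>\<^sub>F s \<circ>\<^sub>F post \<Delta>op F) \<mu>' lam'"
proof -
  define T where "T = Simp C"
  define S where "S = Simp D"
  define s' where "s' = G \<circ>\<^sub>F s \<circ>\<^sub>F post \<Delta>op F"
  define F1 where "F1 = post \<Delta>op F"
  define G1 where "G1 = post \<Delta>op G"
  define s1 where "s1 = post \<Delta>op s"
  define F2 where "F2 = post \<Delta>op F1"
  define cC where "cC = const_func C"
  define cD where "cD = const_func D"
  define cT where "cT = const_func T"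
  define cS where "cS = const_func S"
  have CD: "category C" "category D" using functor_cat[OF F] by auto
  have catT: "category T" and catS: "category S"
    unfolding T_def S_def by (rule category_FunCat[OF category_Dop CD(1)] category_FunCat[OF category_Dop CD(2)])+
  have EA: "E \<subseteq> Arr D" and WA: "W \<subseteq> Arr C" using weq_Arr RC RD by auto
  define EE where "EE = objectwise \<Delta>op D E"
  have s: "is_functor S D s" using s by (simp add: S_def)
  have F1: "is_functor T S F1" unfolding T_def S_def F1_def by (rule functor_post[OF category_Dop F])
  have G1: "is_functor S T G1" unfolding T_def S_def G1_def by (rule functor_post[OF category_Dop G])
  have s1: "is_functor (Simp S) S s1" using functor_post[OF category_Dop s] by (simp add: s1_def S_def)
  have F2: "is_functor (Simp T) (Simp S) F2" unfolding F2_def by (rule functor_post[OF category_Dop F1])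
  have cC: "is_functor C T cC" unfolding cC_def T_def by (rule functor_const_func[OF CD(1)])
  have cD: "is_functor D S cD" unfolding cD_def S_def by (rule functor_const_func[OF CD(2)])
  have cT: "is_functor T (Simp T) cT" unfolding cT_def by (rule functor_const_func[OF catT])
  have cS: "is_functor S (Simp S) cS" unfolding cS_def by (rule functor_const_func[OF catS])
  have pcC: "is_functor T (Simp T) (post \<Delta>op cC)"
    using functor_post[OF category_Dop cC] by (simp add: T_def)
  have pcD: "is_functor S (Simp S) (post \<Delta>op cD)"
    using functor_post[OF category_Dop cD] by (simp add: S_def)
  have dC: "is_functor (Simp T) T (diag_func C)" unfolding T_def by (rule functor_diag_func[OF CD(1)])
  have dD: "is_functor (Simp S) S (diag_func D)" unfolding S_def by (rule functor_diag_func[OF CD(2)])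
  note FF = F G s F1 G1 s1 F2 cC cD cT cS pcC pcD dC dD
  note R = FF[unfolded isf_iff] isf_rules
  have s': "s' = G \<circ>\<^sub>F s \<circ>\<^sub>F F1" by (simp add: s'_def F1_def)
  have Fs': "is_functor T C s'" unfolding s' isf_iff by (simp add: R)
  note Gs = functor_comp_func[OF s G]
  have s'': "is_functor (Simp C) C s'" using Fs' by (simp add: T_def)

  have cF: "F1 \<circ>\<^sub>F cC = cD \<circ>\<^sub>F F" unfolding F1_def cC_def cD_def by (rule post_const_func[OF F])
  have cF1: "F2 \<circ>\<^sub>F cT = cS \<circ>\<^sub>F F1" unfolding F2_def cT_def cS_def by (rule post_const_func[OF F1])
  have cs: "s1 \<circ>\<^sub>F cS = cD \<circ>\<^sub>F s" unfolding s1_def cS_def cD_def by (rule post_const_func[OF s])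
  have pcF: "F2 \<circ>\<^sub>F post \<Delta>op cC = post \<Delta>op cD \<circ>\<^sub>F F1"
    unfolding F2_def post_comp[OF category_Dop cC F1, symmetric] cF
    unfolding F1_def by (rule post_comp[OF category_Dop F cD])
  have dF: "diag_func D \<circ>\<^sub>F F2 = F1 \<circ>\<^sub>F diag_func C"
    unfolding F2_def F1_def by (rule post_diag_func[OF F])

  have sE: "AMap s ` EE \<subseteq> E" using S4 by (auto simp: S4_def EE_def objectwise_def)
  have GsE: "AMap (G \<circ>\<^sub>F s) ` EE \<subseteq> W"
  proof -
    have "EE \<subseteq> Arr S" by (auto simp: EE_def S_def objectwise_def)
    then show ?thesis using sE GE by (auto simp: R subset_eq)
  qed
  have cE: "AMap (s \<circ>\<^sub>F cD) ` E \<subseteq> E"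
  proof -
    have "AMap cD f \<in> EE" if "f \<in> E" for f
      using functor_ar[OF cD, of f] that EA by (auto simp: cD_def EE_def objectwise_def S_def)
    then show ?thesis using sE EA by (auto simp: R subset_eq)
  qed
  note FG = functor_comp_func[OF G F]
  have FGE: "AMap (F \<circ>\<^sub>F G) ` E \<subseteq> E" using FW GE EA by (auto simp: R subset_eq)

  have m: "nzig (Simp S) D E (s \<circ>\<^sub>F diag_func D) \<mu> (s \<circ>\<^sub>F s1)"
    using S2 by (simp add: S2_def we_zigzag_zig S_def s1_def)
  have l: "nzig D D E (s \<circ>\<^sub>F cD) lam (id_func D)"
    using S3 by (simp add: S3_def we_zigzag_zig cD_def)
  have lr: "nzig S D E (s \<circ>\<^sub>F cD \<circ>\<^sub>F s) (wr lam s) s" using nzig_wr[OF s l] by (simp add: R)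
  have pl: "nzig S S EE (s1 \<circ>\<^sub>F post \<Delta>op cD) (pn \<Delta>op lam) (id_func S)"
    using nzig_pn[OF category_Dop l] post_comp[OF category_Dop cD s]
    by (simp add: post_id[OF category_Dop CD(2)] S_def EE_def s1_def)
  have spl: "nzig S D E (s \<circ>\<^sub>F s1 \<circ>\<^sub>F post \<Delta>op cD) (wl s (pn \<Delta>op lam)) s" using nzig_wl[OF s sE pl] by (simp add: R)
  have mc: "nzig S D E s (wr \<mu> cS) (s \<circ>\<^sub>F cD \<circ>\<^sub>F s)"
    using nzig_wr[OF cS m] by (simp add: R cs diag_const[OF CD(2), folded S_def cS_def])
  have mp: "nzig S D E s (wr \<mu> (post \<Delta>op cD)) (s \<circ>\<^sub>F s1 \<circ>\<^sub>F post \<Delta>op cD)"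
    using nzig_wr[OF pcD m] by (simp add: R diag_post_const[OF CD(2), folded S_def cD_def])
  have D1: "nzeq S D E s s (wr \<mu> cS @ wr lam s) []"
    using S3 s zig_append[OF mc lr] by (simp add: S3_def is_identity_of_iff zeq_def S_def cS_def zig_Nil)
  have D2: "nzeq S D E s s (wr \<mu> (post \<Delta>op cD) @ wl s (pn \<Delta>op lam)) []"
    using S3 s zig_append[OF mp spl] by (simp add: S3_def is_identity_of_iff zeq_def S_def cD_def zig_Nil wmap_comp)

  have pb: "nzig S S EE (F1 \<circ>\<^sub>F G1) (pn \<Delta>op \<beta>) (id_func S)"
    using nzig_pn[OF category_Dop b] post_comp[OF category_Dop G F]
    by (simp add: post_id[OF category_Dop CD(2)] S_def EE_def F1_def G1_def)
  note s1F2 = functor_comp_func[OF F2 s1]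
  define B where "B = wr (pn \<Delta>op \<beta>) (s1 \<circ>\<^sub>F F2)"
  have B: "nzig (Simp T) S EE (F1 \<circ>\<^sub>F G1 \<circ>\<^sub>F s1 \<circ>\<^sub>F F2) B (s1 \<circ>\<^sub>F F2)"
    unfolding B_def using nzig_wr[OF s1F2 pb] by (simp add: R)
  have mF: "nzig (Simp T) D E (s \<circ>\<^sub>F F1 \<circ>\<^sub>F diag_func C) (wr \<mu> F2) (s \<circ>\<^sub>F s1 \<circ>\<^sub>F F2)"
    using nzig_wr[OF F2 m] by (simp add: R dF)
  have lF: "nzig C D E (s \<circ>\<^sub>F cD \<circ>\<^sub>F F) (wr lam F) F"
    using nzig_wr[OF F l] by (simp add: R)
  have GB: "nzig (Simp T) C W (G \<circ>\<^sub>F s \<circ>\<^sub>F F1 \<circ>\<^sub>F G1 \<circ>\<^sub>F s1 \<circ>\<^sub>F F2) (wl (G \<circ>\<^sub>F s) B) (G \<circ>\<^sub>F s \<circ>\<^sub>F s1 \<circ>\<^sub>F F2)"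
    using nzig_wl[OF Gs GsE B] by (simp add: R)
  \<comment> \<open>\<open>\<mu>'\<close> is \<open>G s F1 diag = G s diag F2 \<rightarrow> G s s1 F2 \<leftarrow> G s F1 G1 s1 F2\<close>.\<close>
  define \<mu>' where "\<mu>' = wl G (wr \<mu> F2) @ winv (wl (G \<circ>\<^sub>F s) B)"
  define lam' where "lam' = wl G (wr lam F) @ \<alpha>"
  have ps': "post \<Delta>op s' = G1 \<circ>\<^sub>F s1 \<circ>\<^sub>F F2"
    using post_comp[OF category_Dop F1 Gs] post_comp[OF category_Dop s G] comp_func_assoc[OF F2 s1, of G1]
    by (simp add: s' R(1-9) isf_rules G1_def s1_def F2_def)
  have catST: "category (Simp T)" by (rule category_FunCat[OF category_Dop catT])
  have m': "nzig (Simp T) C W (s' \<circ>\<^sub>F diag_func C) \<mu>' (s' \<circ>\<^sub>F post \<Delta>op s')"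
    unfolding \<mu>'_def
    using zig_append[OF nzig_wl[OF G GE mF] zig_winv[OF category_FunCat[OF catST CD(1)] GB]]
    by (simp add: R s' ps'[unfolded s'])
  have l': "nzig C C W (s' \<circ>\<^sub>F cC) lam' (id_func C)"
    unfolding lam'_def using zig_append[OF nzig_wl[OF G GE lF] a] by (simp add: R s' cF)
  have XTC: "category (FunCat T C)" and XSD: "category (FunCat S D)" and XTD: "category (FunCat T D)"
    and XDD: "category (FunCat D D)"
    using category_FunCat catT catS CD by blast+

  \<comment> \<open>First compatibility, with \<open>K = s F1\<close>: after moving \<open>\<beta>K\<close> past \<open>\<lambda>\<close>, the zigzags of \<open>D\<close> cancel and what
    remains is the inverse of \<open>G\<beta>K\<close> followed by \<open>\<alpha>GK\<close>.\<close>
  define K where "K = s \<circ>\<^sub>F F1"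
  have K: "is_functor T D K" unfolding K_def by (rule functor_comp_func[OF F1 s])
  note GK = functor_comp_func[OF K G] and FGK = functor_comp_func[OF K FG]
  note scD = functor_comp_func[OF cD s]
  note RK = K[unfolded isf_iff]
  have s'K: "s' = G \<circ>\<^sub>F K" by (simp add: s' K_def)
  have bK: "nzig T D E (F \<circ>\<^sub>F G \<circ>\<^sub>F K) (wr \<beta> K) K" using nzig_wr[OF K b] by (simp add: R RK)
  have lK: "nzig T D E (s \<circ>\<^sub>F cD \<circ>\<^sub>F K) (wr lam K) K" using nzig_wr[OF K l] by (simp add: R RK)
  have lFGK: "nzig T D E (s \<circ>\<^sub>F cD \<circ>\<^sub>F F \<circ>\<^sub>F G \<circ>\<^sub>F K) (wr lam (F \<circ>\<^sub>F G \<circ>\<^sub>F K)) (F \<circ>\<^sub>F G \<circ>\<^sub>F K)"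
    using nzig_wr[OF FGK l] by (simp add: R RK)
  have cbK: "nzig T D E (s \<circ>\<^sub>F cD \<circ>\<^sub>F F \<circ>\<^sub>F G \<circ>\<^sub>F K) (wl (s \<circ>\<^sub>F cD) (wr \<beta> K)) (s \<circ>\<^sub>F cD \<circ>\<^sub>F K)"
    using nzig_wl[OF scD cE bK] by (simp add: R RK)
  have mK: "nzig T D E K (wr (wr \<mu> cS) F1) (s \<circ>\<^sub>F cD \<circ>\<^sub>F K)"
    using nzig_wr[OF F1 mc] by (simp add: R K_def)
  have sq1: "nzeq T D E (s \<circ>\<^sub>F cD \<circ>\<^sub>F K) (F \<circ>\<^sub>F G \<circ>\<^sub>F K)
      (winv (wl (s \<circ>\<^sub>F cD) (wr \<beta> K)) @ wr lam (F \<circ>\<^sub>F G \<circ>\<^sub>F K)) (wr lam K @ winv (wr \<beta> K))"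
    by (rule zeq_rotate[OF XTD _ cbK lK lFGK bK])
      (use interchange[OF RD EA bK l cE] in \<open>simp add: R RK wl_id[OF bK]\<close>)
  have w1: "wr \<mu>' cT = wl G (wr (wr \<mu> cS) F1) @ winv (wl G (wl (s \<circ>\<^sub>F cD) (wr \<beta> K)))"
  proof -
    have "wr B cT = wr (pn \<Delta>op \<beta>) (s1 \<circ>\<^sub>F F2 \<circ>\<^sub>F cT)"
      unfolding B_def by (simp add: wr_wr[OF pb s1F2 cT] R)
    also have "s1 \<circ>\<^sub>F F2 \<circ>\<^sub>F cT = cD \<circ>\<^sub>F K"
      using comp_func_assoc[OF F1 cS, of s1] comp_func_assoc[OF F1 s, of cD] by (simp add: cF1 cs K_def)
    also have "wr (pn \<Delta>op \<beta>) (cD \<circ>\<^sub>F K) = wr (wr (pn \<Delta>op \<beta>) cD) K"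
      by (rule wr_wr[OF pb cD K, symmetric])
    also have "wr (pn \<Delta>op \<beta>) cD = wl cD \<beta>" unfolding cD_def by (rule pn_const[OF b])
    also have "wr (wl cD \<beta>) K = wl cD (wr \<beta> K)" by (rule wr_wl[OF b K cD])
    finally have "wl (G \<circ>\<^sub>F s) (wr B cT) = wl G (wl (s \<circ>\<^sub>F cD) (wr \<beta> K))"
      by (simp add: wl_wl[OF bK cD Gs] wl_wl[OF bK scD G] R)
    moreover have "wr (wl G (wr \<mu> F2)) cT = wl G (wr (wr \<mu> cS) F1)"
      by (simp add: wr_wl[OF mF cT G] wr_wr[OF m F2 cT] wr_wr[OF m cS F1] cF1)
    ultimately show ?thesis by (simp add: \<mu>'_def wmap_winv wr_wl[OF B cT Gs])
  qed
  have w2: "wr lam' s' = wl G (wr lam (F \<circ>\<^sub>F G \<circ>\<^sub>F K)) @ wr \<alpha> (G \<circ>\<^sub>F K)"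
    by (simp add: lam'_def s'K wr_wl[OF lF GK G] wr_wr[OF l F GK])
  have w3: "wr (wr \<alpha> G) K = wr \<alpha> (G \<circ>\<^sub>F K)" by (rule wr_wr[OF a G K])
  have w4: "wr (wl G \<beta>) K = wl G (wr \<beta> K)" by (rule wr_wl[OF b K G])
  have GKz: "nzig T C W (G \<circ>\<^sub>F F \<circ>\<^sub>F G \<circ>\<^sub>F K) (wr \<alpha> (G \<circ>\<^sub>F K)) (G \<circ>\<^sub>F K)"
    using nzig_wr[OF GK a] by (simp add: R RK)
  have Gbz: "nzig T C W (G \<circ>\<^sub>F F \<circ>\<^sub>F G \<circ>\<^sub>F K) (wl G (wr \<beta> K)) (G \<circ>\<^sub>F K)"
    by (rule nzig_wl[OF G GE bK])
  have "nzeq T C W (G \<circ>\<^sub>F K) (G \<circ>\<^sub>F K) (wr \<mu>' cT @ wr lam' s') []"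
  proof -
    have "wr \<mu>' cT @ wr lam' s' = wl G (wr (wr \<mu> cS) F1) @
        (wl G (winv (wl (s \<circ>\<^sub>F cD) (wr \<beta> K)) @ wr lam (F \<circ>\<^sub>F G \<circ>\<^sub>F K)) @ wr \<alpha> (G \<circ>\<^sub>F K))"
      by (simp add: w1 w2 wmap_winv)
    also have "nzeq T C W (G \<circ>\<^sub>F K) (G \<circ>\<^sub>F K) \<dots>
       (wl G (wr (wr \<mu> cS) F1) @ (wl G (wr lam K @ winv (wr \<beta> K)) @ wr \<alpha> (G \<circ>\<^sub>F K)))"
      by (rule zeq_append_left[OF nzig_wl[OF G GE mK] zeq_append_right[OF nzeq_wl[OF G GE sq1] GKz]])
    also have "wl G (wr (wr \<mu> cS) F1) @ (wl G (wr lam K @ winv (wr \<beta> K)) @ wr \<alpha> (G \<circ>\<^sub>F K))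
       = wl G (wr (wr \<mu> cS @ wr lam s) F1) @ winv (wl G (wr \<beta> K)) @ wr \<alpha> (G \<circ>\<^sub>F K)"
      by (simp add: wmap_winv wr_wr[OF l s F1] K_def)
    also have "nzeq T C W (G \<circ>\<^sub>F K) (G \<circ>\<^sub>F K) \<dots> (wl G (wr [] F1) @ [])"
    proof (rule zeq_append)
      show "nzeq T C W (G \<circ>\<^sub>F K) (G \<circ>\<^sub>F K) (wl G (wr (wr \<mu> cS @ wr lam s) F1)) (wl G (wr [] F1))"
        using nzeq_wl[OF G GE nzeq_wr[OF F1 D1]] by (simp add: K_def)
      have e: "nzeq T C W (G \<circ>\<^sub>F F \<circ>\<^sub>F G \<circ>\<^sub>F K) (G \<circ>\<^sub>F K) (wr \<alpha> (G \<circ>\<^sub>F K)) (wl G (wr \<beta> K))"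
        using zeq_sym[OF nzeq_wr[OF K tri1]] by (simp add: w3 w4 R RK)
      show "nzeq T C W (G \<circ>\<^sub>F K) (G \<circ>\<^sub>F K) (winv (wl G (wr \<beta> K)) @ wr \<alpha> (G \<circ>\<^sub>F K)) []"
        using zeq_trans[OF zeq_append_left[OF zig_winv[OF XTC Gbz] e] zeq_winv_left[OF XTC Gbz]] .
    qed
    finally show ?thesis by simp
  qed
  then have id1: "is_identity_of C W s' (wr \<mu>' cT @ wr lam' s')"
    unfolding is_identity_of_iff[OF s''] by (simp add: zeq_def s'K T_def)

  \<comment> \<open>Second compatibility: this time \<open>\<lambda>\<close> is moved past \<open>\<beta>\<close> levelwise, that is, under \<open>\<Phi>\<close>, and what remains is
    the inverse of \<open>G s (\<beta>F)\<^sub>*\<close> followed by \<open>G s (F\<alpha>)\<^sub>*\<close>.\<close>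
  have FGl: "nzig D D E (F \<circ>\<^sub>F G \<circ>\<^sub>F s \<circ>\<^sub>F cD) (wl (F \<circ>\<^sub>F G) lam) (F \<circ>\<^sub>F G)"
    using nzig_wl[OF FG FGE l] by (simp add: R)
  have bsc: "nzig D D E (F \<circ>\<^sub>F G \<circ>\<^sub>F s \<circ>\<^sub>F cD) (wr \<beta> (s \<circ>\<^sub>F cD)) (s \<circ>\<^sub>F cD)"
    using nzig_wr[OF scD b] by (simp add: R)
  have sq2: "nzeq D D E (s \<circ>\<^sub>F cD) (F \<circ>\<^sub>F G)
      (winv (wr \<beta> (s \<circ>\<^sub>F cD)) @ wl (F \<circ>\<^sub>F G) lam) (lam @ winv \<beta>)"
    by (rule zeq_rotate[OF XDD _ bsc l FGl b])
      (use zeq_sym[OF interchange[OF RD EA l b FGE]] in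
        \<open>simp add: R wl_id[OF l] wr_id[OF b] functor_id_func[OF CD(2), unfolded isf_iff]\<close>)
  define \<Phi> :: "('o2, 'm2, 'o2, 'm2) nattrans letter list \<Rightarrow> _" where "\<Phi> z = wl (G \<circ>\<^sub>F s) (wr (pn \<Delta>op z) F1)" for z
  have \<Phi>_zeq: "nzeq T C W ((G \<circ>\<^sub>F s) \<circ>\<^sub>F (post \<Delta>op P \<circ>\<^sub>F F1)) ((G \<circ>\<^sub>F s) \<circ>\<^sub>F (post \<Delta>op Q \<circ>\<^sub>F F1)) (\<Phi> u) (\<Phi> v)"
    if "nzeq D D E P Q u v" for P Q u v
  proof -
    have "nzeq S S EE (post \<Delta>op P) (post \<Delta>op Q) (pn \<Delta>op u) (pn \<Delta>op v)"
      using nzeq_pn[OF category_Dop that] by (simp add: S_def EE_def)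
    then show ?thesis unfolding \<Phi>_def by (rule nzeq_wl[OF Gs GsE nzeq_wr[OF F1]])
  qed
  have pFG: "post \<Delta>op (F \<circ>\<^sub>F G) = F1 \<circ>\<^sub>F G1"
    unfolding F1_def G1_def by (rule post_comp[OF category_Dop G F])
  have pscD: "post \<Delta>op (s \<circ>\<^sub>F cD) = s1 \<circ>\<^sub>F post \<Delta>op cD"
    unfolding s1_def by (rule post_comp[OF category_Dop cD s])
  have pFGF: "post \<Delta>op (F \<circ>\<^sub>F G \<circ>\<^sub>F F) = F1 \<circ>\<^sub>F G1 \<circ>\<^sub>F F1"
    unfolding F1_def G1_def post_comp[OF category_Dop F G, symmetric]
    by (rule post_comp[OF category_Dop functor_comp_func[OF F G] F])
  have pid: "post \<Delta>op (id_func D) = id_func S"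
    unfolding S_def by (rule post_id[OF category_Dop CD(2)])
  have sq2': "nzeq T C W (G \<circ>\<^sub>F s \<circ>\<^sub>F s1 \<circ>\<^sub>F post \<Delta>op cD \<circ>\<^sub>F F1) (G \<circ>\<^sub>F s \<circ>\<^sub>F F1 \<circ>\<^sub>F G1 \<circ>\<^sub>F F1)
     (\<Phi> (winv (wr \<beta> (s \<circ>\<^sub>F cD)) @ wl (F \<circ>\<^sub>F G) lam)) (\<Phi> (lam @ winv \<beta>))"
    using \<Phi>_zeq[OF sq2] by (simp add: pFG pscD R)
  let ?Y = "wl (G \<circ>\<^sub>F s) (pn \<Delta>op (wl F \<alpha>))"
  have \<Phi>b: "\<Phi> \<beta> = wl (G \<circ>\<^sub>F s) (pn \<Delta>op (wr \<beta> F))"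
    unfolding \<Phi>_def F1_def by (simp add: pn_wr[OF category_Dop b F])
  have \<Phi>bz: "nzig T C W (G \<circ>\<^sub>F s \<circ>\<^sub>F F1 \<circ>\<^sub>F G1 \<circ>\<^sub>F F1) (\<Phi> \<beta>) (G \<circ>\<^sub>F s \<circ>\<^sub>F F1)"
    unfolding \<Phi>_def using nzig_wl[OF Gs GsE nzig_wr[OF F1 pb]] by (simp add: R)
  have Y: "nzeq T C W (G \<circ>\<^sub>F s \<circ>\<^sub>F F1 \<circ>\<^sub>F G1 \<circ>\<^sub>F F1) (G \<circ>\<^sub>F s \<circ>\<^sub>F F1) ?Y (\<Phi> \<beta>)"
  proof -
    have "nzeq T S EE (F1 \<circ>\<^sub>F G1 \<circ>\<^sub>F F1) F1 (pn \<Delta>op (wr \<beta> F)) (pn \<Delta>op (wl F \<alpha>))"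
      using nzeq_pn[OF category_Dop tri2] unfolding pFGF by (simp add: S_def T_def EE_def F1_def)
    from zeq_sym[OF nzeq_wl[OF Gs GsE this]] show ?thesis by (simp add: \<Phi>b R)
  qed
  have w1': "wr \<mu>' (post \<Delta>op cC) = wl G (wr (wr \<mu> (post \<Delta>op cD)) F1) @ winv (\<Phi> (wr \<beta> (s \<circ>\<^sub>F cD)))"
  proof -
    note pscD' = functor_comp_func[OF pcD s1]
    have "wr B (post \<Delta>op cC) = wr (pn \<Delta>op \<beta>) ((s1 \<circ>\<^sub>F post \<Delta>op cD) \<circ>\<^sub>F F1)"
      unfolding B_def by (simp add: wr_wr[OF pb s1F2 pcC] R pcF)
    also have "\<dots> = wr (wr (pn \<Delta>op \<beta>) (s1 \<circ>\<^sub>F post \<Delta>op cD)) F1"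
      by (rule wr_wr[OF pb pscD' F1, symmetric])
    also have "wr (pn \<Delta>op \<beta>) (s1 \<circ>\<^sub>F post \<Delta>op cD) = pn \<Delta>op (wr \<beta> (s \<circ>\<^sub>F cD))"
      by (simp add: pn_wr[OF category_Dop b scD] pscD)
    finally have "wl (G \<circ>\<^sub>F s) (wr B (post \<Delta>op cC)) = \<Phi> (wr \<beta> (s \<circ>\<^sub>F cD))" by (simp add: \<Phi>_def)
    moreover have "wr (wl G (wr \<mu> F2)) (post \<Delta>op cC) = wl G (wr (wr \<mu> (post \<Delta>op cD)) F1)"
      by (simp add: wr_wl[OF mF pcC G] wr_wr[OF m F2 pcC] wr_wr[OF m pcD F1] pcF)
    ultimately show ?thesis by (simp add: \<mu>'_def wmap_winv wr_wl[OF B pcC Gs])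
  qed
  have w2': "wl s' (pn \<Delta>op lam') = \<Phi> (wl (F \<circ>\<^sub>F G) lam) @ ?Y"
  proof -
    let ?X = "wr (pn \<Delta>op lam) F1"
    note X = nzig_wr[OF F1 pl]
    note FG1 = functor_comp_func[OF G1 F1]
    have "pn \<Delta>op (wl G (wr lam F)) = wl G1 ?X"
      by (simp add: pn_wl[OF category_Dop lF G] pn_wr[OF category_Dop l F] G1_def F1_def)
    then have "wl s' (pn \<Delta>op (wl G (wr lam F))) = wl (G \<circ>\<^sub>F s \<circ>\<^sub>F F1 \<circ>\<^sub>F G1) ?X"
      by (simp add: wl_wl[OF X G1 Fs']) (simp add: s' R)
    also have "\<dots> = wl (G \<circ>\<^sub>F s) (wl (F1 \<circ>\<^sub>F G1) ?X)"
      by (simp add: wl_wl[OF X FG1 Gs] R)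
    also have "wl (F1 \<circ>\<^sub>F G1) ?X = wr (pn \<Delta>op (wl (F \<circ>\<^sub>F G) lam)) F1"
      by (simp add: pn_wl[OF category_Dop l FG] pFG wr_wl[OF pl F1 FG1])
    finally have 1: "wl s' (pn \<Delta>op (wl G (wr lam F))) = \<Phi> (wl (F \<circ>\<^sub>F G) lam)" by (simp add: \<Phi>_def)
    have pa: "nzig T T (objectwise \<Delta>op C W) (post \<Delta>op (G \<circ>\<^sub>F F)) (pn \<Delta>op \<alpha>) (post \<Delta>op (id_func C))"
      using nzig_pn[OF category_Dop a] by (simp add: T_def)
    have "?Y = wl (G \<circ>\<^sub>F s) (wl F1 (pn \<Delta>op \<alpha>))"
      by (simp add: pn_wl[OF category_Dop a F] F1_def)
    also have "\<dots> = wl s' (pn \<Delta>op \<alpha>)"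
      by (simp add: wl_wl[OF pa F1 Gs]) (simp add: s' R)
    finally show ?thesis using 1 by (simp add: lam'_def)
  qed
  let ?A = "wl G (wr (wr \<mu> (post \<Delta>op cD)) F1)"
  have A: "nzig T C W (G \<circ>\<^sub>F s \<circ>\<^sub>F F1) ?A (G \<circ>\<^sub>F s \<circ>\<^sub>F s1 \<circ>\<^sub>F post \<Delta>op cD \<circ>\<^sub>F F1)"
    using nzig_wl[OF G GE nzig_wr[OF F1 mp]] by (simp add: R)
  have "nzeq T C W (G \<circ>\<^sub>F s \<circ>\<^sub>F F1) (G \<circ>\<^sub>F s \<circ>\<^sub>F F1) (wr \<mu>' (post \<Delta>op cC) @ wl s' (pn \<Delta>op lam')) []"
  proof -
    have "wr \<mu>' (post \<Delta>op cC) @ wl s' (pn \<Delta>op lam')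
        = ?A @ (\<Phi> (winv (wr \<beta> (s \<circ>\<^sub>F cD)) @ wl (F \<circ>\<^sub>F G) lam) @ ?Y)"
      by (simp add: w1' w2' \<Phi>_def wmap_winv)
    also have "nzeq T C W (G \<circ>\<^sub>F s \<circ>\<^sub>F F1) (G \<circ>\<^sub>F s \<circ>\<^sub>F F1) \<dots> (?A @ (\<Phi> (lam @ winv \<beta>) @ \<Phi> \<beta>))"
      by (rule zeq_append_left[OF A zeq_append[OF sq2' Y]])
    also have "?A @ (\<Phi> (lam @ winv \<beta>) @ \<Phi> \<beta>)
        = wl G (wr (wr \<mu> (post \<Delta>op cD) @ wl s (pn \<Delta>op lam)) F1) @ (winv (\<Phi> \<beta>) @ \<Phi> \<beta>)"
      by (simp add: \<Phi>_def wmap_winv wr_wl[OF pl F1 s] wl_wl[OF nzig_wr[OF F1 pl] s G])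
    also have "nzeq T C W (G \<circ>\<^sub>F s \<circ>\<^sub>F F1) (G \<circ>\<^sub>F s \<circ>\<^sub>F F1) \<dots> (wl G (wr [] F1) @ [])"
      by (rule zeq_append[OF nzeq_wl[OF G GE nzeq_wr[OF F1 D2]] zeq_winv_left[OF XTC \<Phi>bz]])
    finally show ?thesis by simp
  qed
  then have id2: "is_identity_of C W s' (wr \<mu>' (post \<Delta>op cC) @ wl s' (pn \<Delta>op lam'))"
    unfolding is_identity_of_iff[OF s''] by (simp add: zeq_def s' T_def)
  have "S2 C W s' \<mu>'" using m' by (simp add: S2_def we_zigzag_zig T_def)
  moreover have "S3 C W s' \<mu>' lam'"
    using l' id1 id2 by (simp add: S3_def we_zigzag_zig cC_def cT_def T_def wmap_comp)
  ultimately show ?thesis unfolding s'_def by blast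
qed

theorem proposition1p8:
  fixes C :: "('o1, 'm1) category" and W :: "'m1 set"
    and D :: "('o2, 'm2) category" and E :: "'m2 set"
  assumes "relative_category C W" and "closed_by_finite_coproducts C W"
    and "relative_category D E" and "closed_by_finite_coproducts D E"
    and "homotopically_equivalent C W D E"
    and "simplicial_descent_category D E"
  shows "simplicial_descent_category C W"
proof -
  obtain F G \<beta>0 \<alpha> where he: "homotopical_equivalence C W D E F G \<beta>0 \<alpha>"
    using assms(5) unfolding homotopically_equivalent_def by blast
  then have F: "is_functor C D F" and G: "is_functor D C G"
    and FW: "AMap F ` W \<subseteq> E" and GE: "AMap G ` E \<subseteq> W"
    and b0: "nzig D D E (F \<circ>\<^sub>F G) \<beta>0 (id_func D)" and a: "nzig C C W (G \<circ>\<^sub>F F) \<alpha> (id_func C)"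
    unfolding homotopical_equivalence_def we_zigzag_zig by blast+
  obtain s \<mu> lam where "simplicial_descent_structure D E s \<mu> lam"
    using assms(6) unfolding simplicial_descent_category_def by blast
  then have S: "S1 D E s" "S2 D E s \<mu>" "S3 D E s \<mu> lam" "S4 D E s" "S5 D E s"
    unfolding simplicial_descent_structure_def by blast+
  have s: "is_functor (Simp D) D s" using S(1) by (simp add: S1_def)
  have fc: "has_finite_coproducts C" "has_finite_coproducts D"
    using assms(2,4) unfolding closed_by_finite_coproducts_def by blast+
  note preserves = equivalence_preserves_coproducts[OF assms(1,3,2,4) F G FW a b0]
    equivalence_preserves_coproducts[OF assms(3,1,4,2) G F GE b0 a]
  obtain \<beta> where "nzig D D E (F \<circ>\<^sub>F G) \<beta> (id_func D)"
    "nzeq D C W (G \<circ>\<^sub>F F \<circ>\<^sub>F G) G (wl G \<beta>) (wr \<alpha> G)" "nzeq C D E (F \<circ>\<^sub>F G \<circ>\<^sub>F F) F (wr \<beta> F) (wl F \<alpha>)"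
    using adjoint_zigzags[OF assms(1,3) F G FW GE a b0] by blast
  from transport_S2_S3[OF assms(1,3) F G FW GE a this s S(2,3,4)]
  obtain \<mu>' lam' where "S2 C W (G \<circ>\<^sub>F s \<circ>\<^sub>F post \<Delta>op F) \<mu>'" "S3 C W (G \<circ>\<^sub>F s \<circ>\<^sub>F post \<Delta>op F) \<mu>' lam'"
    by blast
  moreover have "S1 C W (G \<circ>\<^sub>F s \<circ>\<^sub>F post \<Delta>op F)"
    by (rule transport_S1[OF assms(1,3) fc F G GE preserves S(1,4)]) simp_all
  moreover have "S4 C W (G \<circ>\<^sub>F s \<circ>\<^sub>F post \<Delta>op F)" by (rule transport_S4[OF F G FW GE s S(4)])
  moreover have "S5 C W (G \<circ>\<^sub>F s \<circ>\<^sub>F post \<Delta>op F)"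
    by (rule transport_S5[OF assms(3) fc(2) F G GE preserves(1) s S(4,5)])
  ultimately show ?thesis
    using assms(1,2) unfolding simplicial_descent_category_def simplicial_descent_structure_def by blast
qed

end
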